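(* Let $n \ge 2$ and let $1\le i<j\le n$. Then $$c_{i,j}(n)=\begin{cases} \dfrac{n}{\binom{n+j}{2}}, & \text{if } i+1 < j \leq n, \\[2ex] \dfrac{n}{\binom{n+j}{2}}+\dfrac{ni}{\binom{n+i}{2}}, & \text{if } i+1 = j \leq n. \end{cases}$$
   Context: Continuous multiline queues. Let $m=(m_1,\ldots,m_n)$ be a tuple of nonnegative integers, $S_i=m_1+\cdots+m_i$ and $N=S_1+\cdots+S_n$. A continuous multiline queue (identified with its placement) of type $m$ is an array $M$ with $n$ rows in which row $i$ is a strictly increasing sequence $M_{i,1}<\cdots<M_{i,S_i}$ of integers and the $N$ entries of $M$ are exactly the integers $1,\ldots,N$, each used once. Bully path procedure. Initially all entries are available. For $r=1,\ldots,n-1$ in turn: every entry of row $r$ that is still available starts a bully path. An entry $x$ of row $r'$ on the path bullies (written $x\to y$) the entry $y$ of row $r'+1$ which is the smallest available entry of row $r'+1$ larger than $x$; if no available entry of row $r'+1$ is larger than $x$, it bullies the smallest available entry of row $r'+1$ (a wrapping). Bullied entries become unavailable, the path continues from $y$ down to row $n$, and its endpoint in row $n$ receives label $r$ (entries on the path, including the starting one, become unavailable). The labels do not depend on the order in which paths starting in a given row are constructed. Finally, the entries of row $n$ still available receive label $n$. The projected word is $\omega=\mathbf{B}(M)=(\omega_1,\ldots,\omega_{S_n})$, where $\omega_k$ is the label of $M_{n,k}$; it is read cyclically. Correlations. For the type $(1,1,\ldots,1)$ ($n$ ones), each label $1,\ldots,n$ appears exactly once in the projected word (of length $n$). Choose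 a continuous multiline queue $M$ of type $(1,\ldots,1)$ uniformly at random and let $\omega=\mathbf{B}(M)$. Define $c_{i,j}(n)$ as the probability that in the cyclic word $\omega$ the letter $i$ is immediately followed by the letter $j$, i.e. $\omega_a=i$ and $\omega_{a+1}=j$ for some $a\in[n]$ (indices mod $n$). (This is the two-point correlation of adjacent particles $i$, $j$ in the continuous multispecies TASEP on a ring of type $(1,\ldots,1)$, whose distribution equals the law of the projected word of a uniformly random continuous multiline queue.) *)

theory Defs
  imports "HOL-Probability.Probability"
begin

text \<open>
  The type \<open>m = (m\<^sub>1, \<dots>, m\<^sub>n)\<close> is a list of naturals and an array is the list of its rows. List
  positions start at 0, so row \<open>i\<close> of the array \<open>M\<close> is \<open>M ! (i - 1)\<close>; labels are numbered from 1.
\<close>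

definition row_size :: "nat list \<Rightarrow> nat \<Rightarrow> nat" where
  "row_size m i = (\<Sum>k<i. m ! k)"

definition num_entries :: "nat list \<Rightarrow> nat" where
  "num_entries m = (\<Sum>i=1..length m. row_size m i)"

definition continuous_mlq :: "nat list \<Rightarrow> nat list list set" where
  "continuous_mlq m = {M. length M = length m \<and>
     (\<forall>i\<in>{1..length m}. length (M ! (i - 1)) = row_size m i \<and> sorted_wrt (<) (M ! (i - 1))) \<and>
     distinct (concat M) \<and> set (concat M) = {1..num_entries m}}"

text \<open>
  The set \<open>A\<close> is the set of available entries of all rows. Since the row sizes weakly
  increase, a path arriving at a row always finds an available entry there, so the \<open>Min\<close> below is
  never applied to the empty set.
\<close>

definition bullied :: "nat set \<Rightarrow> nat list \<Rightarrow> nat \<Rightarrow> nat" where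
  "bullied A R x =
     (if \<exists>y \<in> A \<inter> set R. x < y then Min {y \<in> A \<inter> set R. x < y} else Min (A \<inter> set R))"

text \<open>
  \<open>bully_path A x Rs\<close> continues a path from \<open>x\<close> through \<open>Rs\<close>, the rows below the one containing
  \<open>x\<close>; it returns the endpoint and the entries that remain available.
\<close>

fun bully_path :: "nat set \<Rightarrow> nat \<Rightarrow> nat list list \<Rightarrow> nat \<times> nat set" where
  "bully_path A x [] = (x, A)"
| "bully_path A x (R # Rs) =
     (let y = bullied A R x in bully_path (A - {y}) y Rs)"

text \<open>The state consists of the available entries and the labels assigned so far.\<close>

definition start_path ::
  "nat list list \<Rightarrow> nat \<Rightarrow> nat \<Rightarrow> nat set \<times> (nat \<Rightarrow> nat) \<Rightarrow> nat set \<times> (nat \<Rightarrow> nat)" where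
  "start_path M r x = (\<lambda>(A, L).
     if x \<in> A then (let (y, A') = bully_path (A - {x}) x (drop r M) in (A', L(y := r)))
     else (A, L))"

text \<open>
  The paths starting in a given row are constructed from left to right; the resulting labels do not
  depend on this order.
\<close>

definition process_row ::
  "nat list list \<Rightarrow> nat \<Rightarrow> nat set \<times> (nat \<Rightarrow> nat) \<Rightarrow> nat set \<times> (nat \<Rightarrow> nat)" where
  "process_row M r = fold (start_path M r) (M ! (r - 1))"

definition bully_label :: "nat list list \<Rightarrow> nat \<Rightarrow> nat" where
  "bully_label M y =
     (let (A, L) = fold (process_row M) [1..<length M] (set (concat M), \<lambda>_. 0)
      in if y \<in> A then length M else L y)"

definition projected_word :: "nat list list \<Rightarrow> nat list" where
  "projected_word M = map (bully_label M) (M ! (length M - 1))"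

definition cyclically_followed :: "nat list \<Rightarrow> nat \<Rightarrow> nat \<Rightarrow> bool" where
  "cyclically_followed w i j \<longleftrightarrow>
     (\<exists>a<length w. w ! a = i \<and> w ! (Suc a mod length w) = j)"

definition correlation :: "nat \<Rightarrow> nat \<Rightarrow> nat \<Rightarrow> real" where
  "correlation i j n =
     measure_pmf.prob (pmf_of_set (continuous_mlq (replicate n 1)))
       {M. cyclically_followed (projected_word M) i j}"

text \<open>The uniform distribution above is well-defined.\<close>

lemma finite_continuous_mlq: "finite (continuous_mlq m)"
proof -
  let ?R = "{xs. set xs \<subseteq> {1..num_entries m} \<and> length xs \<le> num_entries m}"
  have "continuous_mlq m \<subseteq> {M. set M \<subseteq> ?R \<and> length M = length m}"
  proof
    fix M assume M: "M \<in> continuous_mlq m"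
    have "xs \<in> ?R" if xs: "xs \<in> set M" for xs
    proof -
      have "set xs \<subseteq> {1..num_entries m}" "distinct xs"
        using M xs by (auto simp: continuous_mlq_def distinct_concat_iff)
      moreover from this have "length xs \<le> num_entries m"
        using card_mono[of "{1..num_entries m}" "set xs"] by (simp add: distinct_card)
      ultimately show ?thesis by simp
    qed
    then show "M \<in> {M. set M \<subseteq> ?R \<and> length M = length m}"
      using M by (auto simp: continuous_mlq_def)
  qed
  moreover have "finite ?R" by (rule finite_lists_length_le) simp
  ultimately show ?thesis
    using finite_lists_length_eq finite_subset by blast
qed

lemma continuous_mlq_nonempty: "continuous_mlq m \<noteq> {}"
proof -
  define T where "T k = (\<Sum>i=1..k. row_size m i)" for k
  define M where "M = map (\<lambda>k. [Suc (T k)..<Suc (T (Suc k))]) [0..<length m]"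
  have T_Suc: "T (Suc k) = T k + row_size m (Suc k)" for k
    by (simp add: T_def)
  have "concat (map (\<lambda>k. [Suc (T k)..<Suc (T (Suc k))]) [0..<l]) = [1..<Suc (T l)]" for l
  proof (induction l)
    case 0
    then show ?case by (simp add: T_def)
  next
    case (Suc l)
    have "[1..<Suc (T l)] @ [Suc (T l)..<Suc (T (Suc l))] = [1..<Suc (T (Suc l))]"
      using upt_add_eq_append[of 1 "Suc (T l)" "row_size m (Suc l)"] by (simp add: T_Suc)
    with Suc show ?case by simp
  qed
  then have c: "concat M = [1..<Suc (num_entries m)]"
    by (simp add: M_def num_entries_def T_def)
  have "length (M ! (i - 1)) = row_size m i \<and> sorted_wrt (<) (M ! (i - 1))"
    if "i \<in> {1..length m}" for i
    using that T_Suc[of "i - 1"] by (auto simp: M_def simp del: upt_Suc)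
  moreover have "length M = length m"
    by (simp add: M_def)
  moreover have "distinct (concat M)" "set (concat M) = {1..num_entries m}"
    unfolding c by auto
  ultimately have "M \<in> continuous_mlq m"
    unfolding continuous_mlq_def by blast
  then show ?thesis by blast
qed

end

theory Submission
  imports Defs
begin

text \<open>
  The positions of the entries are read cyclically. A row \<open>R\<close> serves the entries \<open>T\<close> of the row above
  it: \<open>served T R\<close> is the set of entries of \<open>R\<close> bullied by \<open>T\<close>, and the entries of the last row with label at
  most \<open>r\<close> are obtained from row \<open>r\<close> by passing through all the rows below it. Two facts about queues
  in tandem remove all but three rows: \<open>(T, R) \<mapsto> (dual_row T R, served T R)\<close> is a bijection with fixed union
  (Burke's theorem), and passing through \<open>T\<close> and then \<open>R\<close> is the same as passing through \<open>dual_row T R\<close>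
  and then \<open>served T R\<close> (interchangeability). So the sets of entries of row \<open>n\<close> with labels at most \<open>i\<close>
  and at most \<open>k\<close> have the same joint law as for three rows of sizes \<open>i\<close>, \<open>k\<close>, \<open>n\<close>.

  The correlation is a second difference of the expected numbers of places where a label at most \<open>i\<close> is
  followed by a label larger than \<open>k\<close>. These are \<open>i (n - k) / (n + k)\<close> for \<open>i < k\<close> and
  \<open>k (n - k + 1) / (n + k - 1)\<close> for \<open>i = k\<close>: after a rotation the label larger than \<open>k\<close> sits at the
  last position, and one counts words in three letters according to the final state of two queues. Symmetries
  between the letters reduce this to the words that leave the second queue empty, which the cycle lemma counts.
\<close>

section \<open>Serving one row by another\<close>

text \<open>Wrapping is the obstacle: on a circle a queue has no initial state, so no recursion
  along the positions is available. The first row may still wrap around inside the second, which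
  does no harm while i < k. Rows above row i drop out because row i is fully occupied once the paths
  from the first i rows are drawn. Rows between i and k act on one set only, which is a case for
  Burke's theorem. Rows below k act on two sets at once; interchangeability lifts such a row above
  row k, where it again acts on one set. For i < k the average is linear in i with slope (n - k) /
  (n + k). Off the diagonal the second difference is therefore the drop of this slope from k = j - 1
  to k = j, which is n / (n + j choose 2). For j = i + 1 the value at i = k enters; it exceeds the
  linear formula by n i / (n + i choose 2), the second summand of the theorem.\<close>

text \<open>\<open>btw x z y\<close>: going up cyclically from \<open>x\<close>, one meets \<open>z\<close> strictly before \<open>y\<close>; for \<open>x = y\<close> this means a full turn.\<close>

definition btw :: "nat \<Rightarrow> nat \<Rightarrow> nat \<Rightarrow> bool" where
  "btw x z y \<longleftrightarrow> x < z \<and> z < y \<or> z < y \<and> y \<le> x \<or> y \<le> x \<and> x < z"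

lemma btw_irrefl [simp]: "\<not> btw x x y" "\<not> btw x y y" "btw x z x \<longleftrightarrow> z \<noteq> x"
  unfolding btw_def by linarith+

lemma btw_total: "\<not> btw x z y \<Longrightarrow> x \<noteq> z \<Longrightarrow> x \<noteq> y \<Longrightarrow> z \<noteq> y \<Longrightarrow> btw z x y"
  unfolding btw_def by linarith

lemma btw_rotate: "btw x z y \<Longrightarrow> x \<noteq> y \<Longrightarrow> btw z y x"
  unfolding btw_def by linarith

lemma btw_trans_left: "btw u w v \<Longrightarrow> btw u z w \<Longrightarrow> u \<noteq> v \<Longrightarrow> btw u z v \<and> btw z w v"
  unfolding btw_def by linarith

lemma btw_trans_right: "btw u w v \<Longrightarrow> btw w z v \<Longrightarrow> u \<noteq> v \<Longrightarrow> btw u z v \<and> btw u w z"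
  unfolding btw_def by linarith

lemma not_btw_advance:
  "\<not> btw x z p \<Longrightarrow> \<not> btw x q p \<Longrightarrow> \<not> btw x z q \<Longrightarrow> z \<noteq> p \<Longrightarrow> q \<noteq> p \<Longrightarrow> \<not> btw p z q"
  unfolding btw_def by linarith

lemma not_btw_retreat:
  "\<not> btw v z p \<Longrightarrow> \<not> btw u z v \<Longrightarrow> \<not> btw u p v \<Longrightarrow> z \<noteq> v \<Longrightarrow> z \<noteq> u \<Longrightarrow> p \<noteq> u \<Longrightarrow> p \<noteq> v \<Longrightarrow>
    \<not> btw u z p"
  unfolding btw_def by linarith

lemma btw_move_mid: "btw x v y \<Longrightarrow> \<not> btw u x v \<Longrightarrow> x \<noteq> u \<Longrightarrow> y \<noteq> u \<Longrightarrow> btw x u y"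
  using btw_total[of x u y] btw_trans_right[of u x y v] btw_irrefl by metis

lemma btw_move_end: "btw x z v \<Longrightarrow> \<not> btw u z v \<Longrightarrow> x \<noteq> u \<Longrightarrow> x \<noteq> v \<Longrightarrow> z \<noteq> u \<Longrightarrow> btw x z u"
  using btw_total[of x z u] btw_rotate[of z x u] btw_trans_left[of x z v u] btw_irrefl by metis

text \<open>The body copies that of \<open>bullied\<close>, so the two agree by unfolding once S is
  the set of available entries of a row.\<close>

definition cnext :: "nat set \<Rightarrow> nat \<Rightarrow> nat" where
  "cnext S x = (if \<exists>y\<in>S. x < y then Min {y \<in> S. x < y} else Min S)"

lemma cnext_in: "finite S \<Longrightarrow> S \<noteq> {} \<Longrightarrow> cnext S x \<in> S"
  unfolding cnext_def using Min_in[of "{y \<in> S. x < y}"] by auto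

lemma not_btw_cnext:
  assumes "finite S" "z \<in> S"
  shows "\<not> btw x z (cnext S x)"
proof (cases "\<exists>y\<in>S. x < y")
  case True
  then have "cnext S x \<in> {y \<in> S. x < y}"
    using assms Min_in[of "{y \<in> S. x < y}"] by (auto simp: cnext_def simp del: Min_in Min_gr_iff)
  moreover have "cnext S x \<le> z" if "x < z"
    using True assms that unfolding cnext_def by auto
  ultimately show ?thesis by (auto simp: btw_def)
next
  case False
  then have "cnext S x \<in> S" "cnext S x \<le> z"
    unfolding cnext_def using assms by (auto intro: Min_in)
  with False assms show ?thesis by (auto simp: btw_def not_less)
qed

text \<open>Together with \<open>cnext_in\<close> and \<open>not_btw_cnext\<close> this describes
  \<open>cnext\<close> by the cyclic order alone. Since \<open>btw x z x\<close> means a full turn,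
  x is its own successor only if S = {x}.\<close>

lemma cnext_eqI:
  assumes "finite S" "y \<in> S" "\<And>z. z \<in> S \<Longrightarrow> \<not> btw x z y"
  shows "cnext S x = y"
proof -
  have "cnext S x \<in> S" "\<not> btw x y (cnext S x)" "\<not> btw x (cnext S x) y"
    using assms cnext_in[of S x] not_btw_cnext[of S y x] by auto
  then show ?thesis by (auto simp: btw_def)
qed

lemma cnext_subset:
  assumes "finite S" "S' \<subseteq> S" "cnext S x \<in> S'"
  shows "cnext S' x = cnext S x"
  using assms by (intro cnext_eqI) (auto intro: finite_subset dest: not_btw_cnext)

text \<open>Once its first choice p is gone, the search from x simply continues from p. Hence two
  arrivals that share their first choice also share their second.\<close>

lemma cnext_Diff_cnext:
  assumes "finite S" "S \<noteq> {}" "S - {cnext S x} \<noteq> {}"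
  shows "cnext (S - {cnext S x}) (cnext S x) = cnext (S - {cnext S x}) x"
proof (rule cnext_eqI)
  let ?p = "cnext S x" let ?q = "cnext (S - {?p}) x"
  show "?q \<in> S - {?p}" using assms cnext_in by (metis finite_Diff)
  fix z assume z: "z \<in> S - {?p}"
  have "\<not> btw x z ?p" "\<not> btw x ?q ?p" "\<not> btw x z ?q" "z \<noteq> ?p" "?q \<noteq> ?p"
    using assms z not_btw_cnext[of S z x] not_btw_cnext[of S ?q x] not_btw_cnext[of "S - {?p}" z x] \<open>?q \<in> S - {?p}\<close> by auto
  then show "\<not> btw ?p z ?q" by (metis not_btw_advance)
qed (use assms in auto)

section \<open>Serving a set of arrivals in arbitrary order\<close>

text \<open>The value on infinite sets makes the operations commute without side conditions, as the
  interpretation of \<open>comp_fun_commute\<close> requires.\<close>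

definition take_cnext :: "nat \<Rightarrow> nat set \<Rightarrow> nat set" where
  "take_cnext x S = (if finite S then S - {cnext S x} else S)"

text \<open>Different first choices do not interfere. Equal first choices lead to a common second
  choice, so either order removes the same two entries.\<close>

lemma take_cnext_commute: "take_cnext x (take_cnext y S) = take_cnext y (take_cnext x S)"
proof (cases "finite S \<and> S \<noteq> {}")
  case False
  then show ?thesis by (auto simp: take_cnext_def)
next
  case True
  let ?p = "cnext S x" and ?q = "cnext S y"
  have pq: "?p \<in> S" "?q \<in> S" using True cnext_in by auto
  show ?thesis
  proof (cases "?p = ?q")
    case False
    then have "cnext (S - {?q}) x = ?p" "cnext (S - {?p}) y = ?q"
      using True pq by (auto intro!: cnext_subset)
    then show ?thesis using True by (auto simp: take_cnext_def)
  next
    case eq: True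
    show ?thesis
    proof (cases "S - {?p} = {}")
      case True
      then show ?thesis using eq \<open>finite S \<and> S \<noteq> {}\<close> by (auto simp: take_cnext_def)
    next
      case False
      then have "cnext (S - {?p}) y = cnext (S - {?p}) x"
        using cnext_Diff_cnext[of S x] cnext_Diff_cnext[of S y] eq True by simp
      then show ?thesis using eq True by (simp add: take_cnext_def)
    qed
  qed
qed

lemma take_cnext_subset: "take_cnext x S \<subseteq> S"
  by (auto simp: take_cnext_def)

interpretation take_cnext: comp_fun_commute take_cnext
  by unfold_locales (auto simp: fun_eq_iff take_cnext_commute)

definition served :: "nat set \<Rightarrow> nat set \<Rightarrow> nat set" where
  "served T R = R - Finite_Set.fold take_cnext R T"

lemma fold_take_cnext_subset: "finite T \<Longrightarrow> Finite_Set.fold take_cnext R T \<subseteq> R"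
proof (induction T rule: finite_induct)
  case (insert x T)
  then show ?case using take_cnext.fold_insert[of T x R] take_cnext_subset by fastforce
qed simp

lemma served_subset: "served T R \<subseteq> R"
  by (auto simp: served_def)

lemma finite_served [simp]: "finite R \<Longrightarrow> finite (served T R)"
  using served_subset finite_subset by blast

lemma served_empty [simp]: "served {} R = {}"
  by (simp add: served_def)

lemma Diff_served: "finite T \<Longrightarrow> R - served T R = Finite_Set.fold take_cnext R T"
  using fold_take_cnext_subset by (auto simp: served_def)

lemma card_fold_take_cnext:
  assumes "finite T" "finite R" "card T \<le> card R"
  shows "card (Finite_Set.fold take_cnext R T) = card R - card T"
  using assms
proof (induction T rule: finite_induct)
  case (insert x T)
  let ?S = "Finite_Set.fold take_cnext R T"
  have f: "finite ?S" using insert fold_take_cnext_subset finite_subset by metis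
  have "card ?S = card R - card T" using insert by simp
  moreover from this have "?S \<noteq> {}" using insert by auto
  moreover have "Finite_Set.fold take_cnext R (insert x T) = ?S - {cnext ?S x}"
    using insert f take_cnext.fold_insert[of T x R] take_cnext_def[of x ?S] by simp
  ultimately show ?case using insert f cnext_in[of ?S x] by simp
qed simp

lemma card_served:
  assumes "finite T" "finite R" "card T \<le> card R"
  shows "card (served T R) = card T"
proof -
  have "card (served T R) = card R - (card R - card T)"
    using card_fold_take_cnext[OF assms] fold_take_cnext_subset[OF assms(1), of R]
      finite_subset[OF fold_take_cnext_subset[OF assms(1), of R] assms(2)]
    by (simp add: served_def card_Diff_subset)
  then show ?thesis using assms by simp
qed

text \<open>By order independence t may be served last, from what T leaves over.\<close>

lemma served_insert:
  assumes "finite T" "finite R" "t \<notin> T" "card T < card R"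
  shows "served (insert t T) R = insert (cnext (R - served T R) t) (served T R)"
    and "cnext (R - served T R) t \<in> R - served T R"
proof -
  have ne: "R - served T R \<noteq> {}"
    using assms card_served[of T R] served_subset[of T R] by (metis Diff_eq_empty_iff less_imp_le_nat less_irrefl subset_antisym)
  then show in_: "cnext (R - served T R) t \<in> R - served T R"
    using assms cnext_in[of "R - served T R" t] by simp
  have "served (insert t T) R = R - take_cnext t (R - served T R)"
    using assms by (simp add: served_def[of "insert t T"] Diff_served)
  also have "\<dots> = insert (cnext (R - served T R) t) (served T R)"
    using assms in_ served_subset[of T R] by (auto simp: take_cnext_def)
  finally show "served (insert t T) R = insert (cnext (R - served T R) t) (served T R)" .
qed

text \<open>By order independence t may be served first, with all of R still free.\<close>

lemma served_first:
  assumes "finite T" "finite R" "t \<in> T" "R \<noteq> {}"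
  shows "served T R = insert (cnext R t) (served (T - {t}) (R - {cnext R t}))"
proof -
  let ?r = "cnext R t"
  have r: "?r \<in> R" using assms cnext_in by auto
  have "Finite_Set.fold take_cnext R T = Finite_Set.fold take_cnext R (insert t (T - {t}))"
    using assms by (simp add: insert_absorb)
  also have "\<dots> = Finite_Set.fold take_cnext (take_cnext t R) (T - {t})"
    using assms by (subst take_cnext.fold_insert2) auto
  also have "take_cnext t R = R - {?r}" using assms by (simp add: take_cnext_def)
  finally have "Finite_Set.fold take_cnext R T = Finite_Set.fold take_cnext (R - {?r}) (T - {t})" .
  moreover have "Finite_Set.fold take_cnext (R - {?r}) (T - {t}) \<subseteq> R - {?r}"
    using assms by (intro fold_take_cnext_subset) auto
  ultimately show ?thesis using r by (auto simp: served_def)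
qed

lemma served_mono:
  assumes "finite T" "finite R" "T' \<subseteq> T" "card T \<le> card R"
  shows "served T' R \<subseteq> served T R"
proof -
  have "Z \<subseteq> T - T' \<Longrightarrow> served T' R \<subseteq> served (T' \<union> Z) R" if "finite Z" for Z
    using that
  proof (induction Z rule: finite_induct)
    case (insert z Z)
    have "card (T' \<union> Z) < card T"
      using insert assms by (intro psubset_card_mono) auto
    moreover have "finite (T' \<union> Z)" using insert assms finite_subset by blast
    moreover have "z \<notin> T' \<union> Z" using insert by auto
    ultimately have "served (insert z (T' \<union> Z)) R \<supseteq> served (T' \<union> Z) R"
      using assms by (subst served_insert) auto
    with insert show ?case by auto
  qed simp
  from this[of "T - T'"] assms show ?thesis by (simp add: Un_absorb1 sup.absorb2)
qed

text \<open>The entry u is free throughout, so an arrival cannot pass it on its way to d and must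
  start between u and d. In the induction an arbitrary t is served first: either it hits d itself,
  or t and its service are removed.\<close>

lemma btw_unused_served:
  assumes "finite T" "finite R" "T \<inter> R = {}" "u \<in> R - served T R" "d \<in> served T R"
  shows "\<exists>t\<in>T. btw u t d"
  using assms
proof (induction "card T" arbitrary: T R)
  case 0
  then show ?case by simp
next
  case (Suc n)
  then obtain t where t: "t \<in> T" by (metis card.empty ex_in_conv nat.distinct(1))
  let ?r = "cnext R t"
  have R: "R \<noteq> {}" using Suc.prems by auto
  then have sv: "served T R = insert ?r (served (T - {t}) (R - {?r}))"
    using served_first t Suc.prems by auto
  have u: "u \<in> R" "u \<noteq> ?r" using Suc.prems sv by auto
  show ?case
  proof (cases "d = ?r")
    case True
    have "\<not> btw t u ?r" using not_btw_cnext u Suc.prems by auto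
    moreover have "t \<noteq> u" "t \<noteq> ?r" using t u Suc.prems cnext_in[of R t] R by auto
    ultimately have "btw u t ?r" using u btw_total by blast
    then show ?thesis using t True by auto
  next
    case False
    then have "\<exists>t'\<in>T - {t}. btw u t' d"
      using Suc.prems Suc.hyps t sv u by (intro Suc.hyps(1)) auto
    then show ?thesis by auto
  qed
qed

text \<open>No arrival and no other service separates u from v, so every single search runs in the
  same way with v in place of u.\<close>

lemma served_rename:
  assumes "finite A" "finite Q" "card A \<le> Suc (card Q)"
    and "u \<notin> Q" "v \<notin> Q" "u \<noteq> v" "A \<inter> insert u (insert v Q) = {}"
    and "\<And>z. z \<in> Q \<union> A \<Longrightarrow> \<not> btw u z v"
  shows "served A (insert v Q) = (\<lambda>z. if z = u then v else z) ` served A (insert u Q)"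
  using assms(1,3,7,8)
proof (induction A rule: finite_induct)
  case (insert x A)
  let ?g = "\<lambda>z. if z = u then v else z"
  let ?U = "served A (insert u Q)" let ?V = "served A (insert v Q)"
  have IH: "?V = ?g ` ?U" using insert by auto
  have sU: "?U \<subseteq> insert u Q" by (rule served_subset)
  let ?SU = "insert u Q - ?U" let ?SV = "insert v Q - ?V"
  have SV: "?SV = ?g ` ?SU" using IH sU assms(4-6) by (auto split: if_splits)
  have c: "card A < card (insert u Q)" "card A < card (insert v Q)"
    using insert assms by auto
  note sI = served_insert[OF insert(1) _ insert(2) c(1)] served_insert[OF insert(1) _ insert(2) c(2)]
  have p: "cnext ?SU x \<in> ?SU" using sI(2) assms by auto
  have "cnext ?SV x = ?g (cnext ?SU x)"
  proof (rule cnext_eqI)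
    show "?g (cnext ?SU x) \<in> ?SV" using p SV by blast
    fix z assume "z \<in> ?SV"
    then have "z \<in> ?g ` ?SU" using SV by simp
    then obtain z' where z': "z' \<in> ?SU" "z = ?g z'" by (elim imageE)
    have a: "\<not> btw x z' (cnext ?SU x)" using not_btw_cnext[of ?SU z' x] z' assms by auto
    have b: "\<not> btw u x v" "x \<noteq> u" "x \<noteq> v" using insert by auto
    have e: "\<not> btw u z' v" "\<not> btw u (cnext ?SU x) v"
      using z' p insert by (auto simp: btw_def)
    have f: "z' \<noteq> v" "cnext ?SU x \<noteq> v" using z' p assms by auto
    show "\<not> btw x z (?g (cnext ?SU x))"
    proof (cases "z' = u"; cases "cnext ?SU x = u")
      assume "z' = u" "cnext ?SU x \<noteq> u"
      then show ?thesis using a b e f z'(2) btw_move_mid by auto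
    next
      assume "z' \<noteq> u" "cnext ?SU x = u"
      then show ?thesis using a b e f z'(2) btw_move_end by auto
    qed (use a z'(2) in auto)
  qed (use assms in auto)
  then show ?case using sI(1,3) assms IH by auto
qed simp

text \<open>Searches from x and y that have met never part again: if their common target is removed,
  both continue from it by \<open>cnext_Diff_cnext\<close>.\<close>

lemma cnext_eq_subset:
  assumes "finite S" "cnext S x = cnext S y" "S' \<subseteq> S"
  shows "cnext S' x = cnext S' y"
proof -
  have "finite (S - S')" using assms by auto
  have "Z \<subseteq> S \<Longrightarrow> cnext (S - Z) x = cnext (S - Z) y" if "finite Z" for Z
    using that
  proof (induction Z rule: finite_induct)
    case (insert z Z)
    let ?S = "S - Z"
    have e: "S - insert z Z = ?S - {z}" by auto
    have IH: "cnext ?S x = cnext ?S y" using insert by auto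
    have z: "z \<in> ?S" "finite ?S" using insert assms by auto
    show ?case
    proof (cases "cnext ?S x = z")
      case False
      then have "cnext ?S x \<in> ?S - {z}" using z cnext_in by blast
      then show ?thesis unfolding e using z IH cnext_subset[of ?S "?S - {z}"] by simp
    next
      case True
      show ?thesis
      proof (cases "?S - {z} = {}")
        case True
        then show ?thesis unfolding e True by (simp add: cnext_def)
      next
        case False
        then show ?thesis unfolding e using cnext_Diff_cnext[of ?S x] cnext_Diff_cnext[of ?S y] True IH z by auto
      qed
    qed
  qed (use assms in simp)
  from this[of "S - S'"] show ?thesis
    using assms \<open>finite (S - S')\<close> by (simp add: double_diff)
qed

lemma cnext_eq_if_not_btw:
  assumes "finite D" "D \<noteq> {}" "u \<notin> D" "v \<notin> D" "\<And>d. d \<in> D \<Longrightarrow> \<not> btw u d v"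
  shows "cnext D u = cnext D v"
proof (rule cnext_eqI)
  let ?p = "cnext D v"
  show p: "?p \<in> D" using assms cnext_in by auto
  fix z assume z: "z \<in> D"
  have "\<not> btw v z ?p" "\<not> btw u z v" "\<not> btw u ?p v" "z \<noteq> v" "z \<noteq> u" "?p \<noteq> u" "?p \<noteq> v"
    using z p assms not_btw_cnext[of D z v] by auto
  then show "\<not> btw u z ?p" by (metis not_btw_retreat)
qed (use assms in auto)

lemma served_cong_insert:
  assumes "finite P" "finite D" "u \<notin> P" "v \<notin> P" "u \<notin> D" "v \<notin> D" "card P < card D"
    and "\<And>d. d \<in> D \<Longrightarrow> \<not> btw u d v"
  shows "served (insert u P) D = served (insert v P) D"
proof -
  have "D \<noteq> {}" using assms by auto
  then have "cnext D u = cnext D v" using assms by (intro cnext_eq_if_not_btw) auto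
  then have "cnext (D - served P D) u = cnext (D - served P D) v"
    by (rule cnext_eq_subset[OF assms(2) _ Diff_subset])
  then show ?thesis using assms by (simp add: served_insert)
qed

text \<open>The missing service u moves step by step to the next entry of R until it reaches v. One
  step only renames an entry of the middle image (\<open>served_rename\<close>), and D cannot
  distinguish the two names (\<open>served_cong_insert\<close>).\<close>

lemma served_shift:
  assumes "finite A" "finite R" "finite D" "card A < card R" "card A \<le> card D"
    and "u \<in> R" "v \<in> R" "A \<inter> R = {}" "R \<inter> D = {}"
    and "\<And>z. z \<in> A \<union> D \<Longrightarrow> \<not> btw u z v"
  shows "served (served A (R - {u})) D = served (served A (R - {v})) D"
  using assms(6,10)
proof (induction "card {z \<in> R. btw u z v}" arbitrary: u rule: less_induct)
  case less
  show ?case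
  proof (cases "u = v")
    case False
    have fin: "finite {z \<in> R. btw u z v}" using assms by auto
    let ?w = "cnext R u"
    have w: "?w \<in> R" using assms(2) less.prems(1) cnext_in[of R u] by blast
    have nb: "\<not> btw u z ?w" if "z \<in> R" for z using that assms not_btw_cnext by auto
    have uw: "u \<noteq> ?w" using nb[of v] assms False by (auto simp: btw_def)
    have wv: "btw u ?w v \<or> ?w = v"
      using nb[OF \<open>v \<in> R\<close>] False uw btw_total[of u v ?w] btw_rotate[of v u ?w] by metis
    have sub: "{z \<in> R. btw ?w z v} \<subset> {z \<in> R. btw u z v}" if "?w \<noteq> v"
    proof -
      have "btw u z v" if "z \<in> R" "btw ?w z v" for z
        using that \<open>?w \<noteq> v\<close> wv False btw_trans_right by blast
      moreover have "\<not> btw ?w ?w v" by simp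
      ultimately show ?thesis using w wv \<open>?w \<noteq> v\<close> by blast
    qed
    have tr: "\<not> btw u z ?w" "?w \<noteq> v \<Longrightarrow> \<not> btw ?w z v" if "z \<in> A \<union> D" for z
    proof -
      have "\<not> btw u z v" using less that by auto
      then show "\<not> btw u z ?w" "?w \<noteq> v \<Longrightarrow> \<not> btw ?w z v"
        using wv False uw btw_trans_left[of u ?w v z] btw_trans_right[of u ?w v z] by blast+
    qed
    \<comment> \<open>The two middle rows differ only in one point: one is Q with \<open>?w\<close>,
      the other is Q with u.\<close>
    define Q where "Q = R - {u, ?w}"
    have R: "R - {u} = insert ?w Q" "R - {?w} = insert u Q" using Q_def w less uw by auto
    have cQ: "Suc (Suc (card Q)) = card R"
      using Q_def w less uw assms by (metis R(1) card_Suc_Diff1 card_insert_disjoint finite_Diff DiffD2 insertI1 insert_iff)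
    have re: "served A (insert ?w Q) = (\<lambda>z. if z = u then ?w else z) ` served A (insert u Q)"
      using assms cQ uw w less tr nb by (intro served_rename) (auto simp: Q_def)
    let ?S = "served A (insert u Q)"
    have fQ: "finite Q" using Q_def assms by auto
    have cA: "card ?S = card A"
      using assms cQ fQ by (intro card_served) (auto simp: Q_def card_insert_if)
    have sS: "?S \<subseteq> insert u Q" by (rule served_subset)
    have step: "served (served A (R - {u})) D = served (served A (R - {?w})) D"
    proof (cases "u \<in> ?S")
      case False
      then have "(\<lambda>z. if z = u then ?w else z) ` ?S = ?S" by force
      then show ?thesis using re R by simp
    next
      case True
      then have e: "?S = insert u (?S - {u})" "(\<lambda>z. if z = u then ?w else z) ` ?S = insert ?w (?S - {u})"
        by auto
      have fS: "finite ?S" using fQ by simp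
      have c: "card (?S - {u}) < card D"
        using True fS cA assms by (metis card_Diff1_less less_le_trans)
      have wQ: "?w \<notin> ?S - {u}" using sS Q_def by auto
      have "served (insert u (?S - {u})) D = served (insert ?w (?S - {u})) D"
        using fS assms less w tr c wQ by (intro served_cong_insert) auto
      then show ?thesis using re R e by simp
    qed
    show ?thesis
    proof (cases "?w = v")
      case True
      then show ?thesis using step by simp
    next
      case False
      then have "served (served A (R - {?w})) D = served (served A (R - {v})) D"
        using less(1)[of ?w] w tr sub fin psubset_card_mono by blast
      then show ?thesis using step by simp
    qed
  qed simp
qed

text \<open>Among the elements of A aiming at a fixed t, take one with the fewest elements of A
  between it and t. An element in between would aim at t as well and have fewer.\<close>

lemma obtain_last_before:
  assumes "finite A" "A \<noteq> {}" "finite T" "T \<noteq> {}" "A \<inter> T = {}"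
  obtains a t where "a \<in> A" "t = cnext T a" "\<And>x. x \<in> A \<Longrightarrow> \<not> btw a x t"
proof -
  obtain a0 where a0: "a0 \<in> A" using assms by auto
  let ?t = "cnext T a0"
  have t: "?t \<in> T" using assms cnext_in by auto
  let ?B = "\<lambda>a. {x \<in> A. btw a x ?t}"
  let ?P = "\<lambda>a. a \<in> A \<and> cnext T a = ?t"
  have "\<exists>a. ?P a \<and> (\<forall>b. ?P b \<longrightarrow> card (?B a) \<le> card (?B b))"
    using a0 by (intro ex_has_least_nat[of ?P a0 "\<lambda>a. card (?B a)"]) auto
  then obtain a where a: "a \<in> A" "cnext T a = ?t"
    and least: "\<And>b. b \<in> A \<Longrightarrow> cnext T b = ?t \<Longrightarrow> card (?B a) \<le> card (?B b)" by auto
  have at: "a \<noteq> ?t" using a t assms by auto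
  have "\<not> btw a x ?t" if x: "x \<in> A" for x
  proof
    assume b: "btw a x ?t"
    have "cnext T x = ?t"
    proof (rule cnext_eqI)
      fix z assume z: "z \<in> T"
      then have "\<not> btw a z ?t" using a not_btw_cnext[of T z a] assms by simp
      then show "\<not> btw x z ?t" using btw_trans_right[OF b] at by blast
    qed (use assms t in auto)
    then have le: "card (?B a) \<le> card (?B x)" using least x by auto
    have "?B x \<subset> ?B a"
      using btw_trans_right[OF b] at b x btw_irrefl by blast
    then have "card (?B x) < card (?B a)" using assms by (intro psubset_card_mono) auto
    then show False using le by simp
  qed
  then show thesis using that[of a ?t] a by auto
qed

section \<open>Burke's theorem and interchangeability\<close>

definition dual_row :: "nat set \<Rightarrow> nat set \<Rightarrow> nat set" where
  "dual_row T R = T \<union> (R - served T R)"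

lemma card_dual_row:
  assumes "finite T" "finite R" "T \<inter> R = {}" "card T \<le> card R"
  shows "card (dual_row T R) = card R"
proof -
  have "card (dual_row T R) = card T + card (R - served T R)"
    unfolding dual_row_def using assms by (intro card_Un_disjoint) auto
  moreover have "card (R - served T R) = card R - card T"
    using assms card_served[of T R] served_subset[of T R] by (simp add: card_Diff_subset)
  ultimately show ?thesis using assms by simp
qed

text \<open>
  Induction on \<open>A\<close>: remove the path \<open>a \<rightarrow> t \<rightarrow> r\<close> of an element \<open>a\<close> that is the last one of \<open>A\<close> before
  \<open>t = cnext T a\<close>. In the dual row, \<open>a\<close> may hit an unused service \<open>u\<close> in front of \<open>t\<close> instead; but then no
  element of \<open>A\<close> or \<open>served T R\<close> lies between \<open>u\<close> and \<open>t\<close>, so it does not matter which of them is removed.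
\<close>

theorem served_interchange:
  assumes "finite A" "finite T" "finite R" "A \<inter> T = {}" "A \<inter> R = {}" "T \<inter> R = {}"
    and "card A \<le> card T" "card T \<le> card R"
  shows "served (served A T) R = served (served A (dual_row T R)) (served T R)"
  using assms
proof (induction "card A" arbitrary: A T R)
  case 0
  then show ?case by simp
next
  case (Suc n)
  let ?R' = "dual_row T R" and ?D = "served T R"
  have "A \<noteq> {}" "T \<noteq> {}" "R \<noteq> {}" using Suc by auto
  obtain a t where at: "a \<in> A" "t = cnext T a" "\<And>x. x \<in> A \<Longrightarrow> \<not> btw a x t"
    using obtain_last_before[OF \<open>finite A\<close> \<open>A \<noteq> {}\<close> \<open>finite T\<close> \<open>T \<noteq> {}\<close> \<open>A \<inter> T = {}\<close>] by metis
  define r where "r = cnext R t"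
  have t: "t \<in> T" and r: "r \<in> R" using at r_def cnext_in Suc.prems \<open>T \<noteq> {}\<close> \<open>R \<noteq> {}\<close> by auto
  have D: "?D = insert r (served (T - {t}) (R - {r}))"
    using served_first[of T R t] t Suc.prems \<open>R \<noteq> {}\<close> r_def by auto
  have rD: "r \<in> ?D" using D by simp
  have Dr: "served (T - {t}) (R - {r}) = ?D - {r}" using D served_subset[of "T - {t}" "R - {r}"] by auto
  have tR': "t \<in> ?R'" using t by (simp add: dual_row_def)
  have R': "dual_row (T - {t}) (R - {r}) = ?R' - {t}"
    using Dr D t r Suc.prems by (auto simp: dual_row_def)
  have cards: "card (A - {a}) = n" "card (T - {t}) = card T - 1" "card (R - {r}) = card R - 1"
    using Suc at t r by auto
  have S: "served A T = insert t (served (A - {a}) (T - {t}))"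
    using served_first[of A T a] at Suc.prems \<open>T \<noteq> {}\<close> by auto
  have "t \<in> served A T" using S by simp
  have S': "served (A - {a}) (T - {t}) = served A T - {t}"
    using S served_subset[of "A - {a}" "T - {t}"] by auto
  have shift: "served (served (A - {a}) (?R' - {t})) (?D - {r}) =
      served (served (A - {a}) (?R' - {cnext ?R' a})) (?D - {r})"
    and "cnext ?D (cnext ?R' a) = r"
  proof -
    let ?u = "cnext ?R' a"
    have finR': "finite ?R'" using Suc.prems by (simp add: dual_row_def)
    have u: "?u \<in> ?R'" using cnext_in finR' tR' by blast
    have AR: "A \<inter> ?R' = {}" using Suc.prems(4,5) by (auto simp: dual_row_def)
    then have aR: "a \<notin> ?R'" "a \<noteq> t" using at(1) tR' by blast+
    have DR: "?R' \<inter> ?D = {}" using Suc.prems(6) served_subset[of T R] by (auto simp: dual_row_def)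
    have Dt: "cnext ?D t = r"
      using cnext_subset[of R ?D t] served_subset[of T R] rD r_def Suc.prems(3) by simp
    have "cnext ?D ?u = r \<and> served (served (A - {a}) (?R' - {t})) (?D - {r}) =
        served (served (A - {a}) (?R' - {?u})) (?D - {r})"
    proof (cases "?u = t")
      case True
      then show ?thesis using Dt by simp
    next
      case ut: False
      have "\<not> btw a t ?u" using not_btw_cnext finR' tR' by blast
      then have aut: "btw a ?u t"
        using btw_total[of a t ?u] btw_rotate[of t a ?u] u aR ut by metis
      have noA: "\<not> btw ?u z t" if "z \<in> A" for z
        using at(3)[OF that] aut btw_trans_right aR by blast
      have aT: "\<not> btw a z t" if "z \<in> T" for z
        using not_btw_cnext[of T z a] at(2) that Suc.prems by simp
      then have noT: "\<not> btw ?u z t" if "z \<in> T" for z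
        using that aut btw_trans_right aR by blast
      have "?u \<notin> T" using aT aut by blast
      then have uR: "?u \<in> R - ?D" using u by (auto simp: dual_row_def)
      have noD: "\<not> btw ?u d t" if d: "d \<in> ?D" for d
      proof -
        obtain t' where t': "t' \<in> T" "btw ?u t' d"
          using btw_unused_served[of T R ?u d] uR Suc.prems d by blast
        then show ?thesis using noT[of t'] btw_trans_left ut by blast
      qed
      have "cnext ?D ?u = cnext ?D t"
        using noD rD u tR' DR Suc.prems by (intro cnext_eq_if_not_btw) auto
      moreover have "card ?R' = card R"
        using Suc.prems card_dual_row by blast
      then have "served (served (A - {a}) (?R' - {?u})) (?D - {r}) = served (served (A - {a}) (?R' - {t})) (?D - {r})"
        using noA noD u tR' DR AR finR' Suc.prems Suc.hyps(2) cards rD card_served[of T R]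
        by (intro served_shift) auto
      ultimately show ?thesis using Dt by simp
    qed
    then show "cnext ?D ?u = r" "served (served (A - {a}) (?R' - {t})) (?D - {r}) =
        served (served (A - {a}) (?R' - {?u})) (?D - {r})" by auto
  qed
  have "served (served A T) R = insert r (served (served (A - {a}) (T - {t})) (R - {r}))"
    unfolding S' r_def using Suc.prems \<open>R \<noteq> {}\<close> \<open>t \<in> served A T\<close> by (intro served_first) auto
  also have "served (served (A - {a}) (T - {t})) (R - {r}) = served (served (A - {a}) (?R' - {t})) (?D - {r})"
  proof -
    have "(A - {a}) \<inter> (T - {t}) = {}" "(A - {a}) \<inter> (R - {r}) = {}" "(T - {t}) \<inter> (R - {r}) = {}"
      using Suc.prems(4-6) by blast+
    moreover have "card (A - {a}) \<le> card (T - {t})" "card (T - {t}) \<le> card (R - {r})"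
      using Suc.prems Suc.hyps(2) cards by linarith+
    ultimately have "served (served (A - {a}) (T - {t})) (R - {r}) =
        served (served (A - {a}) (dual_row (T - {t}) (R - {r}))) (served (T - {t}) (R - {r}))"
      by (intro Suc.hyps(1)) (use cards(1) Suc.prems(1-3) in \<open>simp_all only: finite_Diff\<close>)
    then show ?thesis unfolding Dr R' .
  qed
  also have "\<dots> = served (served (A - {a}) (?R' - {cnext ?R' a})) (?D - {r})" by (rule shift)
  also have "insert r (served (served (A - {a}) (?R' - {cnext ?R' a})) (?D - {r})) =
      served (served A ?R') ?D"
  proof -
    let ?u = "cnext ?R' a"
    have finR': "finite ?R'" using Suc.prems by (simp add: dual_row_def)
    have e: "served A ?R' = insert ?u (served (A - {a}) (?R' - {?u}))"
      using served_first[of A ?R' a] at finR' tR' Suc.prems by auto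
    have e': "served (A - {a}) (?R' - {?u}) = served A ?R' - {?u}"
      using e served_subset[of "A - {a}" "?R' - {?u}"] by auto
    have "?u \<in> served A ?R'" using e by simp
    then show ?thesis
      unfolding e' using served_first[of "served A ?R'" ?D ?u] \<open>cnext ?D ?u = r\<close> rD finR' Suc.prems by auto
  qed
  finally show ?case .
qed

lemma dual_row_Un: "dual_row T R \<union> served T R = T \<union> R"
  using served_subset[of T R] by (auto simp: dual_row_def)

lemma dual_row_Int: "T \<inter> R = {} \<Longrightarrow> dual_row T R \<inter> served T R = {}"
  using served_subset[of T R] by (auto simp: dual_row_def)

text \<open>
  In the cyclic order on \<open>T \<union> R\<close>, a pair consisting of an element of the dual row and its successor
  in the image must be an arrival followed by its service; cancelling such pairs recovers \<open>T\<close>.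
\<close>

lemma dual_row_inj:
  assumes "finite T1" "finite R1" "T1 \<inter> R1 = {}" "card T1 \<le> card R1"
    and "finite T2" "finite R2" "T2 \<inter> R2 = {}" "card T2 \<le> card R2"
    and "dual_row T1 R1 = dual_row T2 R2" "served T1 R1 = served T2 R2"
  shows "T1 = T2 \<and> R1 = R2"
  using assms
proof (induction "card T1" arbitrary: T1 R1 T2 R2)
  case 0
  then have "T1 = {}" by simp
  then have "served T2 R2 = {}" using 0 by simp
  then have "T2 = {}" using 0 card_served[of T2 R2] by simp
  then show ?case using 0 \<open>T1 = {}\<close> by (simp add: dual_row_def)
next
  case (Suc n)
  let ?D = "served T1 R1" and ?R' = "dual_row T1 R1"
  let ?W = "?R' \<union> ?D"
  have "card ?D \<noteq> 0" using Suc card_served[of T1 R1] by auto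
  then have D: "?D \<noteq> {}" "finite ?D" using Suc by auto
  have R': "?R' \<noteq> {}" "finite ?R'" using Suc by (auto simp: dual_row_def)
  have disj: "?R' \<inter> ?D = {}" using dual_row_Int Suc by auto
  obtain x y where x: "x \<in> ?R'" and y: "y = cnext ?D x" "\<And>z. z \<in> ?R' \<Longrightarrow> \<not> btw x z y"
    using obtain_last_before[OF R'(2,1) D(2,1) disj] by metis
  have yD: "y \<in> ?D" using cnext_in D y by auto
  have W: "\<not> btw x z y" if "z \<in> ?W" for z
    using that y not_btw_cnext[of ?D z x] D by auto
  have key: "x \<in> T \<and> y \<in> R \<and> cnext R x = y"
    if TR': "finite T" "finite R" "T \<inter> R = {}" "dual_row T R = ?R'" "served T R = ?D" for T R
  proof -
    have TR: "T \<union> R = ?W" using dual_row_Un[of T R] TR' by simp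
    have "x \<in> T"
    proof (rule ccontr)
      assume "x \<notin> T"
      then have "x \<in> R - served T R" using x that by (auto simp: dual_row_def)
      then obtain t where "t \<in> T" "btw x t y"
        using btw_unused_served[OF TR'(1-3)] TR'(5) yD by metis
      then show False using W[of t] TR by auto
    qed
    moreover have "y \<in> R" using yD that served_subset[of T R] by auto
    moreover from this have "cnext R x = y" using that W TR by (intro cnext_eqI) auto
    ultimately show ?thesis by simp
  qed
  have 1: "x \<in> T1" "y \<in> R1" "cnext R1 x = y" using key[of T1 R1] Suc.prems by auto
  have 2: "x \<in> T2" "y \<in> R2" "cnext R2 x = y" using key[of T2 R2] Suc.prems by auto
  have sv: "served (T - {x}) (R - {y}) = served T R - {y}"
    "dual_row (T - {x}) (R - {y}) = dual_row T R - {x}"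
    if "finite T" "finite R" "T \<inter> R = {}" "x \<in> T" "y \<in> R" "cnext R x = y" for T R
  proof -
    have "served T R = insert y (served (T - {x}) (R - {y}))"
      using served_first[of T R x] that by auto
    then show "served (T - {x}) (R - {y}) = served T R - {y}"
      using served_subset[of "T - {x}" "R - {y}"] by auto
    then show "dual_row (T - {x}) (R - {y}) = dual_row T R - {x}"
      using that \<open>served T R = _\<close> by (auto simp: dual_row_def)
  qed
  have "T1 - {x} = T2 - {x} \<and> R1 - {y} = R2 - {y}"
    using Suc.prems Suc.hyps(2) 1 2 sv[of T1 R1] sv[of T2 R2]
    by (intro Suc.hyps(1)) auto
  then show ?case using 1 2 by (metis insert_Diff)
qed

section \<open>Reduction to three rows\<close>

text \<open>Preserving \<open>btw\<close> instead of the linear order admits order isomorphisms and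
  rotations of the circle alike.\<close>

definition cyc_mono :: "(nat \<Rightarrow> nat) \<Rightarrow> nat set \<Rightarrow> bool" where
  "cyc_mono f W \<longleftrightarrow> inj_on f W \<and> (\<forall>x\<in>W. \<forall>z\<in>W. \<forall>y\<in>W. btw (f x) (f z) (f y) \<longleftrightarrow> btw x z y)"

lemma cyc_mono_subset: "cyc_mono f W \<Longrightarrow> V \<subseteq> W \<Longrightarrow> cyc_mono f V"
  unfolding cyc_mono_def by (meson inj_on_subset subsetD)

lemma strict_mono_on_cyc_mono:
  assumes "strict_mono_on W f"
  shows "cyc_mono f W"
proof -
  have "f x < f y \<longleftrightarrow> x < y" "f x \<le> f y \<longleftrightarrow> x \<le> y" if "x \<in> W" "y \<in> W" for x y
    using strict_mono_on_less[OF assms that] strict_mono_on_less_eq[OF assms that] by auto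
  then show ?thesis
    using strict_mono_on_imp_inj_on[OF assms] by (auto simp: cyc_mono_def btw_def)
qed

lemma cnext_image:
  assumes "cyc_mono f W" "finite S" "S \<noteq> {}" "S \<subseteq> W" "x \<in> W"
  shows "cnext (f ` S) (f x) = f (cnext S x)"
proof (rule cnext_eqI)
  have *: "cnext S x \<in> S" using assms cnext_in by auto
  then show "f (cnext S x) \<in> f ` S" by simp
  fix z assume "z \<in> f ` S"
  then obtain z' where z': "z' \<in> S" "z = f z'" by auto
  then have "\<not> btw x z' (cnext S x)" using not_btw_cnext assms by auto
  then show "\<not> btw (f x) z (f (cnext S x))"
    using z' assms * unfolding cyc_mono_def by (metis subsetD)
qed (use assms in auto)

lemma served_image:
  assumes "cyc_mono f W" "finite T" "finite R" "T \<subseteq> W" "R \<subseteq> W"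
  shows "served (f ` T) (f ` R) = f ` served T R"
proof -
  have inj: "inj_on f W" using assms by (simp add: cyc_mono_def)
  have "Finite_Set.fold take_cnext (f ` R) (f ` T) = f ` Finite_Set.fold take_cnext R T"
    using assms(2,4)
  proof (induction T rule: finite_induct)
    case (insert x T)
    let ?S = "Finite_Set.fold take_cnext R T"
    have "?S \<subseteq> R" by (rule fold_take_cnext_subset[OF insert(1)])
    then have S: "?S \<subseteq> W" "finite ?S"
      using assms(5) finite_subset[OF _ assms(3)] by (blast, simp)
    have "f x \<notin> f ` T"
      using inj_on_image_mem_iff[OF inj, of x T] insert(2,4) by simp
    then have "Finite_Set.fold take_cnext (f ` R) (f ` insert x T) = take_cnext (f x) (f ` ?S)"
      using insert by simp
    also have "\<dots> = f ` take_cnext x ?S"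
    proof (cases "?S = {}")
      case False
      then have "cnext (f ` ?S) (f x) = f (cnext ?S x)" "cnext ?S x \<in> ?S"
        using cnext_image[OF assms(1)] S insert cnext_in by auto
      moreover from this have "f ` (?S - {cnext ?S x}) = f ` ?S - f ` {cnext ?S x}"
        using S by (intro inj_on_image_set_diff[OF inj]) auto
      ultimately show ?thesis using S by (simp add: take_cnext_def)
    qed (simp add: take_cnext_def)
    finally show ?case using insert by simp
  qed simp
  moreover have "Finite_Set.fold take_cnext R T \<subseteq> W"
    using fold_take_cnext_subset[of T R] assms by blast
  ultimately show ?thesis
    using inj_on_image_set_diff[OF inj, of R "Finite_Set.fold take_cnext R T"] assms
    by (auto simp: served_def)
qed

lemma foldl_served_image:
  assumes "cyc_mono f W" "finite T" "T \<subseteq> W" "\<Union>(set Rs) \<subseteq> W" "finite (\<Union>(set Rs))"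
  shows "foldl served (f ` T) (map ((`) f) Rs) = f ` foldl served T Rs"
  using assms(2-)
proof (induction Rs arbitrary: T)
  case (Cons R Rs)
  then have "served (f ` T) (f ` R) = f ` served T R"
    using assms(1) by (intro served_image) auto
  moreover have "served T R \<subseteq> W" using served_subset[of T R] Cons by auto
  ultimately show ?case using Cons by auto
qed simp

text \<open>The sets need not cover \<open>W\<close>.\<close>

primrec disjoint_rows :: "nat set \<Rightarrow> nat list \<Rightarrow> nat set list set" where
  "disjoint_rows W [] = {[]}"
| "disjoint_rows W (s # ss) = (\<Union>R\<in>{R. R \<subseteq> W \<and> card R = s}. (#) R ` disjoint_rows (W - R) ss)"

lemma finite_rows: "finite W \<Longrightarrow> finite (disjoint_rows W ss)"
proof (induction ss arbitrary: W)
  case (Cons s ss)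
  have "finite {R. R \<subseteq> W \<and> card R = s}"
    using Cons finite_subset[of _ "Pow W"] by auto
  then show ?case using Cons by auto
qed simp

lemma sum_rows_Cons:
  assumes "finite W"
  shows "sum g (disjoint_rows W (s # ss)) = (\<Sum>R | R \<subseteq> W \<and> card R = s. \<Sum>Rs\<in>disjoint_rows (W - R) ss. g (R # Rs))"
proof -
  have "finite {R. R \<subseteq> W \<and> card R = s}"
    using assms finite_subset[of _ "Pow W"] by auto
  then have "sum g (disjoint_rows W (s # ss)) =
      (\<Sum>R | R \<subseteq> W \<and> card R = s. sum g ((#) R ` disjoint_rows (W - R) ss))"
    unfolding disjoint_rows.simps using assms by (intro sum.UNION_disjoint) (auto simp: finite_rows)
  also have "\<dots> = (\<Sum>R | R \<subseteq> W \<and> card R = s. \<Sum>Rs\<in>disjoint_rows (W - R) ss. g (R # Rs))"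
    by (rule sum.cong[OF refl], subst sum.reindex) auto
  finally show ?thesis .
qed

lemma disjoint_rowsD: "Rs \<in> disjoint_rows W ss \<Longrightarrow> length Rs = length ss \<and> \<Union>(set Rs) \<subseteq> W \<and> map card Rs = ss"
proof (induction ss arbitrary: W Rs)
  case (Cons s ss)
  then obtain R Rs' where *: "Rs = R # Rs'" "R \<subseteq> W" "card R = s" "Rs' \<in> disjoint_rows (W - R) ss"
    by auto
  then show ?case using Cons.IH[OF *(4)] by auto
qed simp

declare disjoint_rows.simps(2) [simp del]

lemma sum_rows_image:
  assumes "inj_on f W" "finite W"
  shows "sum g (disjoint_rows (f ` W) ss) = (\<Sum>Rs\<in>disjoint_rows W ss. g (map ((`) f) Rs))"
  using assms
proof (induction ss arbitrary: W g)
  case (Cons s ss)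
  have inj: "inj_on ((`) f) {R. R \<subseteq> W \<and> card R = s}"
    by (rule inj_on_subset[OF inj_on_image_Pow[OF Cons(2)]]) auto
  have img: "{R. R \<subseteq> f ` W \<and> card R = s} = (`) f ` {R. R \<subseteq> W \<and> card R = s}"
  proof (intro equalityI subsetI)
    fix R assume "R \<in> {R. R \<subseteq> f ` W \<and> card R = s}"
    then obtain V where "V \<subseteq> W" "R = f ` V" "card R = s" by (auto simp: subset_image_iff)
    then show "R \<in> (`) f ` {R. R \<subseteq> W \<and> card R = s}"
      using card_image[of f V] inj_on_subset[OF Cons(2)] by auto
  next
    fix R assume "R \<in> (`) f ` {R. R \<subseteq> W \<and> card R = s}"
    then show "R \<in> {R. R \<subseteq> f ` W \<and> card R = s}"
      using card_image[of f] inj_on_subset[OF Cons(2)] by auto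
  qed
  have "sum g (disjoint_rows (f ` W) (s # ss)) =
      (\<Sum>R | R \<subseteq> W \<and> card R = s. \<Sum>Rs\<in>disjoint_rows (f ` W - f ` R) ss. g (f ` R # Rs))"
    using Cons by (simp only: sum_rows_Cons finite_imageI img sum.reindex[OF inj] comp_def)
  also have "\<dots> = (\<Sum>R | R \<subseteq> W \<and> card R = s. \<Sum>Rs\<in>disjoint_rows (W - R) ss. g (f ` R # map ((`) f) Rs))"
  proof (rule sum.cong[OF refl])
    fix R assume "R \<in> {R. R \<subseteq> W \<and> card R = s}"
    then have "f ` W - f ` R = f ` (W - R)"
      using inj_on_image_set_diff[OF Cons(2), of W R] by auto
    then show "(\<Sum>Rs\<in>disjoint_rows (f ` W - f ` R) ss. g (f ` R # Rs)) =
        (\<Sum>Rs\<in>disjoint_rows (W - R) ss. g (f ` R # map ((`) f) Rs))"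
      using Cons.IH[of "W - R" "\<lambda>Rs. g (f ` R # Rs)"] Cons.prems inj_on_subset[OF Cons.prems(1)] by auto
  qed
  also have "\<dots> = (\<Sum>Rs\<in>disjoint_rows W (s # ss). g (map ((`) f) Rs))"
    using Cons by (simp add: sum_rows_Cons)
  finally show ?case .
qed simp

text \<open>The length is fixed because the functions in question access rows by index, which is
  meaningless on shorter lists.\<close>

definition cyc_inv :: "nat \<Rightarrow> (nat set list \<Rightarrow> real) \<Rightarrow> bool" where
  "cyc_inv l g \<longleftrightarrow> (\<forall>f Rs. length Rs = l \<longrightarrow> finite (\<Union>(set Rs)) \<longrightarrow> cyc_mono f (\<Union>(set Rs)) \<longrightarrow> g (map ((`) f) Rs) = g Rs)"

lemma sum_rows_cyc_mono:
  assumes "cyc_inv (length ss) g" "finite W" "cyc_mono f W"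
  shows "sum g (disjoint_rows (f ` W) ss) = sum g (disjoint_rows W ss)"
proof -
  have "sum g (disjoint_rows (f ` W) ss) = (\<Sum>Rs\<in>disjoint_rows W ss. g (map ((`) f) Rs))"
    using assms by (intro sum_rows_image) (auto simp: cyc_mono_def)
  also have "\<dots> = sum g (disjoint_rows W ss)"
  proof (intro sum.cong refl)
    fix Rs assume "Rs \<in> disjoint_rows W ss"
    then have "\<Union>(set Rs) \<subseteq> W" "length Rs = length ss" using disjoint_rowsD by blast+
    then show "g (map ((`) f) Rs) = g Rs"
      using assms cyc_mono_subset finite_subset unfolding cyc_inv_def by blast
  qed
  finally show ?thesis .
qed

text \<open>The increasing enumeration of W is a \<open>cyc_mono\<close>. So after a row has been
  split off, only the number of remaining places matters.\<close>

lemma sum_rows_card: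
  assumes "cyc_inv (length ss) g" "finite W"
  shows "sum g (disjoint_rows W ss) = sum g (disjoint_rows {..<card W} ss)"
proof -
  obtain h where h: "bij_betw h {..<card W} W" "strict_mono_on {..<card W} h"
    using ex_bij_betw_strict_mono_card[OF assms(2)] by blast
  then show ?thesis
    using sum_rows_cyc_mono[OF assms(1), of "{..<card W}" h] strict_mono_on_cyc_mono[OF h(2)]
    by (simp add: bij_betw_imp_surj_on)
qed

section \<open>Removing rows from the sums\<close>

text \<open>Exchanging the two components shows that source and target have equally many elements,
  so injectivity suffices and no inverse has to be constructed.\<close>

lemma bij_betw_dual_row:
  assumes "finite W" "a \<le> r"
  shows "bij_betw (\<lambda>(A, R). (dual_row A R, served A R))
    (SIGMA A:{A. A \<subseteq> W \<and> card A = a}. {R. R \<subseteq> W - A \<and> card R = r})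
    (SIGMA R:{R. R \<subseteq> W \<and> card R = r}. {D. D \<subseteq> W - R \<and> card D = a})"
    (is "bij_betw ?f ?X ?Y")
proof -
  have fin: "finite A" if "A \<subseteq> W" for A using that assms finite_subset by auto
  have fX: "finite ?X" using assms finite_subset[of _ "Pow W"] by (intro finite_SigmaI) auto
  have inj: "inj_on ?f ?X"
  proof (rule inj_onI, clarsimp)
    fix A1 R1 A2 R2
    assume *: "A1 \<subseteq> W" "A2 \<subseteq> W" "a = card A1" "R1 \<subseteq> W - A1" "r = card R1" "card A2 = card A1" "R2 \<subseteq> W - A2" "card R2 = card R1"
      "dual_row A1 R1 = dual_row A2 R2" "served A1 R1 = served A2 R2"
    show "A1 = A2 \<and> R1 = R2"
    proof (rule dual_row_inj)
      show "finite A1" "finite A2" "finite R1" "finite R2" using * by (auto intro!: fin)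
    qed (use * assms in auto)
  qed
  have sub: "?f ` ?X \<subseteq> ?Y"
  proof (clarsimp)
    fix A R assume *: "A \<subseteq> W" "R \<subseteq> W - A" "a = card A" "r = card R"
    have f: "finite A" "finite R" using * by (auto intro!: fin)
    have "card (dual_row A R) = card R" "card (served A R) = card A"
      using * f assms card_served[of A R] card_dual_row[of A R] by auto
    moreover have "served A R \<subseteq> W - dual_row A R"
      using served_subset[of A R] dual_row_Int[of A R] * by auto
    ultimately show "dual_row A R \<subseteq> W \<and> card (dual_row A R) = card R \<and>
        served A R \<subseteq> W - dual_row A R \<and> card (served A R) = card A"
      using dual_row_Un[of A R] * by auto
  qed
  have swap: "bij_betw (\<lambda>(A, R). (R, A)) ?X ?Y"
    by (rule bij_betw_byWitness[where f' = "\<lambda>(A, R). (R, A)"]) auto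
  then have "card ?X = card ?Y" "finite ?Y" using bij_betw_same_card bij_betw_finite fX by blast+
  then have "?f ` ?X = ?Y"
    using sub card_image[OF inj] by (intro card_subset_eq) auto
  with inj show ?thesis by (simp add: bij_betw_def)
qed

lemma sum_dual_row:
  fixes h :: "nat set \<Rightarrow> nat set \<Rightarrow> real"
  assumes "finite W" "a \<le> r"
  shows "(\<Sum>A | A \<subseteq> W \<and> card A = a. \<Sum>R | R \<subseteq> W - A \<and> card R = r. h (dual_row A R) (served A R)) =
         (\<Sum>R | R \<subseteq> W \<and> card R = r. \<Sum>D | D \<subseteq> W - R \<and> card D = a. h R D)"
proof -
  have fin: "finite {A. A \<subseteq> V \<and> card A = c}" if "V \<subseteq> W" for V c
    using finite_subset[of "{A. A \<subseteq> V \<and> card A = c}" "Pow W"] assms that by auto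
  show ?thesis
    using sum.reindex_bij_betw[OF bij_betw_dual_row[OF assms], of "\<lambda>(R, D). h R D"] fin
    by (simp add: sum.Sigma case_prod_unfold)
qed

lemma sum_rows_drop:
  assumes "finite W" "cyc_inv (length ss) g"
  shows "(\<Sum>R | R \<subseteq> W \<and> card R = r. sum g (disjoint_rows (W - R) ss)) =
    real (card W choose r) * sum g (disjoint_rows {..<card W - r} ss)"
proof -
  have "(\<Sum>R | R \<subseteq> W \<and> card R = r. sum g (disjoint_rows (W - R) ss)) =
      (\<Sum>R | R \<subseteq> W \<and> card R = r. sum g (disjoint_rows {..<card W - r} ss))"
  proof (rule sum.cong[OF refl])
    fix R assume "R \<in> {R. R \<subseteq> W \<and> card R = r}"
    then have "card (W - R) = card W - r"
      using assms(1) by (metis (mono_tags, lifting) card_Diff_subset finite_subset mem_Collect_eq)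
    then show "sum g (disjoint_rows (W - R) ss) = sum g (disjoint_rows {..<card W - r} ss)"
      using sum_rows_card[OF assms(2), of "W - R"] assms(1) by simp
  qed
  then show ?thesis using assms by (simp add: n_subsets)
qed

text \<open>Burke's theorem: the services that are used are as uniformly distributed as the arrivals.\<close>

lemma sum_rows_served:
  assumes "finite W" "a \<le> r" "cyc_inv (Suc (length ss)) g"
  shows "(\<Sum>Rs\<in>disjoint_rows W (a # r # ss). g (served (Rs ! 0) (Rs ! 1) # drop 2 Rs)) =
    real (card W choose r) * sum g (disjoint_rows {..<card W - r} (a # ss))"
proof -
  let ?h = "\<lambda>R D. \<Sum>Rs\<in>disjoint_rows (W - R - D) ss. g (D # Rs)"
  have "(\<Sum>Rs\<in>disjoint_rows W (a # r # ss). g (served (Rs ! 0) (Rs ! 1) # drop 2 Rs)) =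
      (\<Sum>A | A \<subseteq> W \<and> card A = a. \<Sum>R | R \<subseteq> W - A \<and> card R = r. \<Sum>Rs\<in>disjoint_rows (W - A - R) ss. g (served A R # Rs))"
    using assms by (simp add: sum_rows_Cons numeral_2_eq_2)
  also have "\<dots> = (\<Sum>A | A \<subseteq> W \<and> card A = a. \<Sum>R | R \<subseteq> W - A \<and> card R = r. ?h (dual_row A R) (served A R))"
  proof (rule sum.cong[OF refl], rule sum.cong[OF refl])
    fix A R
    have "W - A - R = W - dual_row A R - served A R"
      using dual_row_Un[of A R] by blast
    then show "(\<Sum>Rs\<in>disjoint_rows (W - A - R) ss. g (served A R # Rs)) = ?h (dual_row A R) (served A R)"
      by simp
  qed
  also have "\<dots> = (\<Sum>R | R \<subseteq> W \<and> card R = r. \<Sum>D | D \<subseteq> W - R \<and> card D = a. ?h R D)"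
    using assms by (intro sum_dual_row) auto
  also have "\<dots> = (\<Sum>R | R \<subseteq> W \<and> card R = r. sum g (disjoint_rows (W - R) (a # ss)))"
    using assms by (simp add: sum_rows_Cons)
  also have "\<dots> = real (card W choose r) * sum g (disjoint_rows {..<card W - r} (a # ss))"
    using assms by (intro sum_rows_drop) auto
  finally show ?thesis .
qed

text \<open>The change of variables from (T, R) to the dual row and the image turns sizes t, r into
  r, t. The row of size r then acts on A alone and is removed by Burke's theorem, while the image
  takes over the role of T.\<close>

lemma sum_rows_interchange:
  assumes "finite W" "a \<le> t" "t \<le> r"
    and "cyc_inv (Suc (Suc (length ss))) (\<lambda>Rs. g (served (Rs ! 0) (Rs ! 1)) (Rs ! 1) (drop 2 Rs))"
  shows "(\<Sum>Rs\<in>disjoint_rows W (a # t # r # ss).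
      g (served (served (Rs ! 0) (Rs ! 1)) (Rs ! 2)) (served (Rs ! 1) (Rs ! 2)) (drop 3 Rs)) =
    real (card W choose r) *
      (\<Sum>Rs\<in>disjoint_rows {..<card W - r} (a # t # ss). g (served (Rs ! 0) (Rs ! 1)) (Rs ! 1) (drop 2 Rs))"
    (is "?lhs = _ * sum ?G _")
proof -
  let ?h = "\<lambda>A R D. \<Sum>Rs\<in>disjoint_rows (W - A - R - D) ss. g (served (served A R) D) D Rs"
  have "?lhs = (\<Sum>A | A \<subseteq> W \<and> card A = a. \<Sum>T | T \<subseteq> W - A \<and> card T = t.
      \<Sum>R | R \<subseteq> W - A - T \<and> card R = r. \<Sum>Rs\<in>disjoint_rows (W - A - T - R) ss. g (served (served A T) R) (served T R) Rs)"
    using assms by (simp add: sum_rows_Cons eval_nat_numeral)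
  also have "\<dots> = (\<Sum>A | A \<subseteq> W \<and> card A = a. \<Sum>T | T \<subseteq> W - A \<and> card T = t.
      \<Sum>R | R \<subseteq> W - A - T \<and> card R = r. ?h A (dual_row T R) (served T R))"
  proof (rule sum.cong[OF refl], rule sum.cong[OF refl], rule sum.cong[OF refl])
    fix A T R
    assume A: "A \<in> {A. A \<subseteq> W \<and> card A = a}" and T: "T \<in> {T. T \<subseteq> W - A \<and> card T = t}"
      and R: "R \<in> {R. R \<subseteq> W - A - T \<and> card R = r}"
    have fin: "finite A" "finite T" "finite R" using A T R assms(1) finite_subset by blast+
    have "W - A - T - R = W - A - dual_row T R - served T R"
      using dual_row_Un[of T R] by blast
    moreover have "served (served A T) R = served (served A (dual_row T R)) (served T R)"
      using A T R fin assms by (intro served_interchange) auto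
    ultimately show "(\<Sum>Rs\<in>disjoint_rows (W - A - T - R) ss. g (served (served A T) R) (served T R) Rs) =
        ?h A (dual_row T R) (served T R)" by simp
  qed
  also have "\<dots> = (\<Sum>A | A \<subseteq> W \<and> card A = a. \<Sum>R | R \<subseteq> W - A \<and> card R = r.
      \<Sum>D | D \<subseteq> W - A - R \<and> card D = t. ?h A R D)"
    using assms by (intro sum.cong[OF refl] sum_dual_row) auto
  also have "\<dots> = (\<Sum>Rs\<in>disjoint_rows W (a # r # t # ss). ?G (served (Rs ! 0) (Rs ! 1) # drop 2 Rs))"
    using assms by (simp add: sum_rows_Cons eval_nat_numeral)
  also have "\<dots> = real (card W choose r) * sum ?G (disjoint_rows {..<card W - r} (a # t # ss))"
    using assms by (intro sum_rows_served) auto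
  finally show ?thesis .
qed

text \<open>The number of ways to choose disjoint sets of the given sizes from N places.\<close>

primrec lump_factor :: "nat \<Rightarrow> nat list \<Rightarrow> nat" where
  "lump_factor N [] = 1"
| "lump_factor N (r # rs) = (N choose r) * lump_factor (N - r) rs"

lemma lump_factor_pos: "sum_list rs \<le> N \<Longrightarrow> lump_factor N rs > 0"
proof (induction rs arbitrary: N)
  case (Cons r rs)
  then have "sum_list rs \<le> N - r" "r \<le> N" by auto
  then show ?case using Cons.IH by simp
qed simp

lemma sum_rows_drop_list:
  assumes "finite W" "cyc_inv (length ss) g"
  shows "(\<Sum>Rs\<in>disjoint_rows W (pre @ ss). g (drop (length pre) Rs)) =
    real (lump_factor (card W) pre) * sum g (disjoint_rows {..<card W - sum_list pre} ss)"
  using assms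
proof (induction pre arbitrary: W)
  case Nil
  then show ?case using sum_rows_card[of ss g W] by simp
next
  case (Cons p pre)
  let ?g = "\<lambda>Rs. g (drop (length pre) Rs)"
  have inv: "cyc_inv (length (pre @ ss)) ?g"
    unfolding cyc_inv_def
  proof (intro allI impI)
    fix f Rs assume *: "length Rs = length (pre @ ss)" "finite (\<Union>(set Rs))" "cyc_mono f (\<Union>(set Rs))"
    have "\<Union>(set (drop (length pre) Rs)) \<subseteq> \<Union>(set Rs)" using set_drop_subset by fastforce
    then show "?g (map ((`) f) Rs) = ?g Rs"
      using * assms(2) cyc_mono_subset finite_subset unfolding cyc_inv_def drop_map
      by (metis append_eq_conv_conj length_append length_drop diff_add_inverse)
  qed
  have "(\<Sum>Rs\<in>disjoint_rows W ((p # pre) @ ss). g (drop (length (p # pre)) Rs)) =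
      (\<Sum>R | R \<subseteq> W \<and> card R = p. sum ?g (disjoint_rows (W - R) (pre @ ss)))"
    using Cons.prems by (simp add: sum_rows_Cons)
  also have "\<dots> = real (card W choose p) * sum ?g (disjoint_rows {..<card W - p} (pre @ ss))"
    using Cons.prems inv by (intro sum_rows_drop) auto
  also have "sum ?g (disjoint_rows {..<card W - p} (pre @ ss)) =
      real (lump_factor (card W - p) pre) * sum g (disjoint_rows {..<card W - p - sum_list pre} ss)"
    using Cons.IH[of "{..<card W - p}"] Cons.prems by simp
  finally show ?case by simp
qed

lemma cyc_inv_foldl:
  assumes "cyc_inv (Suc l) g"
  shows "cyc_inv (Suc (p + l)) (\<lambda>Rs. g (foldl served (hd Rs) (take p (tl Rs)) # drop p (tl Rs)))"
  unfolding cyc_inv_def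
proof (intro allI impI)
  fix f Rs assume *: "length Rs = Suc (p + l)" "finite (\<Union>(set Rs))" "cyc_mono f (\<Union>(set Rs))"
  then obtain A Qs where Rs: "Rs = A # Qs" by (cases Rs) auto
  let ?W = "\<Union>(set Rs)"
  have sub: "A \<subseteq> ?W" "\<Union>(set (take p Qs)) \<subseteq> ?W" "\<Union>(set (drop p Qs)) \<subseteq> ?W"
    using Rs set_take_subset[of p Qs] set_drop_subset[of p Qs] by auto
  have fl: "foldl served (f ` A) (map ((`) f) (take p Qs)) = f ` foldl served A (take p Qs)"
    using sub * by (intro foldl_served_image[OF *(3)]) (auto intro: finite_subset)
  have "foldl served A Bs \<subseteq> ?W" if "\<Union>(set Bs) \<subseteq> ?W" "A \<subseteq> ?W" for A Bs
    using that
  proof (induction Bs arbitrary: A)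
    case (Cons B Bs)
    then have "served A B \<subseteq> ?W" using served_subset[of A B] by auto
    then show ?case using Cons by simp
  qed simp
  then have s2: "\<Union>(set (foldl served A (take p Qs) # drop p Qs)) \<subseteq> ?W" using sub by auto
  have len: "length (foldl served A (take p Qs) # drop p Qs) = Suc l" using * Rs by simp
  have "g (map ((`) f) (foldl served A (take p Qs) # drop p Qs)) = g (foldl served A (take p Qs) # drop p Qs)"
    using assms len finite_subset[OF s2 *(2)] cyc_mono_subset[OF *(3) s2] unfolding cyc_inv_def by blast
  then show "g (foldl served (hd (map ((`) f) Rs)) (take p (tl (map ((`) f) Rs))) # drop p (tl (map ((`) f) Rs))) =
      g (foldl served (hd Rs) (take p (tl Rs)) # drop p (tl Rs))"
    using fl by (simp add: Rs take_map drop_map)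
qed

text \<open>The rows in \<open>mids\<close> act on the first set only, so Burke's theorem removes
  them one at a time.\<close>

lemma sum_rows_foldl:
  assumes "finite W" "\<And>r. r \<in> set mids \<Longrightarrow> a \<le> r" "cyc_inv (Suc (length ss)) g"
  shows "(\<Sum>Rs\<in>disjoint_rows W (a # mids @ ss).
      g (foldl served (hd Rs) (take (length mids) (tl Rs)) # drop (length mids) (tl Rs))) =
    real (lump_factor (card W) mids) * sum g (disjoint_rows {..<card W - sum_list mids} (a # ss))"
  using assms
proof (induction mids arbitrary: W)
  case Nil
  have "(\<Sum>Rs\<in>disjoint_rows W (a # ss). g (hd Rs # tl Rs)) = sum g (disjoint_rows W (a # ss))"
    by (intro sum.cong) (auto simp: disjoint_rows.simps)
  then show ?case using Nil sum_rows_card[of "a # ss" g W] by simp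
next
  case (Cons r mids)
  let ?g = "\<lambda>Rs. g (foldl served (hd Rs) (take (length mids) (tl Rs)) # drop (length mids) (tl Rs))"
  have inv: "cyc_inv (Suc (length (mids @ ss))) ?g"
    using cyc_inv_foldl[OF assms(3), of "length mids"] by simp
  have "(\<Sum>Rs\<in>disjoint_rows W (a # (r # mids) @ ss).
      g (foldl served (hd Rs) (take (length (r # mids)) (tl Rs)) # drop (length (r # mids)) (tl Rs))) =
    (\<Sum>Rs\<in>disjoint_rows W (a # r # mids @ ss). ?g (served (Rs ! 0) (Rs ! 1) # drop 2 Rs))"
  proof (rule sum.cong)
    fix Rs assume "Rs \<in> disjoint_rows W (a # r # mids @ ss)"
    then have "length Rs = Suc (Suc (length (mids @ ss)))"
      using disjoint_rowsD[of Rs W "a # r # mids @ ss"] by simp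
    then obtain A R Qs where "Rs = A # R # Qs" by (auto simp: length_Suc_conv)
    then show "g (foldl served (hd Rs) (take (length (r # mids)) (tl Rs)) # drop (length (r # mids)) (tl Rs)) =
      ?g (served (Rs ! 0) (Rs ! 1) # drop 2 Rs)" by (simp add: numeral_2_eq_2)
  qed simp
  also have "\<dots> = real (card W choose r) * sum ?g (disjoint_rows {..<card W - r} (a # mids @ ss))"
    using Cons.prems inv by (intro sum_rows_served) auto
  also have "sum ?g (disjoint_rows {..<card W - r} (a # mids @ ss)) =
      real (lump_factor (card W - r) mids) * sum g (disjoint_rows {..<card W - r - sum_list mids} (a # ss))"
    using Cons.IH[of "{..<card W - r}"] Cons.prems by simp
  finally show ?case by simp
qed

definition cyc_inv3 :: "(nat set \<Rightarrow> nat set \<Rightarrow> nat set \<Rightarrow> real) \<Rightarrow> bool" where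
  "cyc_inv3 h \<longleftrightarrow> (\<forall>f B D C. finite C \<longrightarrow> B \<subseteq> C \<longrightarrow> D \<subseteq> C \<longrightarrow> cyc_mono f C \<longrightarrow> h (f ` B) (f ` D) (f ` C) = h B D C)"

lemma foldl_served_subset: "Rs \<noteq> [] \<Longrightarrow> foldl served T Rs \<subseteq> last Rs"
proof (induction Rs arbitrary: T)
  case (Cons R Rs)
  then show ?case using served_subset[of T R] by auto
qed simp

abbreviation tandem :: "(nat set \<Rightarrow> nat set \<Rightarrow> nat set \<Rightarrow> real) \<Rightarrow> nat set list \<Rightarrow> real" where
  "tandem h Rs \<equiv> h (foldl served (served (Rs ! 0) (Rs ! 1)) (drop 2 Rs))
     (foldl served (Rs ! 1) (drop 2 Rs)) (last (drop 2 Rs))"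

lemma cyc_inv_tandem:
  assumes "cyc_inv3 h" "l > 0"
  shows "cyc_inv (Suc (Suc l)) (tandem h)"
  unfolding cyc_inv_def
proof (intro allI impI)
  fix f Rs assume *: "length Rs = Suc (Suc l)" "finite (\<Union>(set Rs))" "cyc_mono f (\<Union>(set Rs))"
  then obtain A T Qs where Rs: "Rs = A # T # Qs" "Qs \<noteq> []"
    using assms(2) by (metis length_Suc_conv length_0_conv less_irrefl)
  let ?W = "\<Union>(set Rs)"
  have sub: "A \<subseteq> ?W" "T \<subseteq> ?W" "\<Union>(set Qs) \<subseteq> ?W" "last Qs \<subseteq> ?W" "served A T \<subseteq> ?W"
    using Rs served_subset[of A T] last_in_set by auto
  note fin = finite_subset[OF _ *(2)]
  have "served (f ` A) (f ` T) = f ` served A T"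
    using sub fin by (intro served_image[OF *(3)]) auto
  moreover have "foldl served (f ` S) (map ((`) f) Qs) = f ` foldl served S Qs" if "S \<subseteq> ?W" for S
    using sub fin that by (intro foldl_served_image[OF *(3)]) auto
  ultimately have "foldl served (served (f ` A) (f ` T)) (map ((`) f) Qs) = f ` foldl served (served A T) Qs"
    "foldl served (f ` T) (map ((`) f) Qs) = f ` foldl served T Qs" using sub by auto
  moreover have "h (f ` foldl served (served A T) Qs) (f ` foldl served T Qs) (f ` last Qs) =
      h (foldl served (served A T) Qs) (foldl served T Qs) (last Qs)"
    using assms(1)[unfolded cyc_inv3_def, rule_format, OF fin[OF sub(4)] foldl_served_subset[OF Rs(2)]
      foldl_served_subset[OF Rs(2)] cyc_mono_subset[OF *(3) sub(4)]] .
  ultimately show "h (foldl served (served (map ((`) f) Rs ! 0) (map ((`) f) Rs ! 1)) (drop 2 (map ((`) f) Rs)))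
      (foldl served (map ((`) f) Rs ! 1) (drop 2 (map ((`) f) Rs))) (last (drop 2 (map ((`) f) Rs))) =
      tandem h Rs"
    using Rs by (simp add: last_map numeral_2_eq_2)
qed

text \<open>Both sets pass through the rows in \<open>rs\<close>, so these need
  \<open>sum_rows_interchange\<close>. The last row stays, since h depends on it.\<close>

lemma sum_rows_tandem:
  assumes "finite W" "a \<le> t" "\<And>r. r \<in> set rs \<Longrightarrow> t \<le> r" "cyc_inv3 h"
  shows "(\<Sum>Rs\<in>disjoint_rows W (a # t # rs @ [n]). tandem h Rs) =
    real (lump_factor (card W) rs) * (\<Sum>Rs\<in>disjoint_rows {..<card W - sum_list rs} [a, t, n].
      tandem h Rs)"
  using assms(1,3)
proof (induction rs arbitrary: W)
  case Nil
  let ?G = "tandem h"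
  show ?case using sum_rows_card[of "[a, t, n]" ?G W] cyc_inv_tandem[OF assms(4), of 1] Nil by simp
next
  case (Cons r rs)
  let ?G = "tandem h"
  let ?g = "\<lambda>B D Qs. h (foldl served B Qs) (foldl served D Qs) (last Qs)"
  have "sum ?G (disjoint_rows W (a # t # (r # rs) @ [n])) = (\<Sum>Rs\<in>disjoint_rows W (a # t # r # rs @ [n]).
      ?g (served (served (Rs ! 0) (Rs ! 1)) (Rs ! 2)) (served (Rs ! 1) (Rs ! 2)) (drop 3 Rs))"
  proof (rule sum.cong)
    fix Rs assume "Rs \<in> disjoint_rows W (a # t # r # rs @ [n])"
    then have "length Rs = Suc (Suc (Suc (Suc (length rs))))"
      using disjoint_rowsD[of Rs W "a # t # r # rs @ [n]"] by simp
    then obtain A T R Q Qs where "Rs = A # T # R # Q # Qs" by (auto simp: length_Suc_conv)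
    then show "?G Rs = ?g (served (served (Rs ! 0) (Rs ! 1)) (Rs ! 2)) (served (Rs ! 1) (Rs ! 2)) (drop 3 Rs)"
      by (simp add: eval_nat_numeral)
  qed simp
  also have "\<dots> = real (card W choose r) * sum ?G (disjoint_rows {..<card W - r} (a # t # rs @ [n]))"
    using Cons.prems assms cyc_inv_tandem[OF assms(4), of "length (rs @ [n])"]
    by (intro sum_rows_interchange) auto
  also have "sum ?G (disjoint_rows {..<card W - r} (a # t # rs @ [n])) =
      real (lump_factor (card W - r) rs) * sum ?G (disjoint_rows {..<card W - r - sum_list rs} [a, t, n])"
    using Cons.IH[of "{..<card W - r}"] Cons.prems by simp
  finally show ?case by simp
qed

text \<open>In a multiline queue of type (1, ..., 1) these are the entries of the last row with
  label at most p + 1: the paths from the first p + 1 rows occupy all of \<open>Rs ! p\<close>, and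
  the rows above no longer matter.\<close>

definition descend :: "nat \<Rightarrow> nat set list \<Rightarrow> nat set" where
  "descend p Rs = foldl served (Rs ! p) (drop (Suc p) Rs)"

abbreviation three_rows :: "(nat set \<Rightarrow> nat set \<Rightarrow> nat set \<Rightarrow> real) \<Rightarrow> nat set list \<Rightarrow> real" where
  "three_rows h Rs \<equiv> h (served (served (Rs ! 0) (Rs ! 1)) (Rs ! 2)) (served (Rs ! 1) (Rs ! 2)) (Rs ! 2)"

text \<open>K does not depend on h. The constant function 1 identifies it as the quotient of the
  numbers of row lists, so the averages over both kinds of lists agree.\<close>

theorem sum_rows_lump:
  fixes pre mids rest :: "nat list" and i k n :: nat
  defines "ss \<equiv> pre @ i # mids @ k # rest @ [n]"
  assumes "i \<le> k" "\<And>r. r \<in> set mids \<Longrightarrow> i \<le> r" "\<And>r. r \<in> set rest \<Longrightarrow> k \<le> r"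
    and "finite W" "card W = sum_list ss"
  obtains K :: real where "K > 0"
    "\<And>h. cyc_inv3 h \<Longrightarrow>
      (\<Sum>Rs\<in>disjoint_rows W ss.
        h (descend (length pre) Rs) (descend (length pre + Suc (length mids)) Rs) (last Rs)) =
      K * (\<Sum>Rs\<in>disjoint_rows {..<i + k + n} [i, k, n].
        three_rows h Rs)"
proof -
  let ?N0 = "card W" let ?N1 = "?N0 - sum_list pre" let ?N2 = "?N1 - sum_list mids"
  define K where "K = real (lump_factor ?N0 pre * lump_factor ?N1 mids * lump_factor ?N2 rest)"
  have N: "?N2 - sum_list rest = i + k + n" using assms(6) by (simp add: ss_def)
  have K: "K > 0" unfolding K_def using assms(6) by (simp add: ss_def lump_factor_pos)
  have "(\<Sum>Rs\<in>disjoint_rows W ss.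
        h (descend (length pre) Rs) (descend (length pre + Suc (length mids)) Rs) (last Rs)) =
      K * (\<Sum>Rs\<in>disjoint_rows {..<i + k + n} [i, k, n].
        three_rows h Rs)"
    if h: "cyc_inv3 h" for h
  proof -
    let ?G = "tandem h"
    let ?M = "\<lambda>Rs. ?G (foldl served (hd Rs) (take (length mids) (tl Rs)) # drop (length mids) (tl Rs))"
    have invG: "cyc_inv (Suc (length (k # rest @ [n]))) ?G"
      using cyc_inv_tandem[OF h, of "length (rest @ [n])"] by simp
    have invM: "cyc_inv (length (i # mids @ k # rest @ [n])) ?M"
      using cyc_inv_foldl[OF invG, of "length mids"] by simp
    have "(\<Sum>Rs\<in>disjoint_rows W ss.
        h (descend (length pre) Rs) (descend (length pre + Suc (length mids)) Rs) (last Rs)) =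
      (\<Sum>Rs\<in>disjoint_rows W ss. ?M (drop (length pre) Rs))"
    proof (rule sum.cong[OF refl])
      fix Rs assume "Rs \<in> disjoint_rows W ss"
      then have len: "length Rs = length ss" using disjoint_rowsD by blast
      define Ps where "Ps = take (length pre) Rs"
      define Qs where "Qs = drop (length pre) Rs"
      have Rs: "Rs = Ps @ Qs" "length Ps = length pre" "length Qs = length (i # mids @ k # rest @ [n])"
        using len by (auto simp: Ps_def Qs_def ss_def)
      then obtain A Qs' where Q: "Qs = A # Qs'" by (cases Qs) auto
      define Ms where "Ms = take (length mids) Qs'"
      define Ts where "Ts = drop (length mids) Qs'"
      have Q': "Qs' = Ms @ Ts" "length Ms = length mids" "length Ts = length (k # rest @ [n])"
        using Rs Q by (auto simp: Ms_def Ts_def)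
      then obtain T Us where T: "Ts = T # Us" by (cases Ts) auto
      then have Us: "Us \<noteq> []" using Q' by auto
      have dn: "foldl served (Rs ! length pre) (drop (Suc (length pre)) Rs) =
          foldl served (served (foldl served A Ms) T) Us"
        using Rs Q Q' T by (simp add: nth_append)
      have dn2: "foldl served (Rs ! (length pre + Suc (length mids))) (drop (Suc (length pre + Suc (length mids))) Rs) =
          foldl served T Us"
        using Rs Q Q' T by (simp add: nth_append)
      show "h (descend (length pre) Rs) (descend (length pre + Suc (length mids)) Rs) (last Rs) =
        ?M (drop (length pre) Rs)"
        unfolding descend_def dn dn2 using Rs Q Q' T Us by (simp add: numeral_2_eq_2)
    qed
    also have "\<dots> = real (lump_factor ?N0 pre) * sum ?M (disjoint_rows {..<?N1} (i # mids @ k # rest @ [n]))"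
      unfolding ss_def using assms(5) invM by (intro sum_rows_drop_list) auto
    also have "sum ?M (disjoint_rows {..<?N1} (i # mids @ k # rest @ [n])) =
        real (lump_factor ?N1 mids) * sum ?G (disjoint_rows {..<?N2} (i # k # rest @ [n]))"
      using sum_rows_foldl[of "{..<?N1}" mids i "k # rest @ [n]" ?G] assms(3) invG by simp
    also have "sum ?G (disjoint_rows {..<?N2} (i # k # rest @ [n])) =
        real (lump_factor ?N2 rest) * sum ?G (disjoint_rows {..<i + k + n} [i, k, n])"
      using sum_rows_tandem[of "{..<?N2}" i k rest h n] assms(2,4) h N by simp
    also have "sum ?G (disjoint_rows {..<i + k + n} [i, k, n]) =
        (\<Sum>Rs\<in>disjoint_rows {..<i + k + n} [i, k, n].
        three_rows h Rs)"
    proof (rule sum.cong[OF refl])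
      fix Rs assume "Rs \<in> disjoint_rows {..<i + k + n} [i, k, n]"
      then have "length Rs = 3" using disjoint_rowsD[of Rs "{..<i + k + n}" "[i, k, n]"] by simp
      then obtain A T C where "Rs = [A, T, C]" by (auto simp: eval_nat_numeral length_Suc_conv)
      then show "?G Rs = three_rows h Rs"
        by (simp add: eval_nat_numeral)
    qed
    finally show ?thesis by (simp add: K_def mult_ac)
  qed
  with K show thesis using that by blast
qed

section \<open>Words of arrivals and services\<close>

text \<open>
  A word is stored with its last letter first: the head of \<open>x # w\<close> is at position \<open>length w\<close>. The
  letters \<open>La\<close>, \<open>Lt\<close>, \<open>Lc\<close> stand for the three rows; \<open>La\<close> is served by \<open>Lt\<close> and \<open>Lt\<close> by \<open>Lc\<close>.
\<close>

datatype letter = La | Lt | Lc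

primrec pos :: "letter \<Rightarrow> letter list \<Rightarrow> nat set" where
  "pos l [] = {}"
| "pos l (x # w) = (if x = l then insert (length w) (pos l w) else pos l w)"

definition words :: "nat \<Rightarrow> nat \<Rightarrow> nat \<Rightarrow> letter list set" where
  "words i k m = {w. count_list w La = i \<and> count_list w Lt = k \<and> count_list w Lc = m}"

lemma pos_subset: "pos l w \<subseteq> {..<length w}"
  by (induction w) auto

lemma finite_pos [simp]: "finite (pos l w)"
  using pos_subset finite_subset by blast

lemma length_notin_pos [simp]: "length w \<notin> pos l w"
  using pos_subset by blast

lemma card_pos: "card (pos l w) = count_list w l"
  by (induction w) auto

lemma pos_disjoint: "l \<noteq> l' \<Longrightarrow> pos l w \<inter> pos l' w = {}"
  by (induction w) auto

lemma length_words:
  assumes "w \<in> words i k m"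
  shows "length w = i + k + m"
proof -
  have "length w = count_list w La + count_list w Lt + count_list w Lc"
  proof (induction w)
    case (Cons x w)
    then show ?case by (cases x) auto
  qed simp
  then show ?thesis using assms by (simp add: words_def)
qed

lemma Cons_in_disjoint_rows:
  "R # Rs \<in> disjoint_rows W (s # ss) \<longleftrightarrow> R \<subseteq> W \<and> card R = s \<and> Rs \<in> disjoint_rows (W - R) ss"
  by (auto simp: disjoint_rows.simps)

lemma pos_inj:
  "length v = length w \<Longrightarrow> (\<And>l. pos l v = pos l w) \<Longrightarrow> v = w"
proof (induction v w rule: list_induct2)
  case (Cons x v y w)
  have "length v \<in> pos x (y # w)" using Cons(3)[of x] by auto
  then have xy: "x = y" using Cons(1) by (auto split: if_splits)
  have "pos l v = pos l w" for l
    using Cons(3)[of l] Cons(1) xy by (auto split: if_splits) (metis insert_ident length_notin_pos)+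
  then show ?case using Cons xy by simp
qed simp

lemma pos_surj:
  assumes "A \<union> T \<union> C = {..<N}" "A \<inter> T = {}" "A \<inter> C = {}" "T \<inter> C = {}"
  shows "\<exists>w. length w = N \<and> pos La w = A \<and> pos Lt w = T \<and> pos Lc w = C"
  using assms
proof (induction N arbitrary: A T C)
  case (Suc N)
  let ?m = "\<lambda>X. X - {N}"
  have "?m A \<union> ?m T \<union> ?m C = (A \<union> T \<union> C) - {N}" by auto
  also have "\<dots> = {..<N}" unfolding Suc(2) by auto
  finally have "\<exists>w. length w = N \<and> pos La w = ?m A \<and> pos Lt w = ?m T \<and> pos Lc w = ?m C"
    by (rule Suc.IH) (use Suc.prems(2-4) in blast)+
  then obtain w where w: "length w = N" "pos La w = ?m A" "pos Lt w = ?m T" "pos Lc w = ?m C" by blast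
  have "N \<in> A \<union> T \<union> C" unfolding Suc(2) by simp
  then consider "N \<in> A" "N \<notin> T" "N \<notin> C" | "N \<notin> A" "N \<in> T" "N \<notin> C" | "N \<notin> A" "N \<notin> T" "N \<in> C"
    using Suc.prems(2-4) by blast
  then show ?case
  proof cases
    case 1
    with w show ?thesis by (intro exI[of _ "La # w"]) auto
  next
    case 2
    with w show ?thesis by (intro exI[of _ "Lt # w"]) auto
  next
    case 3
    with w show ?thesis by (intro exI[of _ "Lc # w"]) auto
  qed
qed auto

lemma finite_words: "finite (words i k m)"
proof -
  have "(UNIV :: letter set) = {La, Lt, Lc}" using letter.exhaust by auto
  then have "finite (UNIV :: letter set)" by (metis finite.simps)
  then have "finite {w. set w \<subseteq> (UNIV :: letter set) \<and> length w = i + k + m}"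
    by (rule finite_lists_length_eq)
  then show ?thesis by (rule rev_finite_subset) (auto dest: length_words)
qed

text \<open>The sizes add up to the number of places, so the three disjoint rows form a partition,
  which is the same as a word.\<close>

lemma sum_rows_words:
  "sum g (disjoint_rows {..<i + k + m} [i, k, m]) =
    (\<Sum>w\<in>words i k m. g [pos La w, pos Lt w, pos Lc w])"
proof -
  let ?f = "\<lambda>w. [pos La w, pos Lt w, pos Lc w]"
  have "inj_on ?f (words i k m)"
  proof (rule inj_onI)
    fix v w assume *: "v \<in> words i k m" "w \<in> words i k m" "?f v = ?f w"
    have "pos l v = pos l w" for l using * by (cases l) auto
    then show "v = w" using * length_words by (intro pos_inj) auto
  qed
  moreover have "?f ` words i k m = disjoint_rows {..<i + k + m} [i, k, m]"
  proof (intro equalityI subsetI)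
    fix Rs assume "Rs \<in> ?f ` words i k m"
    then obtain w where w: "w \<in> words i k m" "Rs = ?f w" by auto
    have "pos La w \<subseteq> {..<i+k+m}" "pos Lt w \<subseteq> {..<i+k+m} - pos La w"
      "pos Lc w \<subseteq> {..<i+k+m} - pos La w - pos Lt w"
      using pos_subset[of La w] pos_subset[of Lt w] pos_subset[of Lc w] length_words[OF w(1)]
        pos_disjoint[of La Lt w] pos_disjoint[of La Lc w] pos_disjoint[of Lt Lc w] by auto
    moreover have "card (pos La w) = i" "card (pos Lt w) = k" "card (pos Lc w) = m"
      using w by (auto simp: card_pos words_def)
    ultimately show "Rs \<in> disjoint_rows {..<i + k + m} [i, k, m]"
      using w by (simp add: Cons_in_disjoint_rows)
  next
    fix Rs assume "Rs \<in> disjoint_rows {..<i + k + m} [i, k, m]"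
    then obtain A T C where Rs: "Rs = [A, T, C]" "A \<subseteq> {..<i+k+m}" "T \<subseteq> {..<i+k+m} - A"
      "C \<subseteq> {..<i+k+m} - A - T" "card A = i" "card T = k" "card C = m"
      by (auto simp: disjoint_rows.simps)
    have fin: "finite A" "finite T" "finite C" using Rs finite_subset[OF _ finite_lessThan] by blast+
    have "card (A \<union> T \<union> C) = i + k + m"
    proof -
      have "card (A \<union> T \<union> C) = card (A \<union> T) + card C"
        using Rs fin by (intro card_Un_disjoint) blast+
      also have "card (A \<union> T) = card A + card T"
        using Rs fin by (intro card_Un_disjoint) blast+
      finally show ?thesis using Rs by simp
    qed
    then have "A \<union> T \<union> C = {..<i+k+m}"
      using Rs by (intro card_subset_eq) auto
    then obtain w where w: "length w = i + k + m" "pos La w = A" "pos Lt w = T" "pos Lc w = C"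
      using pos_surj[of A T C "i + k + m"] Rs by blast
    then have "w \<in> words i k m" using Rs card_pos[of _ w] by (auto simp: words_def)
    then show "Rs \<in> ?f ` words i k m" using w Rs by auto
  qed
  ultimately show ?thesis using sum.reindex[of ?f "words i k m" g] by (simp add: comp_def)
qed

lemma cyc_mono_rotate: "cyc_mono (\<lambda>x. if Suc x = N then 0 else Suc x) {..<N}"
proof -
  let ?r = "\<lambda>x. if Suc x = N then 0 else Suc x"
  have "inj_on ?r {..<N}" by (auto simp: inj_on_def)
  moreover have "btw (?r x) (?r z) (?r y) \<longleftrightarrow> btw x z y" if "x < N" "z < N" "y < N" for x z y
    using that by (cases "Suc x = N"; cases "Suc y = N"; cases "Suc z = N") (auto simp: btw_def)
  ultimately show ?thesis by (auto simp: cyc_mono_def)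
qed

text \<open>Rotation by one place permutes the row lists and moves the mark u to the next place. The
  reference place N - 1 is the one whose letter is the head of the word.\<close>

lemma sum_rows_rotate:
  fixes e :: "nat \<Rightarrow> nat set list \<Rightarrow> real"
  assumes inv: "\<And>f u Rs. length Rs = length ss \<Longrightarrow> \<Union>(set Rs) \<subseteq> {..<N} \<Longrightarrow> u < N \<Longrightarrow>
    cyc_mono f {..<N} \<Longrightarrow> e (f u) (map ((`) f) Rs) = e u Rs" and "u < N"
  shows "sum (e u) (disjoint_rows {..<N} ss) = sum (e (N - 1)) (disjoint_rows {..<N} ss)"
proof -
  let ?r = "\<lambda>x. if Suc x = N then 0 else Suc x"
  have img: "?r ` {..<N} = {..<N}"
  proof (rule card_subset_eq)
    show "card (?r ` {..<N}) = card {..<N}"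
      using cyc_mono_rotate[of N] by (intro card_image) (simp add: cyc_mono_def)
  qed auto
  have step: "sum (e (?r u)) (disjoint_rows {..<N} ss) = sum (e u) (disjoint_rows {..<N} ss)" if "u < N" for u
  proof -
    have "sum (e (?r u)) (disjoint_rows (?r ` {..<N}) ss) =
        (\<Sum>Rs\<in>disjoint_rows {..<N} ss. e (?r u) (map ((`) ?r) Rs))"
      using cyc_mono_rotate[of N] by (intro sum_rows_image) (auto simp: cyc_mono_def)
    also have "\<dots> = sum (e u) (disjoint_rows {..<N} ss)"
    proof (rule sum.cong[OF refl])
      fix Rs assume "Rs \<in> disjoint_rows {..<N} ss"
      then have "length Rs = length ss" "\<Union>(set Rs) \<subseteq> {..<N}" using disjoint_rowsD by blast+
      then show "e (?r u) (map ((`) ?r) Rs) = e u Rs"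
        by (rule inv[OF _ _ that cyc_mono_rotate])
    qed
    finally show ?thesis by (simp only: img)
  qed
  have "sum (e (N - 1 - d)) (disjoint_rows {..<N} ss) = sum (e (N - 1)) (disjoint_rows {..<N} ss)"
    if "d < N" for d
    using that
  proof (induction d)
    case (Suc d)
    have "?r (N - 1 - Suc d) = N - 1 - d" using Suc by auto
    then show ?case using step[of "N - 1 - Suc d"] Suc by auto
  qed simp
  from this[of "N - 1 - u"] show ?thesis using assms(2) by simp
qed

section \<open>Counting criteria for a service to be used\<close>

text \<open>One arrival t is peeled off and served last. As x is still free then, the way from t to
  its service d does not pass x. This is the induction step of the two counts below.\<close>

lemma served_insert_steps:
  assumes "finite T" "finite R" "T \<inter> R = {}" "card T \<le> card R" "x \<in> R - served T R"
  shows "T = {} \<or> (\<exists>t T' d. T = insert t T' \<and> t \<notin> T' \<and> finite T' \<and> served T R = insert d (served T' R) \<and>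
    d \<in> R - served T' R \<and> d \<noteq> x \<and> \<not> btw t x d)"
proof (cases "T = {}")
  case False
  then obtain t T' where T: "T = insert t T'" "t \<notin> T'" by (metis all_not_in_conv mk_disjoint_insert)
  then have f: "finite T'" "card T' < card R" using assms by auto
  let ?d = "cnext (R - served T' R) t"
  have "served T R = insert ?d (served T' R)" "?d \<in> R - served T' R"
    using served_insert[OF f(1) assms(2) T(2) f(2)] T by auto
  moreover from this have "x \<in> R - served T' R" "?d \<noteq> x" using assms by auto
  moreover from this have "\<not> btw t x ?d" using not_btw_cnext assms by auto
  ultimately show ?thesis using T f by blast
qed simp

lemma card_before_unused:
  assumes "finite T" "finite R" "T \<inter> R = {}" "card T \<le> card R" "x \<in> R - served T R"
  shows "card (T \<inter> {y..<x}) \<le> card (R \<inter> {y..<x})"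
proof -
  have "card (T \<inter> {y..<x}) \<le> card (served T R \<inter> {y..<x})"
    using assms
  proof (induction "card T" arbitrary: T)
    case (Suc n)
    then obtain t T' d where T: "T = insert t T'" "t \<notin> T'" "finite T'" "served T R = insert d (served T' R)"
      "d \<in> R - served T' R" "d \<noteq> x" "\<not> btw t x d"
      using served_insert_steps[OF Suc.prems] by fastforce
    have IH: "card (T' \<inter> {y..<x}) \<le> card (served T' R \<inter> {y..<x})"
      using Suc T by (intro Suc.hyps(1)) auto
    have d: "d \<in> {y..<x}" if "t \<in> {y..<x}"
      using that T(6,7) by (auto simp: btw_def)
    have fin: "finite (served T' R)" using Suc.prems by simp
    show ?case
    proof (cases "t \<in> {y..<x}")
      case True
      then have "card (T \<inter> {y..<x}) = Suc (card (T' \<inter> {y..<x}))"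
        using T by simp
      moreover have "card (served T R \<inter> {y..<x}) = Suc (card (served T' R \<inter> {y..<x}))"
        using T d[OF True] fin by simp
      ultimately show ?thesis using IH by simp
    next
      case False
      then have "T \<inter> {y..<x} = T' \<inter> {y..<x}" using T by auto
      moreover have "card (served T' R \<inter> {y..<x}) \<le> card (served T R \<inter> {y..<x})"
        using T fin by (intro card_mono) auto
      ultimately show ?thesis using IH by simp
    qed
  qed simp
  also have "\<dots> \<le> card (R \<inter> {y..<x})"
    using served_subset[of T R] assms by (intro card_mono) auto
  finally show ?thesis .
qed

text \<open>No customer passes z, so the services from y up to and including x, all of them used,
  serve arrivals from [y, x). In the second alternative of \<open>zx\<close> the barrier z is the
  topmost place, and the interval starts at 0.\<close>

lemma card_before_served:
  assumes "finite T" "finite R" "T \<inter> R = {}" "card T \<le> card R" "z \<in> R - served T R" "x \<in> served T R"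
    and zx: "z < x \<and> y = Suc z \<or> T \<union> R \<subseteq> {..z} \<and> y = 0"
    and all: "R \<inter> {y..<x} \<subseteq> served T R"
  shows "card (R \<inter> {y..<x}) < card (T \<inter> {y..<x})"
proof -
  have "card (served T R \<inter> {y..x}) \<le> card (T \<inter> {y..<x})"
    using assms(1,3,4,5) zx
  proof (induction "card T" arbitrary: T)
    case 0
    then show ?case by simp
  next
    case (Suc n)
    then obtain t T' d where T: "T = insert t T'" "t \<notin> T'" "finite T'" "served T R = insert d (served T' R)"
      "d \<in> R - served T' R" "d \<noteq> z" "\<not> btw t z d"
      using served_insert_steps[OF Suc.prems(1) assms(2) Suc.prems(2,3,4)] by fastforce
    have IH: "card (served T' R \<inter> {y..x}) \<le> card (T' \<inter> {y..<x})"
      using Suc T by (intro Suc.hyps(1)) auto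
    have tz: "t \<noteq> z" using T Suc.prems by auto
    have td: "t \<noteq> d" using T Suc.prems by auto
    have t: "t \<in> {y..<x}" if "d \<in> {y..x}"
      using that T(1,5,6,7) Suc.prems(5) tz td unfolding btw_def by auto
    have fin: "finite (served T' R)" using assms by simp
    show ?case
    proof (cases "d \<in> {y..x}")
      case True
      then have "card (T \<inter> {y..<x}) = Suc (card (T' \<inter> {y..<x}))"
        using T t by simp
      moreover have "card (served T R \<inter> {y..x}) = Suc (card (served T' R \<inter> {y..x}))"
        using T True fin by simp
      ultimately show ?thesis using IH by simp
    next
      case False
      then have "served T R \<inter> {y..x} = served T' R \<inter> {y..x}" using T by auto
      moreover have "card (T' \<inter> {y..<x}) \<le> card (T \<inter> {y..<x})"
        using T by (intro card_mono) auto
      ultimately show ?thesis using IH by simp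
    qed
  qed
  moreover have "card (R \<inter> {y..<x}) < card (served T R \<inter> {y..x})"
  proof (rule psubset_card_mono)
    have "x \<in> served T R \<inter> {y..x}" using assms(6) zx by auto
    moreover have "R \<inter> {y..<x} \<subseteq> served T R \<inter> {y..x}" using all by auto
    moreover have "x \<notin> R \<inter> {y..<x}" by simp
    ultimately show "R \<inter> {y..<x} \<subset> served T R \<inter> {y..x}" by blast
  qed (use assms in simp)
  ultimately show ?thesis by simp
qed

lemma served_excess:
  assumes "finite T" "finite R" "T \<inter> R = {}" "card T \<le> card R" "z \<in> R - served T R" "x \<in> served T R"
    and "z < x \<or> T \<union> R \<subseteq> {..z}"
  shows "\<exists>y\<le>x. card (R \<inter> {y..<x}) < card (T \<inter> {y..<x})"
proof (cases "\<exists>z. z \<in> R - served T R \<and> z < x")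
  case True
  let ?Z = "{z \<in> R - served T R. z < x}"
  let ?z = "Max ?Z"
  have fin: "finite ?Z" using assms by auto
  then have z: "?z \<in> ?Z" using True by (intro Max_in) auto
  have "card (R \<inter> {Suc ?z..<x}) < card (T \<inter> {Suc ?z..<x})"
  proof (rule card_before_served[OF assms(1-4) _ assms(6)])
    show "R \<inter> {Suc ?z..<x} \<subseteq> served T R"
    proof
      fix r assume r: "r \<in> R \<inter> {Suc ?z..<x}"
      show "r \<in> served T R"
      proof (rule ccontr)
        assume "r \<notin> served T R"
        then have "r \<le> ?z" using r fin by (intro Max_ge) auto
        then show False using r by simp
      qed
    qed
  qed (use z in auto)
  then show ?thesis using z by (intro exI[of _ "Suc ?z"]) auto
next
  case False
  then have "T \<union> R \<subseteq> {..z}" using assms by auto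
  then have "card (R \<inter> {0..<x}) < card (T \<inter> {0..<x})"
    using False by (intro card_before_served[OF assms(1-6)]) auto
  then show ?thesis by (intro exI[of _ 0]) auto
qed

section \<open>Queues along a word\<close>

text \<open>Here q is the maximum over y of arrivals minus services in [y, L), the usual formula for
  the length of a queue that starts empty. It connects recursions along a word with the counting
  criteria for \<open>served\<close>.\<close>

definition queue_len :: "nat set \<Rightarrow> nat set \<Rightarrow> nat \<Rightarrow> nat \<Rightarrow> bool" where
  "queue_len P R L q \<longleftrightarrow> (\<forall>y. card (P \<inter> {y..<L}) \<le> card (R \<inter> {y..<L}) + q) \<and>
     (\<exists>y\<le>L. card (P \<inter> {y..<L}) = card (R \<inter> {y..<L}) + q)"

lemma queue_len_empty: "queue_len {} {} 0 0"
  by (auto simp: queue_len_def)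

lemma card_interval_Suc:
  assumes "P \<subseteq> {..<L}"
  shows "card (P \<inter> {y..<Suc L}) = card (P \<inter> {y..<L})"
    and "card (insert L P \<inter> {y..<Suc L}) = card (P \<inter> {y..<L}) + (if y \<le> L then 1 else 0)"
proof -
  have f: "finite (P \<inter> {y..<L})" using finite_subset[OF assms] by auto
  have "P \<inter> {y..<Suc L} = P \<inter> {y..<L}" using assms by auto
  then show "card (P \<inter> {y..<Suc L}) = card (P \<inter> {y..<L})" by simp
  have "insert L P \<inter> {y..<Suc L} = (if y \<le> L then insert L (P \<inter> {y..<L}) else P \<inter> {y..<L})"
    using assms by auto
  then show "card (insert L P \<inter> {y..<Suc L}) = card (P \<inter> {y..<L}) + (if y \<le> L then 1 else 0)"
    using f by simp
qed

lemma queue_len_step: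
  assumes "queue_len P R L q" "P \<subseteq> {..<L}" "R \<subseteq> {..<L}"
  shows "queue_len (insert L P) R (Suc L) (Suc q)" "queue_len P (insert L R) (Suc L) (q - 1)"
    "queue_len P R (Suc L) q"
proof -
  obtain y0 where y0: "y0 \<le> L" "card (P \<inter> {y0..<L}) = card (R \<inter> {y0..<L}) + q"
    using assms(1) by (auto simp: queue_len_def)
  have le: "card (P \<inter> {y..<L}) \<le> card (R \<inter> {y..<L}) + q" for y
    using assms(1) by (auto simp: queue_len_def)
  note [simp] = card_interval_Suc[OF assms(2)] card_interval_Suc[OF assms(3)]
  show "queue_len (insert L P) R (Suc L) (Suc q)"
    unfolding queue_len_def using y0 le by (auto intro!: exI[of _ y0] simp: le_SucI)
  show "queue_len P R (Suc L) q"
    unfolding queue_len_def using y0 le by (auto intro!: exI[of _ y0])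
  show "queue_len P (insert L R) (Suc L) (q - 1)"
  proof -
    have "card (P \<inter> {y..<Suc L}) \<le> card (insert L R \<inter> {y..<Suc L}) + (q - 1)" for y
      unfolding card_interval_Suc(2)[OF assms(3)] card_interval_Suc(1)[OF assms(2)]
      using le[of y] by (cases "y \<le> L") auto
    moreover have "\<exists>y\<le>Suc L. card (P \<inter> {y..<Suc L}) = card (insert L R \<inter> {y..<Suc L}) + (q - 1)"
    proof (cases q)
      case 0
      \<comment> \<open>A service offered to an empty queue is lost; the maximum 0 is attained on
        the empty interval.\<close>
      then show ?thesis by (intro exI[of _ "Suc L"]) simp
    next
      case (Suc q')
      then show ?thesis
        unfolding card_interval_Suc(2)[OF assms(3)] card_interval_Suc(1)[OF assms(2)]
        using y0 by (intro exI[of _ y0]) simp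
    qed
    ultimately show ?thesis unfolding queue_len_def by blast
  qed
qed

lemma queue_len_pos_iff:
  assumes "queue_len P R L q"
  shows "q > 0 \<longleftrightarrow> (\<exists>y\<le>L. card (R \<inter> {y..<L}) < card (P \<inter> {y..<L}))"
proof
  assume "q > 0"
  moreover obtain y where "y \<le> L" "card (P \<inter> {y..<L}) = card (R \<inter> {y..<L}) + q"
    using assms by (auto simp: queue_len_def)
  ultimately show "\<exists>y\<le>L. card (R \<inter> {y..<L}) < card (P \<inter> {y..<L})" by (intro exI[of _ y]) simp
next
  assume "\<exists>y\<le>L. card (R \<inter> {y..<L}) < card (P \<inter> {y..<L})"
  then show "q > 0" using assms unfolding queue_len_def by (metis add_0_right not_gr_zero not_less)
qed

primrec queueA :: "letter list \<Rightarrow> nat" where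
  "queueA [] = 0"
| "queueA (x # w) = (case x of La \<Rightarrow> Suc (queueA w) | Lt \<Rightarrow> queueA w - 1 | Lc \<Rightarrow> queueA w)"

text \<open>
  \<open>hits w\<close> are the positions of the letters \<open>Lt\<close> that serve an \<open>La\<close> when nothing wraps around; \<open>queueS\<close>
  counts only these among the customers waiting for \<open>Lc\<close>, where they have priority.
\<close>

primrec hits :: "letter list \<Rightarrow> nat set" where
  "hits [] = {}"
| "hits (x # w) = (if x = Lt \<and> queueA w > 0 then insert (length w) (hits w) else hits w)"

primrec queueS :: "letter list \<Rightarrow> nat" where
  "queueS [] = 0"
| "queueS (x # w) = (case x of La \<Rightarrow> queueS w | Lt \<Rightarrow> (if queueA w > 0 then Suc (queueS w) else queueS w)
    | Lc \<Rightarrow> queueS w - 1)"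

primrec queueT :: "letter list \<Rightarrow> nat" where
  "queueT [] = 0"
| "queueT (x # w) = (case x of La \<Rightarrow> queueT w | Lt \<Rightarrow> Suc (queueT w) | Lc \<Rightarrow> queueT w - 1)"

lemma hits_subset: "hits w \<subseteq> pos Lt w"
  by (induction w) auto

lemma queue_len_A: "queue_len (pos La w) (pos Lt w) (length w) (queueA w)"
proof (induction w)
  case (Cons x w)
  then show ?case using queue_len_step[OF Cons pos_subset pos_subset] by (cases x) auto
qed (simp add: queue_len_empty)

lemma queue_len_S: "queue_len (hits w) (pos Lc w) (length w) (queueS w)"
proof (induction w)
  case (Cons x w)
  then show ?case
    using queue_len_step[OF Cons subset_trans[OF hits_subset pos_subset] pos_subset] by (cases x) auto
qed (simp add: queue_len_empty)

lemma queue_len_T: "queue_len (pos Lt w) (pos Lc w) (length w) (queueT w)"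
proof (induction w)
  case (Cons x w)
  then show ?case using queue_len_step[OF Cons pos_subset pos_subset] by (cases x) auto
qed (simp add: queue_len_empty)

lemma queueS_le_queueT: "queueS w \<le> queueT w"
proof (induction w)
  case (Cons x w)
  then show ?case by (cases x) auto
qed simp

lemma hits_iff:
  "t \<in> hits w \<longleftrightarrow> t \<in> pos Lt w \<and>
    (\<exists>y\<le>t. card (pos Lt w \<inter> {y..<t}) < card (pos La w \<inter> {y..<t}))"
proof (induction w)
  case (Cons x w)
  have old: "pos l (x # w) \<inter> {y..<t} = pos l w \<inter> {y..<t}" if "t \<le> length w" for l y
    using that by auto
  have sub: "t < length w" if "t \<in> pos Lt w" using that pos_subset by blast
  show ?case
  proof (cases "t = length w")
    case True
    have "t \<notin> hits w" "t \<notin> pos Lt w" using True hits_subset[of w] length_notin_pos[of w Lt] by blast+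
    then show ?thesis
      using queue_len_pos_iff[OF queue_len_A[of w]] old True by (auto simp del: pos.simps simp: pos.simps(2)[of Lt])
  next
    case False
    then have "t \<in> hits (x # w) \<longleftrightarrow> t \<in> hits w" "t \<in> pos Lt (x # w) \<longleftrightarrow> t \<in> pos Lt w" by auto
    then show ?thesis using Cons sub old by (metis less_imp_le)
  qed
qed simp

lemma hits_served:
  assumes "count_list w La < count_list w Lt"
  shows "hits w \<subseteq> served (pos La w) (pos Lt w)"
    and "t \<in> pos Lt w \<Longrightarrow> t \<notin> hits w \<Longrightarrow> (\<And>t'. t' \<in> pos Lt w \<Longrightarrow> t < t' \<Longrightarrow> t' \<in> hits w) \<Longrightarrow>
      t \<notin> served (pos La w) (pos Lt w)"
proof -
  let ?A = "pos La w" and ?T = "pos Lt w"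
  let ?S = "served ?A ?T"
  have c: "card ?A \<le> card ?T" "?A \<inter> ?T = {}" using assms pos_disjoint[of La Lt w] by (auto simp: card_pos)
  show sub: "hits w \<subseteq> ?S"
  proof
    fix t assume t: "t \<in> hits w"
    show "t \<in> ?S"
    proof (rule ccontr)
      assume "t \<notin> ?S"
      then have "t \<in> ?T - ?S" using t hits_subset by auto
      then have "card (?A \<inter> {y..<t}) \<le> card (?T \<inter> {y..<t})" for y
        using c by (intro card_before_unused) auto
      then show False using t unfolding hits_iff by (meson not_less)
    qed
  qed
  assume t: "t \<in> ?T" "t \<notin> hits w" and last: "\<And>t'. t' \<in> ?T \<Longrightarrow> t < t' \<Longrightarrow> t' \<in> hits w"
  show "t \<notin> ?S"
  proof
    assume tS: "t \<in> ?S"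
    have "card ?S < card ?T" using card_served[of ?A ?T] c assms by (simp add: card_pos)
    then have "?T - ?S \<noteq> {}" using card_mono[of ?S ?T] by auto
    then obtain z where z: "z \<in> ?T - ?S" by auto
    then have "z < t" using last sub tS by (metis DiffD1 DiffD2 in_mono linorder_neqE_nat)
    then have "\<exists>y\<le>t. card (?T \<inter> {y..<t}) < card (?A \<inter> {y..<t})"
      using z tS c by (intro served_excess[of ?A ?T z t]) auto
    then show False using t hits_iff by blast
  qed
qed

lemma pos_replicate_La: "l \<noteq> La \<Longrightarrow> pos l (replicate r La @ w) = pos l w"
  by (induction r) auto

lemma queueT_replicate_La: "queueT (replicate r La @ w) = queueT w"
  by (induction r) auto

lemma last_pos_Lc:
  assumes "c \<in> pos Lc w" "\<And>x. c < x \<Longrightarrow> x < length w \<Longrightarrow> x \<notin> pos Lc w \<and> x \<notin> pos Lt w"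
  shows "\<exists>r v. w = replicate r La @ Lc # v \<and> length v = c"
  using assms
proof (induction w)
  case (Cons x w)
  show ?case
  proof (cases "c = length w")
    case True
    then have "x = Lc" using Cons.prems(1) by (auto split: if_splits)
    then show ?thesis using True by (intro exI[of _ 0] exI[of _ w]) simp
  next
    case False
    then have cw: "c \<in> pos Lc w" using Cons.prems(1) by (auto split: if_splits)
    then have "c < length w" using pos_subset by blast
    then have "x \<noteq> Lc" "x \<noteq> Lt" using Cons.prems(2)[of "length w"] by auto
    then have x: "x = La" by (cases x) auto
    have "\<exists>r v. w = replicate r La @ Lc # v \<and> length v = c"
      using Cons.prems(2) cw x by (intro Cons.IH) auto
    then obtain r v where "w = replicate r La @ Lc # v" "length v = c" by blast
    then show ?thesis using x by (intro exI[of _ "Suc r"] exI[of _ v]) simp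
  qed
qed simp

section \<open>The event at the last place\<close>

lemma last_service:
  fixes w :: "letter list"
  defines "L \<equiv> length w"
  defines "T \<equiv> pos Lt w" and "C \<equiv> insert L (pos Lc w)"
  assumes S: "S \<subseteq> T" and less: "count_list w Lt \<le> count_list w Lc"
  shows "L \<in> C - served T C \<longleftrightarrow> queueT w = 0"
    and "(L \<in> C - served T C \<and> (\<exists>c\<in>served S C. cnext C c = L)) \<longleftrightarrow>
      queueT w = 0 \<and> (\<exists>r v. w = replicate r La @ Lc # v \<and>
        (\<exists>y\<le>length v. card (pos Lc v \<inter> {y..<length v}) < card (S \<inter> {y..<length v})))"
proof -
  have fin: "finite T" "finite C" "finite S" using finite_subset[OF S] by (auto simp: T_def C_def)
  have TL: "T \<subseteq> {..<L}" "pos Lc w \<subseteq> {..<L}" using pos_subset by (auto simp: T_def L_def)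
  have disj: "T \<inter> C = {}" "S \<inter> C = {}"
    using pos_disjoint[of Lt Lc w] TL S by (auto simp: T_def C_def)
  have cC: "card C = Suc (count_list w Lc)" by (simp add: C_def L_def card_pos)
  have cT: "card T < card C" using less cC by (simp add: T_def card_pos)
  have cS: "card S \<le> card C" using card_mono[OF fin(1) S] cT by simp
  have iv: "C \<inter> {y..<x} = pos Lc w \<inter> {y..<x}" if "x \<le> L" for x y
    using that by (auto simp: C_def)
  show 1: "L \<in> C - served T C \<longleftrightarrow> queueT w = 0"
  proof
    assume "L \<in> C - served T C"
    then have "card (T \<inter> {y..<L}) \<le> card (pos Lc w \<inter> {y..<L})" for y
      using card_before_unused[of T C L y] fin disj cT iv[of L y] by auto
    then have "\<not> (\<exists>y\<le>L. card (pos Lc w \<inter> {y..<L}) < card (T \<inter> {y..<L}))" by (meson not_less)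
    then show "queueT w = 0"
      using queue_len_pos_iff[OF queue_len_T[of w]] unfolding T_def L_def by blast
  next
    assume q: "queueT w = 0"
    show "L \<in> C - served T C"
    proof (rule ccontr)
      assume "L \<notin> C - served T C"
      then have L: "L \<in> served T C" by (simp add: C_def)
      have "card (served T C) < card C" using card_served[of T C] fin cT by simp
      then obtain z where z: "z \<in> C - served T C"
        by (metis Diff_eq_empty_iff all_not_in_conv card_mono fin(2) finite_served leD)
      then have "z \<noteq> L" using L by auto
      then have "z < L" using z TL by (auto simp: C_def)
      then have "\<exists>y\<le>L. card (C \<inter> {y..<L}) < card (T \<inter> {y..<L})"
        using z L fin disj cT by (intro served_excess) auto
      then have "queueT w > 0"
        using queue_len_pos_iff[OF queue_len_T[of w]] iv[of L] unfolding T_def L_def by simp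
      then show False using q by simp
    qed
  qed
  have served_iff: "c \<in> served S C \<longleftrightarrow> (\<exists>y\<le>c. card (pos Lc w \<inter> {y..<c}) < card (S \<inter> {y..<c}))"
    if "L \<in> C - served T C" "c \<in> C" for c
  proof -
    have "L \<in> C - served S C"
      using that served_mono[OF fin(1,2) S] cT by auto
    moreover have "S \<union> C \<subseteq> {..L}" using S TL by (auto simp: C_def)
    ultimately have "c \<in> served S C \<Longrightarrow> \<exists>y\<le>c. card (C \<inter> {y..<c}) < card (S \<inter> {y..<c})"
      using fin disj cS by (intro served_excess[of S C L]) auto
    moreover have "card (S \<inter> {y..<c}) \<le> card (C \<inter> {y..<c})" if "c \<notin> served S C" for y
      using fin disj cS that \<open>c \<in> C\<close> by (intro card_before_unused) auto
    moreover have "c \<le> L" using that TL by (auto simp: C_def)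
    ultimately show ?thesis using iv[of c] by (metis not_less)
  qed
  have LS: "L \<notin> served S C" if "L \<in> C - served T C"
    using that served_mono[OF fin(1,2) S] cT by auto
  show "(L \<in> C - served T C \<and> (\<exists>c\<in>served S C. cnext C c = L)) \<longleftrightarrow>
      queueT w = 0 \<and> (\<exists>r v. w = replicate r La @ Lc # v \<and>
        (\<exists>y\<le>length v. card (pos Lc v \<inter> {y..<length v}) < card (S \<inter> {y..<length v})))"
    (is "?l \<longleftrightarrow> ?r")
  proof
    assume l: ?l
    then obtain c where c: "c \<in> served S C" "cnext C c = L" by auto
    then have cC': "c \<in> C" "c \<noteq> L" using served_subset LS l by auto
    then have "c < L" using TL by (auto simp: C_def)
    have noC: "x \<notin> pos Lc w" if "c < x" "x < L" for x
      using not_btw_cnext[of C x c] c fin that by (auto simp: C_def btw_def)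
    have "T \<inter> {Suc c..<L} = {}"
    proof -
      have "pos Lc w \<inter> {Suc c..<L} = {}" using noC by auto
      then have "card (T \<inter> {Suc c..<L}) = 0"
        using card_before_unused[of T C L "Suc c"] fin disj cT l iv[of L "Suc c"] by auto
      then show ?thesis using fin by simp
    qed
    then have noT: "x \<notin> pos Lt w" if "c < x" "x < L" for x using that by (auto simp: T_def)
    have "\<exists>r v. w = replicate r La @ Lc # v \<and> length v = c"
      using cC' noC noT unfolding C_def L_def by (intro last_pos_Lc) auto
    then obtain r v where v: "w = replicate r La @ Lc # v" "length v = c" by blast
    have pv: "pos Lc w \<inter> {y..<c} = pos Lc v \<inter> {y..<c}" for y
      using v by (auto simp: pos_replicate_La)
    have "\<exists>y\<le>c. card (pos Lc w \<inter> {y..<c}) < card (S \<inter> {y..<c})"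
      using served_iff c cC' l by blast
    then show ?r using 1 l v pv by auto
  next
    assume r: ?r
    then obtain r v where v: "w = replicate r La @ Lc # v"
      and ex: "\<exists>y\<le>length v. card (pos Lc v \<inter> {y..<length v}) < card (S \<inter> {y..<length v})" by blast
    let ?c = "length v"
    have l: "L \<in> C - served T C" using r 1 by simp
    have pw: "pos Lc w = insert ?c (pos Lc v)" using v by (simp add: pos_replicate_La)
    have cC': "?c \<in> C" by (simp add: C_def pw)
    have "pos Lc w \<inter> {y..<?c} = pos Lc v \<inter> {y..<?c}" for y using pw by auto
    then have "?c \<in> served S C" using served_iff[OF l cC'] ex by auto
    moreover have "cnext C ?c = L"
    proof (rule cnext_eqI)
      fix z assume "z \<in> C"
      then have "z \<le> ?c \<or> z = L" using pw pos_subset[of Lc v] by (auto simp: C_def)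
      moreover have "?c < L" using v by (simp add: L_def)
      ultimately show "\<not> btw ?c z L" by (auto simp: btw_def)
    qed (use fin in \<open>auto simp: C_def\<close>)
    ultimately show ?l using l by blast
  qed
qed

primrec good :: "letter list \<Rightarrow> bool" where
  "good [] = False"
| "good (x # w) = (case x of La \<Rightarrow> good w | Lt \<Rightarrow> False | Lc \<Rightarrow> queueS w = 1 \<and> queueT w = 1)"

lemma good_iff:
  "good w \<longleftrightarrow> (\<exists>r v. w = replicate r La @ Lc # v \<and> queueS v = 1 \<and> queueT v = 1)"
proof (induction w)
  case (Cons x w)
  show ?case
  proof (cases x)
    case La
    have "(\<exists>r v. La # w = replicate r La @ Lc # v \<and> queueS v = 1 \<and> queueT v = 1) \<longleftrightarrow>
      (\<exists>r v. w = replicate r La @ Lc # v \<and> queueS v = 1 \<and> queueT v = 1)" (is "?l \<longleftrightarrow> ?r")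
    proof
      assume ?l
      then obtain r v where *: "La # w = replicate r La @ Lc # v" "queueS v = 1" "queueT v = 1" by blast
      then obtain r' where "r = Suc r'" by (cases r) auto
      then show ?r using * by auto
    next
      assume ?r
      then obtain r v where "w = replicate r La @ Lc # v" "queueS v = 1" "queueT v = 1" by blast
      then show ?l by (intro exI[of _ "Suc r"] exI[of _ v]) auto
    qed
    then show ?thesis using La Cons by simp
  next
    case Lt
    have "Lt # w \<noteq> replicate r La @ Lc # v" for r v by (cases r) auto
    then show ?thesis using Lt by simp
  next
    case Lc
    have "Lc # w = replicate r La @ Lc # v \<longleftrightarrow> r = 0 \<and> w = v" for r v by (cases r) auto
    then show ?thesis using Lc by auto
  qed
qed simp

text \<open>
  Since there are fewer arrivals \<open>La\<close> than services \<open>Lt\<close>, the arrivals that wrap around cannot reach the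
  last service missed without wrapping, and only the services after it matter.
\<close>

theorem good_event:
  fixes w :: "letter list"
  defines "L \<equiv> length w"
  defines "T \<equiv> pos Lt w" and "C \<equiv> insert L (pos Lc w)"
  assumes "count_list w La < count_list w Lt" "count_list w Lt \<le> count_list w Lc"
  shows "(L \<in> C - served T C \<and> (\<exists>c\<in>served (served (pos La w) T) C. cnext C c = L)) \<longleftrightarrow> good w"
proof -
  let ?S = "served (pos La w) T"
  have S: "?S \<subseteq> T" by (rule served_subset)
  have ex: "(\<exists>y\<le>length v. card (pos Lc v \<inter> {y..<length v}) < card (?S \<inter> {y..<length v})) \<longleftrightarrow> queueS v = 1 \<and> queueT v = 1"
    if v: "w = replicate r La @ Lc # v" and q: "queueT w = 0" for r v
  proof -
    let ?c = "length v"
    have Tv: "T = pos Lt v" using v by (simp add: T_def pos_replicate_La)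
    have "hits w = hits v" unfolding v by (induction r) auto
    have qv: "queueT v \<le> 1" using q v by (simp add: queueT_replicate_La)
    have "(\<exists>y\<le>?c. card (pos Lc v \<inter> {y..<?c}) < card (?S \<inter> {y..<?c})) \<longleftrightarrow>
        (\<exists>y\<le>?c. card (pos Lc v \<inter> {y..<?c}) < card (hits v \<inter> {y..<?c}))"
    proof
      assume "\<exists>y\<le>?c. card (pos Lc v \<inter> {y..<?c}) < card (hits v \<inter> {y..<?c})"
      then obtain y where y: "y \<le> ?c" "card (pos Lc v \<inter> {y..<?c}) < card (hits v \<inter> {y..<?c})" by blast
      have "card (hits v \<inter> {y..<?c}) \<le> card (?S \<inter> {y..<?c})"
        using hits_served(1)[OF assms(4)] \<open>hits w = hits v\<close> by (intro card_mono) (auto simp: T_def)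
      then show "\<exists>y\<le>?c. card (pos Lc v \<inter> {y..<?c}) < card (?S \<inter> {y..<?c})"
        using y by (intro exI[of _ y]) simp
    next
      assume "\<exists>y\<le>?c. card (pos Lc v \<inter> {y..<?c}) < card (?S \<inter> {y..<?c})"
      then obtain y where y: "y \<le> ?c" "card (pos Lc v \<inter> {y..<?c}) < card (?S \<inter> {y..<?c})" by blast
      have "card (T \<inter> {y..<?c}) \<le> card (pos Lc v \<inter> {y..<?c}) + queueT v"
        using queue_len_T[of v] Tv by (auto simp: queue_len_def)
      then have "card (T \<inter> {y..<?c}) \<le> card (?S \<inter> {y..<?c})" using y qv by linarith
      \<comment> \<open>On this interval T exceeds the services by at most \<open>queueT v\<close>,
        hence by at most 1, while its subset \<open>?S\<close> exceeds them by at least 1.\<close>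
      then have eq: "?S \<inter> {y..<?c} = T \<inter> {y..<?c}"
        using S by (intro card_seteq) (auto simp: T_def)
      \<comment> \<open>The last miss does not belong to \<open>?S\<close>, so it lies before y, and
        all of T from y on consists of hits.\<close>
      let ?M = "T - hits w"
      have "T \<inter> {y..<?c} \<subseteq> hits w"
      proof (cases "?M = {}")
        case False
        let ?m = "Max ?M"
        have fM: "finite ?M" by (simp add: T_def)
        then have m: "?m \<in> ?M" using False by (intro Max_in) auto
        have gt: "t' \<in> hits w" if "t' \<in> T" "?m < t'" for t'
          using Max_ge[OF fM, of t'] that by auto
        then have "?m \<notin> ?S" using hits_served(2)[OF assms(4), of ?m] m unfolding T_def by blast
        moreover have mT: "?m \<in> T" using m by blast
        ultimately have "?m \<notin> {y..<?c}" using eq by blast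
        moreover have "?m < ?c" using mT Tv pos_subset[of Lt v] by blast
        ultimately have "?m < y" by (meson atLeastLessThan_iff not_le)
        then show ?thesis using gt by auto
      qed auto
      then have "card (?S \<inter> {y..<?c}) \<le> card (hits v \<inter> {y..<?c})"
        using eq \<open>hits w = hits v\<close> by (intro card_mono) auto
      then show "\<exists>y\<le>?c. card (pos Lc v \<inter> {y..<?c}) < card (hits v \<inter> {y..<?c})"
        using y by (intro exI[of _ y]) simp
    qed
    also have "\<dots> \<longleftrightarrow> queueS v > 0" using queue_len_pos_iff[OF queue_len_S[of v]] by simp
    also have "\<dots> \<longleftrightarrow> queueS v = 1 \<and> queueT v = 1" using qv queueS_le_queueT[of v] by auto
    finally show ?thesis .
  qed
  have gT: "queueT w = 0" if "good w"
    using that by (auto simp: good_iff queueT_replicate_La)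
  show ?thesis
    using last_service(2)[of ?S w] S assms(5) ex gT unfolding good_iff L_def T_def C_def by blast
qed

text \<open>This is \<open>last_service\<close> with S = T, needed for i = k. Without letters La,
  the last Lc is the head of the word.\<close>

lemma event_two_rows:
  fixes w :: "letter list"
  defines "L \<equiv> length w"
  defines "T \<equiv> pos Lt w" and "C \<equiv> insert L (pos Lc w)"
  assumes "count_list w La = 0" "count_list w Lt \<le> count_list w Lc"
  shows "(L \<in> C - served T C \<and> (\<exists>c\<in>served T C. cnext C c = L)) \<longleftrightarrow>
    (\<exists>v. w = Lc # v \<and> queueT v = 1)"
proof -
  have "(\<exists>y\<le>length v. card (pos Lc v \<inter> {y..<length v}) < card (T \<inter> {y..<length v})) \<longleftrightarrow> queueT v > 0"
    if "w = Lc # v" for v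
    using queue_len_pos_iff[OF queue_len_T[of v]] that by (simp add: T_def)
  moreover have "r = 0" if "w = replicate r La @ v" for r v
    using assms(4) that by (cases r) simp_all
  ultimately have "(L \<in> C - served T C \<and> (\<exists>c\<in>served T C. cnext C c = L)) \<longleftrightarrow>
      queueT w = 0 \<and> (\<exists>v. w = Lc # v \<and> queueT v > 0)"
    using last_service(2)[of T w] assms(5) unfolding L_def T_def C_def
    by (metis append_Nil order_refl replicate_0)
  also have "\<dots> \<longleftrightarrow> (\<exists>v. w = Lc # v \<and> queueT v = 1)" by auto
  finally show ?thesis .
qed

section \<open>Counting words by their final state\<close>

definition num_words :: "nat \<Rightarrow> nat \<Rightarrow> nat \<Rightarrow> (letter list \<Rightarrow> bool) \<Rightarrow> nat" where
  "num_words i k m P = card {w \<in> words i k m. P w}"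

lemma num_words_cong: "(\<And>w. w \<in> words i k m \<Longrightarrow> P w \<longleftrightarrow> Q w) \<Longrightarrow> num_words i k m P = num_words i k m Q"
  unfolding num_words_def by (rule arg_cong[of _ _ card]) auto

lemma num_words_eq_0: "(\<And>w. w \<in> words i k m \<Longrightarrow> \<not> P w) \<Longrightarrow> num_words i k m P = 0"
  unfolding num_words_def by (metis (no_types, lifting) card_eq_0_iff empty_Collect_eq)

lemma num_words_disj:
  assumes "\<And>w. w \<in> words i k m \<Longrightarrow> \<not> (P w \<and> Q w)"
  shows "num_words i k m (\<lambda>w. P w \<or> Q w) = num_words i k m P + num_words i k m Q"
proof -
  have "{w \<in> words i k m. P w \<or> Q w} = {w \<in> words i k m. P w} \<union> {w \<in> words i k m. Q w}" by auto
  then show ?thesis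
    unfolding num_words_def using assms finite_words[of i k m] by (auto intro!: card_Un_disjoint)
qed

lemma num_words_head:
  "num_words i k m P = (if i + k + m = 0 \<and> P [] then 1 else 0)
    + (if i > 0 then num_words (i - 1) k m (\<lambda>w. P (La # w)) else 0)
    + (if k > 0 then num_words i (k - 1) m (\<lambda>w. P (Lt # w)) else 0)
    + (if m > 0 then num_words i k (m - 1) (\<lambda>w. P (Lc # w)) else 0)"
proof -
  let ?W = "\<lambda>l. {w \<in> words i k m. P w \<and> (\<exists>v. w = l # v)}"
  let ?E = "{w \<in> words i k m. P w \<and> w = []}"
  have fin: "finite {w \<in> words i k m. R w}" for R using finite_words by auto
  have split: "{w \<in> words i k m. P w} = ?E \<union> ?W La \<union> ?W Lt \<union> ?W Lc"
  proof -
    have "w = [] \<or> (\<exists>v. w = La # v) \<or> (\<exists>v. w = Lt # v) \<or> (\<exists>v. w = Lc # v)" for w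
      by (metis letter.exhaust list.exhaust)
    then show ?thesis by blast
  qed
  have "num_words i k m P = card ?E + card (?W La) + card (?W Lt) + card (?W Lc)"
    unfolding num_words_def split using fin
    by (subst card_Un_disjoint; (subst card_Un_disjoint)?; auto)+
  moreover have "card ?E = (if i + k + m = 0 \<and> P [] then 1 else 0)"
  proof -
    have "?E = (if i + k + m = 0 \<and> P [] then {[]} else {})" by (auto simp: words_def)
    then show ?thesis by simp
  qed
  moreover have "card (?W La) = (if i > 0 then num_words (i - 1) k m (\<lambda>w. P (La # w)) else 0)"
  proof -
    have "?W La = (if i > 0 then (#) La ` {w \<in> words (i - 1) k m. P (La # w)} else {})"
      by (auto simp: words_def image_iff)
    then show ?thesis by (simp add: num_words_def card_image)
  qed
  moreover have "card (?W Lt) = (if k > 0 then num_words i (k - 1) m (\<lambda>w. P (Lt # w)) else 0)"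
  proof -
    have "?W Lt = (if k > 0 then (#) Lt ` {w \<in> words i (k - 1) m. P (Lt # w)} else {})"
      by (auto simp: words_def image_iff)
    then show ?thesis by (simp add: num_words_def card_image)
  qed
  moreover have "card (?W Lc) = (if m > 0 then num_words i k (m - 1) (\<lambda>w. P (Lc # w)) else 0)"
  proof -
    have "?W Lc = (if m > 0 then (#) Lc ` {w \<in> words i k (m - 1). P (Lc # w)} else {})"
      by (auto simp: words_def image_iff)
    then show ?thesis by (simp add: num_words_def card_image)
  qed
  ultimately show ?thesis by simp
qed

lemma num_words_total:
  "num_words i k m (\<lambda>_. True) * (fact i * fact k * fact m) = fact (i + k + m)"
proof (induction "i + k + m" arbitrary: i k m rule: less_induct)
  case less
  let ?n = "\<lambda>i k m. num_words i k m (\<lambda>_. True)"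
  show ?case
  proof (cases "i + k + m = 0")
    case True
    then show ?thesis using num_words_head[of i k m "\<lambda>_. True"] by simp
  next
    case False
    have a: "(if i > 0 then ?n (i - 1) k m else 0) * (fact i * fact k * fact m) = i * fact (i + k + m - 1)"
    proof (cases i)
      case (Suc i')
      have "?n i' k m * (fact i' * fact k * fact m) = fact (i' + k + m)" using less[of i' k m] Suc by simp
      then have "i * (?n i' k m * (fact i' * fact k * fact m)) = i * fact (i' + k + m)" by simp
      then show ?thesis using Suc by (simp add: algebra_simps)
    qed simp
    have b: "(if k > 0 then ?n i (k - 1) m else 0) * (fact i * fact k * fact m) = k * fact (i + k + m - 1)"
    proof (cases k)
      case (Suc k')
      have "?n i k' m * (fact i * fact k' * fact m) = fact (i + k' + m)" using less[of i k' m] Suc by simp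
      then have "k * (?n i k' m * (fact i * fact k' * fact m)) = k * fact (i + k' + m)" by simp
      then show ?thesis using Suc by (simp add: algebra_simps)
    qed simp
    have c: "(if m > 0 then ?n i k (m - 1) else 0) * (fact i * fact k * fact m) = m * fact (i + k + m - 1)"
    proof (cases m)
      case (Suc m')
      have "?n i k m' * (fact i * fact k * fact m') = fact (i + k + m')" using less[of i k m'] Suc by simp
      then have "m * (?n i k m' * (fact i * fact k * fact m')) = m * fact (i + k + m')" by simp
      then show ?thesis using Suc by (simp add: algebra_simps)
    qed simp
    have h: "?n i k m = (if i > 0 then ?n (i - 1) k m else 0) + (if k > 0 then ?n i (k - 1) m else 0)
        + (if m > 0 then ?n i k (m - 1) else 0)"
      using num_words_head[of i k m "\<lambda>_. True"] False by simp
    have "?n i k m * (fact i * fact k * fact m) = (i + k + m) * fact (i + k + m - 1)"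
      unfolding h add_mult_distrib a b c by simp
    also have "\<dots> = fact (i + k + m)" using False by (metis fact_reduce of_nat_id not_gr_zero)
    finally show ?thesis .
  qed
qed

section \<open>Joint states of the two queues\<close>

text \<open>The number y counts the waiting customers of Lc that are not hits; prescribing the total
  as x + y avoids a subtraction.\<close>

definition num_state :: "nat \<Rightarrow> nat \<Rightarrow> nat \<Rightarrow> nat \<Rightarrow> nat \<Rightarrow> nat \<Rightarrow> nat" where
  "num_state q x y i k m = num_words i k m (\<lambda>w. queueA w = q \<and> queueS w = x \<and> queueT w = x + y)"

lemma queue_bounds:
  "queueA w \<le> count_list w La" "queueS w \<le> count_list w La" "queueT w \<le> count_list w Lt"
  "queueA w + queueS w \<le> count_list w La"
proof -
  show s: "queueA w + queueS w \<le> count_list w La"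
  proof (induction w)
    case (Cons x w)
    then show ?case by (cases x) auto
  qed simp
  then show "queueA w \<le> count_list w La" "queueS w \<le> count_list w La" by auto
  show "queueT w \<le> count_list w Lt"
  proof (induction w)
    case (Cons x w)
    then show ?case by (cases x) auto
  qed simp
qed

lemma queue_no_Lc:
  "count_list w Lc = 0 \<Longrightarrow> queueT w = count_list w Lt \<and> queueA w + queueS w = count_list w La"
proof (induction w)
  case (Cons x w)
  then show ?case by (cases x) auto
qed simp

lemma num_state_eq_0:
  "i < q + x \<Longrightarrow> num_state q x y i k m = 0" "k < x + y \<Longrightarrow> num_state q x y i k m = 0"
  "k \<noteq> x + y \<or> i \<noteq> q + x \<Longrightarrow> num_state q x y i k 0 = 0"
  unfolding num_state_def
proof -
  show "num_words i k m (\<lambda>w. queueA w = q \<and> queueS w = x \<and> queueT w = x + y) = 0" if "i < q + x"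
  proof (rule num_words_eq_0)
    fix w assume "w \<in> words i k m"
    then show "\<not> (queueA w = q \<and> queueS w = x \<and> queueT w = x + y)"
      using queue_bounds(4)[of w] that by (auto simp: words_def)
  qed
  show "num_words i k m (\<lambda>w. queueA w = q \<and> queueS w = x \<and> queueT w = x + y) = 0" if "k < x + y"
  proof (rule num_words_eq_0)
    fix w assume "w \<in> words i k m"
    then show "\<not> (queueA w = q \<and> queueS w = x \<and> queueT w = x + y)"
      using queue_bounds(3)[of w] that by (auto simp: words_def)
  qed
  show "num_words i k 0 (\<lambda>w. queueA w = q \<and> queueS w = x \<and> queueT w = x + y) = 0" if "k \<noteq> x + y \<or> i \<noteq> q + x"
  proof (rule num_words_eq_0)
    fix w assume "w \<in> words i k 0"
    then show "\<not> (queueA w = q \<and> queueS w = x \<and> queueT w = x + y)"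
      using queue_no_Lc[of w] that by (auto simp: words_def)
  qed
qed

text \<open>The summands undo the last letter. An Lt adds a hit if some La was waiting, otherwise a
  customer of low priority. An Lc serves a hit, or for lack of hits a customer of low priority, or
  idles; these are the last three summands.\<close>

lemma num_state_head:
  assumes "i + k + m > 0"
  shows "num_state q x y i k m =
      (if i > 0 \<and> q > 0 then num_state (q - 1) x y (i - 1) k m else 0)
    + (if k > 0 \<and> x > 0 then num_state (Suc q) (x - 1) y i (k - 1) m else 0)
    + (if k > 0 \<and> q = 0 \<and> y > 0 then num_state 0 x (y - 1) i (k - 1) m else 0)
    + (if m > 0 then num_state q (Suc x) y i k (m - 1) else 0)
    + (if m > 0 \<and> x = 0 then num_state q 0 (Suc y) i k (m - 1) else 0)
    + (if m > 0 \<and> x = 0 \<and> y = 0 then num_state q 0 0 i k (m - 1) else 0)"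
proof -
  let ?P = "\<lambda>q x y w. queueA w = q \<and> queueS w = x \<and> queueT w = x + y"
  have a: "num_words i' k m (\<lambda>w. ?P q x y (La # w)) = (if q > 0 then num_state (q - 1) x y i' k m else 0)" for i'
    by (auto simp: num_state_def intro!: num_words_cong num_words_eq_0)
  have t: "num_words i k' m (\<lambda>w. ?P q x y (Lt # w)) = (if x > 0 then num_state (Suc q) (x - 1) y i k' m else 0)
      + (if q = 0 \<and> y > 0 then num_state 0 x (y - 1) i k' m else 0)" for k'
  proof -
    have "num_words i k' m (\<lambda>w. ?P q x y (Lt # w)) =
      num_words i k' m (\<lambda>w. (x > 0 \<and> ?P (Suc q) (x - 1) y w) \<or> (q = 0 \<and> y > 0 \<and> ?P 0 x (y - 1) w))"
    proof (rule num_words_cong)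
      fix w
      show "?P q x y (Lt # w) \<longleftrightarrow> (x > 0 \<and> ?P (Suc q) (x - 1) y w) \<or> (q = 0 \<and> y > 0 \<and> ?P 0 x (y - 1) w)"
        using queueS_le_queueT[of w] by (cases "queueA w") auto
    qed
    also have "\<dots> = num_words i k' m (\<lambda>w. x > 0 \<and> ?P (Suc q) (x - 1) y w) + num_words i k' m (\<lambda>w. q = 0 \<and> y > 0 \<and> ?P 0 x (y - 1) w)"
      by (rule num_words_disj) auto
    finally show ?thesis by (auto simp: num_state_def num_words_eq_0)
  qed
  have c: "num_words i k m' (\<lambda>w. ?P q x y (Lc # w)) = num_state q (Suc x) y i k m'
      + (if x = 0 then num_state q 0 (Suc y) i k m' else 0) + (if x = 0 \<and> y = 0 then num_state q 0 0 i k m' else 0)" for m'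
  proof -
    have "num_words i k m' (\<lambda>w. ?P q x y (Lc # w)) =
      num_words i k m' (\<lambda>w. (?P q (Suc x) y w \<or> (x = 0 \<and> ?P q 0 (Suc y) w)) \<or> (x = 0 \<and> y = 0 \<and> ?P q 0 0 w))"
    proof (rule num_words_cong)
      fix w
      show "?P q x y (Lc # w) \<longleftrightarrow> (?P q (Suc x) y w \<or> (x = 0 \<and> ?P q 0 (Suc y) w)) \<or> (x = 0 \<and> y = 0 \<and> ?P q 0 0 w)"
        using queueS_le_queueT[of w] by (cases "queueS w"; cases "queueT w") auto
    qed
    also have "\<dots> = num_words i k m' (?P q (Suc x) y) + num_words i k m' (\<lambda>w. x = 0 \<and> ?P q 0 (Suc y) w)
      + num_words i k m' (\<lambda>w. x = 0 \<and> y = 0 \<and> ?P q 0 0 w)"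
      by (subst num_words_disj, auto)+
    finally show ?thesis by (auto simp: num_state_def num_words_eq_0)
  qed
  show ?thesis
    unfolding num_state_def[of q x y i k m] num_words_head[of i k m] a t c using assms by auto
qed

text \<open>
  The number of words with a given final state is a sum of numbers of standard Young tableaux (the shape
  being that of the word under the Robinson--Schensted--Knuth correspondence). This is where the next two
  symmetries come from; removing the last letter of the words gives a direct proof.
\<close>

lemma num_state_exchange_AT:
  "y > 0 \<or> i < q + Suc k \<Longrightarrow> num_state (Suc q) x y (Suc i) k m =
    num_state q x (Suc y) i (Suc k) m + (if y = 0 then num_state q x 0 i (Suc k) m else 0)"
proof (induction "i + k + m" arbitrary: q x y i k m rule: less_induct)
  case less
  note IH = less.hyps and prem = less.prems
  define e where "e z = (if y = 0 then z else 0)" for z :: nat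
  have e_add: "e (z + z') = e z + e z'" for z z' by (simp add: e_def)
  have a: "num_state q x y i k m =
      (if i > 0 \<and> q > 0 then num_state (q - 1) x (Suc y) (i - 1) (Suc k) m else 0)
    + (if q = 0 then num_state 0 x y i k m else 0)
    + e (if i > 0 \<and> q > 0 then num_state (q - 1) x 0 (i - 1) (Suc k) m else 0)"
  proof (cases q)
    case (Suc q')
    show ?thesis
    proof (cases i)
      case 0
      then show ?thesis using Suc num_state_eq_0(1)[of 0 q x] by (simp add: e_def)
    next
      case (Suc i')
      then show ?thesis using IH[of i' k m y q' x] prem \<open>q = Suc q'\<close> by (auto simp: e_def)
    qed
  qed (simp add: e_def)
  have t: "(if k > 0 \<and> x > 0 then num_state (Suc (Suc q)) (x - 1) y (Suc i) (k - 1) m else 0) =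
      (if x > 0 then num_state (Suc q) (x - 1) (Suc y) i k m else 0)
    + e (if x > 0 then num_state (Suc q) (x - 1) 0 i k m else 0)"
  proof (cases k)
    case 0
    have "num_state (Suc q) (x - 1) (Suc y) i 0 m = 0" by (rule num_state_eq_0) simp
    moreover have "num_state (Suc q) (x - 1) 0 i 0 m = 0" if "y = 0"
      using prem that 0 by (intro num_state_eq_0(1)) simp
    ultimately show ?thesis using 0 by (auto simp: e_def)
  next
    case (Suc k')
    then show ?thesis using IH[of i k' m y "Suc q" "x - 1"] prem by (auto simp: e_def)
  qed
  have c: "(if m > 0 then num_state (Suc q) (Suc x) y (Suc i) k (m - 1) else 0) =
      (if m > 0 then num_state q (Suc x) (Suc y) i (Suc k) (m - 1) else 0)
    + e (if m > 0 then num_state q (Suc x) 0 i (Suc k) (m - 1) else 0)"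
    using IH[of i k "m - 1" y q "Suc x"] prem by (auto simp: e_def)
  have c': "(if m > 0 \<and> x = 0 then num_state (Suc q) 0 (Suc y) (Suc i) k (m - 1) else 0) =
      (if m > 0 \<and> x = 0 then num_state q 0 (Suc (Suc y)) i (Suc k) (m - 1) else 0)"
    using IH[of i k "m - 1" "Suc y" q 0] by auto
  have c'': "(if m > 0 \<and> x = 0 \<and> y = 0 then num_state (Suc q) 0 0 (Suc i) k (m - 1) else 0) =
      e (if m > 0 \<and> x = 0 then num_state q 0 (Suc 0) i (Suc k) (m - 1) else 0) +
      e (if m > 0 \<and> x = 0 then num_state q 0 0 i (Suc k) (m - 1) else 0)"
    using IH[of i k "m - 1" 0 q 0] prem by (auto simp: e_def)
  have H1: "num_state (Suc q) x y (Suc i) k m = num_state q x y i k m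
    + (if k > 0 \<and> x > 0 then num_state (Suc (Suc q)) (x - 1) y (Suc i) (k - 1) m else 0)
    + (if m > 0 then num_state (Suc q) (Suc x) y (Suc i) k (m - 1) else 0)
    + (if m > 0 \<and> x = 0 then num_state (Suc q) 0 (Suc y) (Suc i) k (m - 1) else 0)
    + (if m > 0 \<and> x = 0 \<and> y = 0 then num_state (Suc q) 0 0 (Suc i) k (m - 1) else 0)"
    by (subst num_state_head) simp_all
  have H2: "num_state q x (Suc y) i (Suc k) m =
      (if i > 0 \<and> q > 0 then num_state (q - 1) x (Suc y) (i - 1) (Suc k) m else 0)
    + (if x > 0 then num_state (Suc q) (x - 1) (Suc y) i k m else 0)
    + (if q = 0 then num_state 0 x y i k m else 0)
    + (if m > 0 then num_state q (Suc x) (Suc y) i (Suc k) (m - 1) else 0)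
    + (if m > 0 \<and> x = 0 then num_state q 0 (Suc (Suc y)) i (Suc k) (m - 1) else 0)"
    by (subst num_state_head) simp_all
  have H3: "num_state q x 0 i (Suc k) m =
      (if i > 0 \<and> q > 0 then num_state (q - 1) x 0 (i - 1) (Suc k) m else 0)
    + (if x > 0 then num_state (Suc q) (x - 1) 0 i k m else 0)
    + (if m > 0 then num_state q (Suc x) 0 i (Suc k) (m - 1) else 0)
    + (if m > 0 \<and> x = 0 then num_state q 0 (Suc 0) i (Suc k) (m - 1) else 0)
    + (if m > 0 \<and> x = 0 then num_state q 0 0 i (Suc k) (m - 1) else 0)"
    by (subst num_state_head) simp_all
  have "num_state (Suc q) x y (Suc i) k m = num_state q x (Suc y) i (Suc k) m + e (num_state q x 0 i (Suc k) m)"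
    unfolding H1 H2 H3 e_add t c c' c'' using a by linarith
  then show ?case by (simp add: e_def)
qed

text \<open>Each La is still waiting or was served by a hit, so a word counted on the right has q +
  k - i missed letters Lt. The hypothesis says that more are missed than still wait for Lc, so one
  of them has been served. In the induction with x = 0, a last letter Lt on the left matches, by
  \<open>num_state_exchange_AT\<close>, the last letters Lc on the right that serve no hit.\<close>

lemma num_state_exchange_AC:
  "i + y < q + k \<Longrightarrow> num_state q (Suc x) y (Suc i) k m = num_state q x y i k (Suc m)"
proof (induction "i + k + m" arbitrary: q x y i k m rule: less_induct)
  case less
  note IH = less.hyps and prem = less.prems
  show ?case
  proof (cases k)
    case 0
    then have "num_state q (Suc x) y (Suc i) k m = 0" "num_state q x y i k (Suc m) = 0"
      using prem num_state_eq_0(2)[of k "Suc x" y] num_state_eq_0(1)[of i q x] by auto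
    then show ?thesis by simp
  next
    case (Suc k')
    have a: "(if q > 0 then num_state (q - 1) (Suc x) y i k m else 0) =
        (if i > 0 \<and> q > 0 then num_state (q - 1) x y (i - 1) k (Suc m) else 0)"
    proof (cases i)
      case 0
      then show ?thesis using num_state_eq_0(1)[of 0 "q - 1" "Suc x"] by simp
    next
      case (Suc i')
      then show ?thesis using IH[of i' k m y "q - 1" x] prem by auto
    qed
    have t: "num_state (Suc q) x y (Suc i) k' m =
        (if x > 0 then num_state (Suc q) (x - 1) y i k' (Suc m) else 0)
      + (if x = 0 then num_state q 0 (Suc y) i k m else 0)
      + (if x = 0 \<and> y = 0 then num_state q 0 0 i k m else 0)"
    proof (cases x)
      case 0
      then show ?thesis using num_state_exchange_AT[of y i q k' 0 m] prem Suc by auto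
    next
      case (Suc x')
      then show ?thesis using IH[of i k' m y "Suc q" x'] prem \<open>k = Suc k'\<close> by auto
    qed
    have t': "(if q = 0 \<and> y > 0 then num_state 0 (Suc x) (y - 1) (Suc i) k' m else 0) =
        (if q = 0 \<and> y > 0 then num_state 0 x (y - 1) i k' (Suc m) else 0)"
      using IH[of i k' m "y - 1" 0 x] prem Suc by auto
    have c: "(if m > 0 then num_state q (Suc (Suc x)) y (Suc i) k (m - 1) else 0) = num_state q (Suc x) y i k m"
    proof (cases m)
      case 0
      have "num_state q (Suc x) y i k 0 = 0" using prem by (intro num_state_eq_0(3)) auto
      then show ?thesis using 0 by simp
    next
      case (Suc m')
      then show ?thesis using IH[of i k m' y q "Suc x"] prem by auto
    qed
    have H1: "num_state q (Suc x) y (Suc i) k m = (if q > 0 then num_state (q - 1) (Suc x) y i k m else 0)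
      + num_state (Suc q) x y (Suc i) k' m
      + (if q = 0 \<and> y > 0 then num_state 0 (Suc x) (y - 1) (Suc i) k' m else 0)
      + (if m > 0 then num_state q (Suc (Suc x)) y (Suc i) k (m - 1) else 0)"
      by (subst num_state_head) (simp_all add: Suc)
    have H2: "num_state q x y i k (Suc m) =
        (if i > 0 \<and> q > 0 then num_state (q - 1) x y (i - 1) k (Suc m) else 0)
      + (if x > 0 then num_state (Suc q) (x - 1) y i k' (Suc m) else 0)
      + (if q = 0 \<and> y > 0 then num_state 0 x (y - 1) i k' (Suc m) else 0)
      + num_state q (Suc x) y i k m
      + (if x = 0 then num_state q 0 (Suc y) i k m else 0)
      + (if x = 0 \<and> y = 0 then num_state q 0 0 i k m else 0)"
      by (subst num_state_head) (simp_all add: Suc)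
    show ?thesis unfolding H1 H2 a t t' c by linarith
  qed
qed

lemma num_words_sum_queueA:
  "num_words i k m P = (\<Sum>q\<le>i. num_words i k m (\<lambda>w. queueA w = q \<and> P w))"
proof -
  have "{w \<in> words i k m. P w} = (\<Union>q\<le>i. {w \<in> words i k m. queueA w = q \<and> P w})"
    using queue_bounds(1) by (fastforce simp: words_def)
  then show ?thesis
    unfolding num_words_def using finite_words[of i k m] by (auto intro!: card_UN_disjoint)
qed

text \<open>Summation of \<open>num_state_exchange_AC\<close> with x = y = 0 over q, applicable to
  every q because i < k. It replaces a condition on hits by one that does not see the letters La at
  all.\<close>

lemma num_words_single:
  assumes "i < k"
  shows "num_words (Suc i) k m (\<lambda>w. queueS w = 1 \<and> queueT w = 1) = num_words i k (Suc m) (\<lambda>w. queueT w = 0)"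
proof -
  have "num_words (Suc i) k m (\<lambda>w. queueS w = 1 \<and> queueT w = 1) = (\<Sum>q\<le>Suc i. num_state q 1 0 (Suc i) k m)"
    by (subst num_words_sum_queueA) (simp add: num_state_def)
  also have "\<dots> = (\<Sum>q\<le>Suc i. num_state q 0 0 i k (Suc m))"
    using assms num_state_exchange_AC[of i 0 _ k 0 m] by (intro sum.cong) auto
  also have "\<dots> = (\<Sum>q\<le>i. num_state q 0 0 i k (Suc m))"
    using num_state_eq_0(1)[of i "Suc i" 0] by simp
  also have "\<dots> = num_words i k (Suc m) (\<lambda>w. queueT w = 0)"
  proof -
    have "num_words i k (Suc m) (\<lambda>w. queueT w = 0) = num_words i k (Suc m) (\<lambda>w. queueS w = 0 \<and> queueT w = 0)"
      by (rule num_words_cong) (metis queueS_le_queueT le_zero_eq)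
    then show ?thesis by (subst (asm) (2) num_words_sum_queueA) (simp add: num_state_def)
  qed
  finally show ?thesis .
qed

text \<open>A good word ends with La, leaving a good word with one La fewer, or with Lc, leaving a
  word counted by \<open>num_words_single\<close>.\<close>

lemma num_words_good:
  "i \<le> k \<Longrightarrow> num_words i k (Suc m) good = (\<Sum>i'<i. num_words i' k (Suc m) (\<lambda>w. queueT w = 0))"
proof (induction i)
  case 0
  have "num_words 0 k m (\<lambda>w. queueS w = 1 \<and> queueT w = 1) = 0"
  proof (rule num_words_eq_0)
    fix w assume "w \<in> words 0 k m"
    then show "\<not> (queueS w = 1 \<and> queueT w = 1)" using queue_bounds(2)[of w] by (auto simp: words_def)
  qed
  then show ?case using num_words_head[of 0 k "Suc m" good] num_words_eq_0[of 0 "k - 1" "Suc m" "\<lambda>_. False"] by simp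
next
  case (Suc i)
  then have "num_words (Suc i) k (Suc m) good = num_words i k (Suc m) good + num_words i k (Suc m) (\<lambda>w. queueT w = 0)"
    using num_words_head[of "Suc i" k "Suc m" good] num_words_single[of i k m]
      num_words_eq_0[of "Suc i" "k - 1" "Suc m" "\<lambda>_. False"] by simp
  then show ?case using Suc by simp
qed

section \<open>Averages for three rows\<close>

abbreviation marked :: "(nat \<Rightarrow> nat set \<Rightarrow> nat set \<Rightarrow> nat set \<Rightarrow> bool) \<Rightarrow> letter list \<Rightarrow> bool" where
  "marked e v \<equiv> e (length v) (pos La v) (pos Lt v) (insert (length v) (pos Lc v))"

text \<open>Rotation puts the mark u on the last place. The event forces u into C, so the letter
  there is Lc; it is split off, and its place returns as the inserted \<open>length v\<close> in
  \<open>marked\<close>.\<close>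

lemma sum_rows_marked:
  fixes ev :: "nat \<Rightarrow> nat set \<Rightarrow> nat set \<Rightarrow> nat set \<Rightarrow> bool" and i k m :: nat
  defines "N \<equiv> i + k + Suc m"
  assumes ev_C: "\<And>u A T C. ev u A T C \<Longrightarrow> u \<in> C"
    and inv: "\<And>f u A T C. A \<subseteq> {..<N} \<Longrightarrow> T \<subseteq> {..<N} \<Longrightarrow> C \<subseteq> {..<N} \<Longrightarrow> u < N \<Longrightarrow> cyc_mono f {..<N} \<Longrightarrow>
      ev (f u) (f ` A) (f ` T) (f ` C) \<longleftrightarrow> ev u A T C"
  shows "(\<Sum>Rs\<in>disjoint_rows {..<N} [i, k, Suc m]. real (card {u. ev u (Rs ! 0) (Rs ! 1) (Rs ! 2)})) =
    real N * real (num_words i k m (marked ev))"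
proof -
  let ?W = "disjoint_rows {..<N} [i, k, Suc m]"
  let ?e = "\<lambda>u Rs. of_bool (ev u (Rs ! 0) (Rs ! 1) (Rs ! 2)) :: real"
  have len: "\<exists>A T C. Rs = [A, T, C]" if "length Rs = length [i, k, Suc m]" for Rs :: "nat set list"
    using that by (auto simp: length_Suc_conv)
  have "(\<Sum>Rs\<in>?W. real (card {u. ev u (Rs ! 0) (Rs ! 1) (Rs ! 2)})) = (\<Sum>Rs\<in>?W. \<Sum>u<N. ?e u Rs)"
  proof (rule sum.cong[OF refl])
    fix Rs assume Rs: "Rs \<in> ?W"
    then obtain A T C where "Rs = [A, T, C]" using len disjoint_rowsD by blast
    moreover from this have "C \<subseteq> {..<N}" using Rs disjoint_rowsD[OF Rs] by auto
    ultimately have "{u. ev u (Rs ! 0) (Rs ! 1) (Rs ! 2)} = {u \<in> {..<N}. ev u (Rs ! 0) (Rs ! 1) (Rs ! 2)}"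
      by (auto simp: numeral_2_eq_2 dest: ev_C)
    then show "real (card {u. ev u (Rs ! 0) (Rs ! 1) (Rs ! 2)}) = (\<Sum>u<N. ?e u Rs)"
      by (simp add: sum.If_cases of_bool_def Int_def)
  qed
  also have "\<dots> = (\<Sum>u<N. \<Sum>Rs\<in>?W. ?e u Rs)" by (rule sum.swap)
  also have "\<dots> = (\<Sum>u<N. \<Sum>Rs\<in>?W. ?e (N - 1) Rs)"
  proof (rule sum.cong[OF refl])
    fix u assume "u \<in> {..<N}"
    then have "u < N" by simp
    then show "sum (?e u) ?W = sum (?e (N - 1)) ?W"
    proof (rule sum_rows_rotate[rotated])
      fix f u and Rs :: "nat set list"
      assume *: "length Rs = length [i, k, Suc m]" "\<Union>(set Rs) \<subseteq> {..<N}" "u < N" "cyc_mono f {..<N}"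
      then obtain A T C where "Rs = [A, T, C]" using len by blast
      then show "?e (f u) (map ((`) f) Rs) = ?e u Rs"
        using * inv[of A T C u f] by (auto simp: numeral_2_eq_2)
    qed
  qed
  also have "\<dots> = real N * (\<Sum>Rs\<in>?W. ?e (N - 1) Rs)" by simp
  also have "(\<Sum>Rs\<in>?W. ?e (N - 1) Rs) =
      (\<Sum>w\<in>words i k (Suc m). of_bool (ev (N - 1) (pos La w) (pos Lt w) (pos Lc w)))"
    unfolding N_def by (subst sum_rows_words) (simp add: numeral_2_eq_2)
  also have "\<dots> = real (num_words i k (Suc m) (\<lambda>w. ev (N - 1) (pos La w) (pos Lt w) (pos Lc w)))"
    using finite_words[of i k "Suc m"] by (simp add: num_words_def of_bool_def sum.If_cases Int_def conj_commute)
  also have "num_words i k (Suc m) (\<lambda>w. ev (N - 1) (pos La w) (pos Lt w) (pos Lc w)) =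
      num_words i k m (marked ev)"
  proof -
    have "num_words i k (Suc m) (\<lambda>w. ev (N - 1) (pos La w) (pos Lt w) (pos Lc w)) =
        num_words i k (Suc m) (\<lambda>w. \<exists>v. w = Lc # v \<and> marked ev v)"
    proof (rule num_words_cong)
      fix w assume w: "w \<in> words i k (Suc m)"
      then have "length w = N" using length_words N_def by auto
      then obtain x v where v: "w = x # v" "length v = N - 1" by (cases w) (auto simp: N_def)
      show "ev (N - 1) (pos La w) (pos Lt w) (pos Lc w) \<longleftrightarrow>
        (\<exists>v. w = Lc # v \<and> marked ev v)"
      proof (cases "x = Lc")
        case True
        then show ?thesis using v by auto
      next
        case False
        then have "N - 1 \<notin> pos Lc w" using v length_notin_pos[of v Lc] by auto
        then show ?thesis using ev_C False v by blast
      qed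
    qed
    also have "\<dots> = num_words i k m (marked ev)"
      using num_words_head[of i k "Suc m" "\<lambda>w. \<exists>v. w = Lc # v \<and> marked ev v"]
        num_words_eq_0[of _ _ _ "\<lambda>_. False"] by simp
    finally show ?thesis .
  qed
  finally show ?thesis .
qed

text \<open>The count is by the follower u, because u becomes the mark in the rotation argument;
  \<open>follow_count_eq\<close> counts by the predecessor instead.\<close>

definition follow_count :: "nat set \<Rightarrow> nat set \<Rightarrow> nat set \<Rightarrow> real" where
  "follow_count B D C = real (card {u. u \<in> C - D \<and> (\<exists>c\<in>B. cnext C c = u)})"

lemma cyc_mono_follow:
  assumes "cyc_mono f W" "finite C" "C \<subseteq> W" "B \<subseteq> C" "D \<subseteq> C" "u \<in> W"
  shows "f u \<in> f ` C - f ` D \<and> (\<exists>c\<in>f ` B. cnext (f ` C) c = f u) \<longleftrightarrow>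
    u \<in> C - D \<and> (\<exists>c\<in>B. cnext C c = u)"
proof -
  have inj: "inj_on f W" using assms by (simp add: cyc_mono_def)
  have mem: "f u \<in> f ` X \<longleftrightarrow> u \<in> X" if "X \<subseteq> W" for X
    using inj_on_image_mem_iff[OF inj assms(6) that] .
  have "cnext (f ` C) (f c) = f u \<longleftrightarrow> cnext C c = u" if "c \<in> B" for c
  proof -
    have "cnext C c \<in> C" using cnext_in[OF assms(2)] that assms by blast
    moreover have "cnext (f ` C) (f c) = f (cnext C c)"
      using cnext_image[OF assms(1,2) _ assms(3)] that assms by blast
    ultimately show ?thesis using inj_on_eq_iff[OF inj, of "cnext C c" u] assms by auto
  qed
  moreover have "D \<subseteq> W" using assms by auto
  ultimately show ?thesis using mem[of C] mem[of D] assms(3) by auto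
qed

lemma cyc_inv3_follow_count: "cyc_inv3 follow_count"
  unfolding cyc_inv3_def
proof (intro allI impI)
  fix f B D C assume *: "finite C" "B \<subseteq> C" "D \<subseteq> C" "cyc_mono f C"
  have inj: "inj_on f C" using * by (simp add: cyc_mono_def)
  let ?X = "{u. u \<in> C - D \<and> (\<exists>c\<in>B. cnext C c = u)}"
  have "{u. u \<in> f ` C - f ` D \<and> (\<exists>c\<in>f ` B. cnext (f ` C) c = u)} = f ` ?X"
  proof (intro equalityI subsetI)
    fix u assume u: "u \<in> {u. u \<in> f ` C - f ` D \<and> (\<exists>c\<in>f ` B. cnext (f ` C) c = u)}"
    then obtain u' where "u' \<in> C" "u = f u'" by auto
    moreover from this have "u' \<in> ?X"
      using u cyc_mono_follow[OF *(4,1) subset_refl *(2,3), of u'] by simp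
    ultimately show "u \<in> f ` ?X" by blast
  next
    fix u assume "u \<in> f ` ?X"
    then obtain u' where u': "u' \<in> ?X" "u = f u'" by (rule imageE)
    then have "u' \<in> C" by simp
    then show "u \<in> {u. u \<in> f ` C - f ` D \<and> (\<exists>c\<in>f ` B. cnext (f ` C) c = u)}"
      using cyc_mono_follow[OF *(4,1) subset_refl *(2,3), of u'] u' by simp
  qed
  moreover have "inj_on f ?X" using inj by (rule inj_on_subset) auto
  ultimately show "follow_count (f ` B) (f ` D) (f ` C) = follow_count B D C"
    by (simp add: follow_count_def card_image)
qed

lemma card_rows3: "card (disjoint_rows {..<i + k + n} [i, k, n]) = num_words i k n (\<lambda>_. True)"
proof -
  have "card (disjoint_rows {..<i + k + n} [i, k, n]) = card (words i k n)"
    using sum_rows_words[of "\<lambda>_. 1 :: nat" i k n] by simp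
  then show ?thesis by (simp add: num_words_def)
qed

text \<open>The number of unused services is always \<open>Suc m - k\<close>, and by rotation each position is equally likely
  to be one of them.\<close>

lemma cycle_lemma:
  assumes "k \<le> m"
  shows "real (i + k + Suc m) * real (num_words i k m (\<lambda>w. queueT w = 0)) =
    real (Suc m - k) * real (num_words i k (Suc m) (\<lambda>_. True))"
proof -
  let ?N = "i + k + Suc m"
  let ?ev = "\<lambda>u (A::nat set) T C. u \<in> C - served T C"
  have "real ?N * real (num_words i k m (marked ?ev)) =
    (\<Sum>Rs\<in>disjoint_rows {..<?N} [i, k, Suc m]. real (card {u. ?ev u (Rs ! 0) (Rs ! 1) (Rs ! 2)}))"
  proof (rule sum_rows_marked[symmetric])
    fix f u and A T C :: "nat set"
    assume *: "A \<subseteq> {..<?N}" "T \<subseteq> {..<?N}" "C \<subseteq> {..<?N}" "u < ?N" "cyc_mono f {..<?N}"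
    have fin: "finite T" "finite C" using * finite_subset by blast+
    have inj: "inj_on f {..<?N}" using * by (simp add: cyc_mono_def)
    have "served (f ` T) (f ` C) = f ` served T C" using * fin by (intro served_image) auto
    moreover have "served T C \<subseteq> {..<?N}" using served_subset[of T C] * by blast
    ultimately show "f u \<in> f ` C - served (f ` T) (f ` C) \<longleftrightarrow> u \<in> C - served T C"
      using inj_on_image_mem_iff[OF inj, of u] * by auto
  qed auto
  also have "\<dots> = (\<Sum>Rs\<in>disjoint_rows {..<?N} [i, k, Suc m]. real (Suc m - k))"
  proof (rule sum.cong[OF refl])
    fix Rs assume Rs: "Rs \<in> disjoint_rows {..<?N} [i, k, Suc m]"
    note D = disjoint_rowsD[OF Rs]
    then obtain A T C where [simp]: "Rs = [A, T, C]" by (auto simp: length_Suc_conv)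
    have fin: "finite T" "finite C" using D finite_subset[OF _ finite_lessThan] by auto
    have "card (C - served T C) = card C - card (served T C)"
      using fin served_subset by (intro card_Diff_subset) auto
    then show "real (card {u. ?ev u (Rs ! 0) (Rs ! 1) (Rs ! 2)}) = real (Suc m - k)"
      using D card_served[OF fin] assms by (simp add: set_diff_eq[symmetric] numeral_2_eq_2)
  qed
  also have "\<dots> = real (Suc m - k) * real (num_words i k (Suc m) (\<lambda>_. True))"
    using card_rows3[of i k "Suc m"] by simp
  also have "num_words i k m (marked ?ev) =
      num_words i k m (\<lambda>w. queueT w = 0)"
    using assms by (intro num_words_cong last_service(1)[OF subset_refl]) (auto simp: words_def)
  finally show ?thesis .
qed

lemma sum_follow_count:
  assumes "i < k" "k \<le> m"
  shows "(\<Sum>Rs\<in>disjoint_rows {..<i + k + Suc m} [i, k, Suc m].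
      three_rows follow_count Rs) =
    real (i + k + Suc m) * real (num_words i k m good)"
proof -
  let ?N = "i + k + Suc m"
  let ?ev = "\<lambda>u A T C. u \<in> C - served T C \<and> (\<exists>c\<in>served (served A T) C. cnext C c = u)"
  have "(\<Sum>Rs\<in>disjoint_rows {..<?N} [i, k, Suc m]. real (card {u. ?ev u (Rs ! 0) (Rs ! 1) (Rs ! 2)})) =
    real ?N * real (num_words i k m (marked ?ev))"
  proof (rule sum_rows_marked)
    fix f u and A T C :: "nat set"
    assume *: "A \<subseteq> {..<?N}" "T \<subseteq> {..<?N}" "C \<subseteq> {..<?N}" "u < ?N" "cyc_mono f {..<?N}"
    have fin: "finite A" "finite T" "finite C" using * finite_subset by blast+
    have 1: "served (f ` T) (f ` C) = f ` served T C" "served (f ` A) (f ` T) = f ` served A T"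
      using served_image[OF *(5) fin(2,3) *(2,3)] served_image[OF *(5) fin(1,2) *(1,2)] by simp_all
    have "served A T \<subseteq> {..<?N}" using served_subset[of A T] * by blast
    then have 2: "served (f ` served A T) (f ` C) = f ` served (served A T) C"
      using * fin by (intro served_image) auto
    show "?ev (f u) (f ` A) (f ` T) (f ` C) \<longleftrightarrow> ?ev u A T C"
      unfolding 1 2 using * fin by (intro cyc_mono_follow served_subset) auto
  qed auto
  also have "num_words i k m (marked ?ev) =
      num_words i k m good"
    using assms by (intro num_words_cong good_event) (auto simp: words_def)
  finally show ?thesis by (simp add: follow_count_def)
qed

lemma sum_follow_count_two_rows:
  assumes "k \<le> m"
  shows "(\<Sum>Rs\<in>disjoint_rows {..<0 + k + Suc m} [0, k, Suc m].
      follow_count (served (Rs ! 1) (Rs ! 2)) (served (Rs ! 1) (Rs ! 2)) (Rs ! 2)) =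
    real (0 + k + Suc m) * real (num_words 0 k m (\<lambda>w. \<exists>v. w = Lc # v \<and> queueT v = 1))"
proof -
  let ?N = "0 + k + Suc m"
  let ?ev = "\<lambda>u (A :: nat set) T C. u \<in> C - served T C \<and> (\<exists>c\<in>served T C. cnext C c = u)"
  have "(\<Sum>Rs\<in>disjoint_rows {..<?N} [0, k, Suc m]. real (card {u. ?ev u (Rs ! 0) (Rs ! 1) (Rs ! 2)})) =
    real ?N * real (num_words 0 k m (marked ?ev))"
  proof (rule sum_rows_marked)
    fix f u and A T C :: "nat set"
    assume *: "A \<subseteq> {..<?N}" "T \<subseteq> {..<?N}" "C \<subseteq> {..<?N}" "u < ?N" "cyc_mono f {..<?N}"
    have fin: "finite T" "finite C" using * finite_subset by blast+
    have 1: "served (f ` T) (f ` C) = f ` served T C"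
      using served_image[OF *(5) fin *(2,3)] .
    show "?ev (f u) (f ` A) (f ` T) (f ` C) \<longleftrightarrow> ?ev u A T C"
      unfolding 1 using * fin by (intro cyc_mono_follow served_subset) auto
  qed auto
  also have "num_words 0 k m (marked ?ev) =
      num_words 0 k m (\<lambda>w. \<exists>v. w = Lc # v \<and> queueT v = 1)"
    using assms by (intro num_words_cong event_two_rows) (auto simp: words_def)
  finally show ?thesis by (simp add: follow_count_def)
qed

section \<open>Closed forms of the averages\<close>

text \<open>The hockey-stick identity for the binomial coefficients (j + L choose L), multiplied by
  L!.\<close>

lemma sum_fact_ratio:
  "(\<Sum>j<i. fact (j + L) / fact j :: real) = real i * fact (i + L) / (fact i * real (Suc L))"
proof (induction i)
  case (Suc i)
  let ?F = "fact (i + L) :: real" and ?f = "fact i :: real" and ?D = "real (Suc L)"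
  have "(\<Sum>j<Suc i. fact (j + L) / fact j :: real) = real i * ?F / (?f * ?D) + ?F / ?f"
    using Suc by simp
  also have "?F / ?f = ?D * ?F / (?f * ?D)" by simp
  also have "real i * ?F / (?f * ?D) + ?D * ?F / (?f * ?D) = (real i + ?D) * ?F / (?f * ?D)"
    by (simp only: add_divide_distrib distrib_right)
  also have "\<dots> = (real (Suc i) * ((real i + ?D) * ?F)) / (real (Suc i) * (?f * ?D))" by simp
  also have "(real i + ?D) * ?F = fact (Suc i + L)" by (simp add: algebra_simps)
  also have "real (Suc i) * (?f * ?D) = fact (Suc i) * ?D" by (simp add: algebra_simps)
  finally show ?case .
qed simp

lemma num_words_total_real:
  "real (num_words i k m (\<lambda>_. True)) = fact (i + k + m) / (fact i * fact k * fact m)"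
proof -
  have "real (num_words i k m (\<lambda>_. True) * (fact i * fact k * fact m)) = real (fact (i + k + m))"
    by (simp only: num_words_total)
  then show ?thesis by (simp add: field_simps)
qed

lemma queue_zero_real:
  assumes "k \<le> m"
  shows "real (num_words i k m (\<lambda>w. queueT w = 0)) =
    real (Suc m - k) * (fact (i + (k + m)) / fact i) / (fact k * fact (Suc m))"
proof -
  have "fact (i + k + Suc m) = real (i + k + Suc m) * fact (i + (k + m))"
    by (simp add: add.assoc)
  then have "real (i + k + Suc m) * real (num_words i k m (\<lambda>w. queueT w = 0)) =
      real (i + k + Suc m) * (real (Suc m - k) * (fact (i + (k + m)) / fact i) / (fact k * fact (Suc m)))"
    unfolding cycle_lemma[OF assms] num_words_total_real by (simp add: mult_ac)
  then show ?thesis by (subst (asm) mult_cancel_left) auto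
qed

theorem follow_count_average:
  assumes "i < k" "k < n"
  shows "(\<Sum>Rs\<in>disjoint_rows {..<i + k + n} [i, k, n].
      three_rows follow_count Rs) =
    real i * real (n - k) / real (n + k) * real (card (disjoint_rows {..<i + k + n} [i, k, n]))"
proof -
  obtain m where n: "n = Suc m" using assms by (cases n) auto
  obtain m' where m: "m = Suc m'" using assms n by (cases m) auto
  have km: "k \<le> m" using assms n by simp
  have "real (num_words i k m good) = (\<Sum>j<i. real (num_words j k m (\<lambda>w. queueT w = 0)))"
    using num_words_good[of i k m'] assms m by simp
  also have "\<dots> = real (Suc m - k) / (fact k * fact (Suc m)) * (\<Sum>j<i. fact (j + (k + m)) / fact j)"
    unfolding queue_zero_real[OF km] sum_distrib_left by (intro sum.cong) auto
  \<comment> \<open>The identity is used with L = k + m; its \<open>Suc L\<close> is the denominator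
    n + k of the average.\<close>
  also have "\<dots> = real (n - k) / (fact k * fact n) * (real i * fact (i + (k + m)) / (fact i * real (n + k)))"
    unfolding sum_fact_ratio n by (simp add: add.commute)
  finally have g: "real (num_words i k m good) =
    real (n - k) / (fact k * fact n) * (real i * fact (i + (k + m)) / (fact i * real (n + k)))" .
  have f: "fact (i + k + n) = real (i + k + n) * fact (i + (k + m))"
    by (simp add: n add.assoc)
  show ?thesis
    using sum_follow_count[OF assms(1) km] unfolding card_rows3 num_words_total_real n[symmetric] g f
    by (simp add: field_simps)
qed

text \<open>In the application \<open>fk\<close> and \<open>fm\<close> are k! and m!, and F is (k +
  m - 1)!. The difference on the left is that of two counts of words with empty queue.\<close>

lemma two_rows_identity:
  fixes k m fk fm F :: real
  assumes "k + m > 0" "m + 1 > 0" "fk > 0" "fm > 0"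
  shows "(k + (m + 1)) * ((m + 1 - k) * ((k + m) * F) / (fk * ((m + 1) * fm)) - (m - k) * F / (fk * fm)) =
    k * (m + 1 - k + 1) / (k + m) * ((k + (m + 1)) * ((k + m) * F) / (fk * ((m + 1) * fm)))"
proof -
  define d where "d = fk * ((m + 1) * fm)"
  have d: "d \<noteq> 0" using assms by (simp add: d_def)
  have "(m - k) * F / (fk * fm) = (m - k) * (m + 1) * F / d"
    using assms by (simp add: d_def)
  then have "(m + 1 - k) * ((k + m) * F) / d - (m - k) * F / (fk * fm) =
      ((m + 1 - k) * ((k + m) * F) - (m - k) * (m + 1) * F) / d"
    by (simp add: diff_divide_distrib)
  also have "(m + 1 - k) * ((k + m) * F) - (m - k) * (m + 1) * F = k * (m + 1 - k + 1) * F"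
    by (simp add: algebra_simps)
  finally have "(m + 1 - k) * ((k + m) * F) / d - (m - k) * F / (fk * fm) = k * (m + 1 - k + 1) * F / d" .
  then show ?thesis unfolding d_def[symmetric] using assms(1) by simp
qed

text \<open>The queue is empty after a further Lc exactly if it held 0 or 1 customers before. Words
  with one waiting customer are thus counted by a difference of two numbers from the cycle
  lemma.\<close>

theorem follow_count_average_two_rows:
  assumes "0 < k" "k < n"
  shows "(\<Sum>Rs\<in>disjoint_rows {..<0 + k + n} [0, k, n].
      follow_count (served (Rs ! 1) (Rs ! 2)) (served (Rs ! 1) (Rs ! 2)) (Rs ! 2)) =
    real k * real (n - k + 1) / real (n + k - 1) * real (card (disjoint_rows {..<0 + k + n} [0, k, n]))"
proof -
  obtain m where n: "n = Suc m" using assms by (cases n) auto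
  obtain m' where m: "m = Suc m'" using assms n by (cases m) auto
  obtain k' where k: "k = Suc k'" using assms by (cases k) auto
  have km: "k \<le> m" using assms n by simp
  let ?b = "\<lambda>m. num_words 0 k m (\<lambda>w. queueT w = 0)"
  have h1: "num_words 0 k m (\<lambda>w. \<exists>v. w = Lc # v \<and> queueT v = 1) = num_words 0 k m' (\<lambda>v. queueT v = 1)"
    using num_words_head[of 0 k m "\<lambda>w. \<exists>v. w = Lc # v \<and> queueT v = 1"]
      num_words_eq_0[of _ _ _ "\<lambda>_. False"] m k by simp
  have "?b m = num_words 0 k m' (\<lambda>v. queueT v = 0 \<or> queueT v = 1)"
  proof -
    have "num_words 0 k m' (\<lambda>w. queueT (Lc # w) = 0) = num_words 0 k m' (\<lambda>v. queueT v = 0 \<or> queueT v = 1)"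
      by (rule num_words_cong) auto
    then show ?thesis
      using num_words_head[of 0 k m "\<lambda>w. queueT w = 0"] num_words_eq_0[of _ _ _ "\<lambda>_. False"] m k by simp
  qed
  also have "\<dots> = ?b m' + num_words 0 k m' (\<lambda>v. queueT v = 1)"
    by (rule num_words_disj) auto
  finally have h2: "real (num_words 0 k m' (\<lambda>v. queueT v = 1)) = real (?b m) - real (?b m')" by simp
  have b': "real (?b m') = (real m - real k) * (fact (k + m')) / (fact k * fact m)"
  proof (cases "k \<le> m'")
    case True
    then show ?thesis using queue_zero_real[OF True, of 0] m by (simp add: of_nat_diff)
  next
    case False
    \<comment> \<open>The cycle lemma does not cover this boundary case. There are too few services
      to empty the queue, and the formula vanishes as well.\<close>
    then have "k = m" using km m by simp
    have bound: "count_list w Lt \<le> count_list w Lc + queueT w" for w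
    proof (induction w)
      case (Cons x w)
      then show ?case by (cases x) auto
    qed simp
    have "\<not> queueT w = 0" if "w \<in> words 0 k m'" for w
      using False that bound[of w] by (auto simp: words_def)
    then have "?b m' = 0" by (intro num_words_eq_0) simp
    then show ?thesis using \<open>k = m\<close> by simp
  qed
  have b: "real (?b m) = (real n - real k) * (fact (k + m)) / (fact k * fact n)"
    using queue_zero_real[OF km, of 0] n km by (simp add: of_nat_diff)
  have f: "fact (0 + k + n) = (real k + (real m + 1)) * ((real k + real m) * fact (k + m'))"
    "fact (k + m) = (real k + real m) * fact (k + m')" "fact n = (real m + 1) * fact m"
    by (simp_all add: n m algebra_simps)
  have r: "real (n - k + 1) = real m + 1 - real k + 1" "real (n + k - 1) = real k + real m" "real n = real m + 1"
    "real (k + Suc m) = real k + (real m + 1)"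
    using assms n by (simp_all add: of_nat_diff)
  have "real (k + Suc m) * real (num_words 0 k m (\<lambda>w. \<exists>v. w = Lc # v \<and> queueT v = 1)) =
      real k * real (n - k + 1) / real (n + k - 1) * (fact (0 + k + n) / (fact 0 * fact k * fact n))"
    unfolding h1 h2 b b' f r fact_0 mult_1_left using k by (intro two_rows_identity) auto
  then show ?thesis
    using sum_follow_count_two_rows[OF km] unfolding card_rows3 num_words_total_real n[symmetric] by simp
qed

section \<open>Multiline queues\<close>

lemma map_set_disjoint_rows:
  assumes "\<And>R. R \<in> set M \<Longrightarrow> sorted_wrt (<) R"
  shows "map set M \<in> disjoint_rows W ss \<longleftrightarrow> map length M = ss \<and> distinct (concat M) \<and> set (concat M) \<subseteq> W"
  using assms
proof (induction M arbitrary: W ss)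
  case Nil
  then show ?case by (cases ss) (auto simp: disjoint_rows.simps)
next
  case (Cons R M)
  show ?case
  proof (cases ss)
    case Nil
    then show ?thesis by simp
  next
    case ss: (Cons s ss')
    have "distinct R" using Cons.prems by (simp add: strict_sorted_iff)
    then have "card (set R) = length R" by (rule distinct_card)
    then show ?thesis
      using Cons \<open>distinct R\<close> by (auto simp: ss Cons_in_disjoint_rows)
  qed
qed

text \<open>A strictly increasing row is determined by its set. Since the sizes add up to
  \<open>card W\<close>, disjoint rows inside W cover it.\<close>

lemma disjoint_rows_image:
  assumes "finite W" "card W = sum_list ss"
  shows "bij_betw (map set) {M. (\<forall>R\<in>set M. sorted_wrt (<) R) \<and> map length M = ss \<and>
      distinct (concat M) \<and> set (concat M) = W} (disjoint_rows W ss)" (is "bij_betw _ ?X _")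
  unfolding bij_betw_def
proof
  show "inj_on (map set) ?X"
  proof (rule inj_onI)
    fix M M' assume *: "M \<in> ?X" "M' \<in> ?X" "map set M = map set M'"
    have len: "length M = length M'" using *(3) by (metis length_map)
    show "M = M'"
    proof (rule nth_equalityI[OF len])
      fix l assume "l < length M"
      moreover from this have "set (M ! l) = set (M' ! l)" using *(3) len by (metis nth_map)
      ultimately show "M ! l = M' ! l" using *(1,2) len by (intro strict_sorted_equal) auto
    qed
  qed
  show "map set ` ?X = disjoint_rows W ss"
  proof (intro equalityI subsetI)
    fix Rs assume "Rs \<in> map set ` ?X"
    then obtain M where "M \<in> ?X" "Rs = map set M" by (rule imageE)
    then show "Rs \<in> disjoint_rows W ss" using map_set_disjoint_rows[of M W ss] by simp
  next
    fix Rs assume Rs: "Rs \<in> disjoint_rows W ss"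
    define M where "M = map sorted_list_of_set Rs"
    have fin: "finite R" if "R \<in> set Rs" for R
      using disjoint_rowsD[OF Rs] that finite_subset[OF _ assms(1)] by blast
    have mapM: "map set M = Rs"
      unfolding M_def using fin by (simp add: map_idI comp_def)
    have srt: "sorted_wrt (<) R" if "R \<in> set M" for R
      using that by (auto simp: M_def)
    have *: "map length M = ss" "distinct (concat M)" "set (concat M) \<subseteq> W"
      using map_set_disjoint_rows[of M W ss] srt Rs mapM by auto
    have "card (set (concat M)) = card W"
      using * assms(2) by (simp add: distinct_card length_concat del: set_concat)
    then have "set (concat M) = W" using * assms(1) by (intro card_subset_eq)
    then have "M \<in> ?X" using * srt by blast
    then show "Rs \<in> map set ` ?X" using mapM by blast
  qed
qed

lemma row_size_ones: "r \<le> n \<Longrightarrow> row_size (replicate n 1) r = r"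
  unfolding row_size_def by simp

lemma num_entries_ones: "num_entries (replicate n 1) = sum_list [1..<Suc n]"
proof -
  have "num_entries (replicate n 1) = (\<Sum>r=1..n. r)"
    unfolding num_entries_def using row_size_ones[of _ n] by (intro sum.cong) simp_all
  also have "\<dots> = sum_list [1..<Suc n]"
    by (simp add: interv_sum_list_conv_sum_set_nat atLeastLessThanSuc_atLeastAtMost del: upt_Suc)
  finally show ?thesis .
qed

lemma continuous_mlq_ones:
  "continuous_mlq (replicate n 1) = {M. (\<forall>R\<in>set M. sorted_wrt (<) R) \<and> map length M = [1..<Suc n] \<and>
      distinct (concat M) \<and> set (concat M) = {1..num_entries (replicate n 1)}}"
proof -
  have "length M = n \<and> (\<forall>i\<in>{1..n}. length (M ! (i - 1)) = row_size (replicate n 1) i \<and> sorted_wrt (<) (M ! (i - 1))) \<longleftrightarrow>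
      (\<forall>R\<in>set M. sorted_wrt (<) R) \<and> map length M = [1..<Suc n]" for M :: "nat list list"
  proof (cases "length M = n")
    case True
    have "(\<forall>i\<in>{1..n}. length (M ! (i - 1)) = row_size (replicate n 1) i \<and> sorted_wrt (<) (M ! (i - 1))) \<longleftrightarrow>
      (\<forall>l<n. length (M ! l) = Suc l \<and> sorted_wrt (<) (M ! l))"
    proof
      assume *: "\<forall>i\<in>{1..n}. length (M ! (i - 1)) = row_size (replicate n 1) i \<and> sorted_wrt (<) (M ! (i - 1))"
      show "\<forall>l<n. length (M ! l) = Suc l \<and> sorted_wrt (<) (M ! l)"
      proof (intro allI impI)
        fix l assume "l < n"
        then show "length (M ! l) = Suc l \<and> sorted_wrt (<) (M ! l)"
          using *[rule_format, of "Suc l"] row_size_ones[of "Suc l" n] by simp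
      qed
    next
      assume *: "\<forall>l<n. length (M ! l) = Suc l \<and> sorted_wrt (<) (M ! l)"
      show "\<forall>i\<in>{1..n}. length (M ! (i - 1)) = row_size (replicate n 1) i \<and> sorted_wrt (<) (M ! (i - 1))"
      proof
        fix i assume "i \<in> {1..n}"
        then show "length (M ! (i - 1)) = row_size (replicate n 1) i \<and> sorted_wrt (<) (M ! (i - 1))"
          using *[rule_format, of "i - 1"] row_size_ones[of i n] by auto
      qed
    qed
    moreover have "map length M = [1..<Suc n] \<longleftrightarrow> (\<forall>l<n. length (M ! l) = Suc l)"
      using True by (simp add: list_eq_iff_nth_eq del: upt_Suc)
    ultimately show ?thesis using True by (auto simp: all_set_conv_all_nth)
  next
    case False
    have "map length M \<noteq> [1..<Suc n]"
    proof
      assume "map length M = [1..<Suc n]"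
      then have "length (map length M) = length [1..<Suc n]" by simp
      then show False using False by (simp del: upt_Suc)
    qed
    then show ?thesis using False by blast
  qed
  note rows_iff = this
  show ?thesis unfolding continuous_mlq_def length_replicate
  proof (rule Collect_cong)
    fix M :: "nat list list"
    show "(length M = n \<and> (\<forall>i\<in>{1..n}. length (M ! (i - 1)) = row_size (replicate n 1) i \<and> sorted_wrt (<) (M ! (i - 1))) \<and>
        distinct (concat M) \<and> set (concat M) = {1..num_entries (replicate n 1)}) \<longleftrightarrow>
      ((\<forall>R\<in>set M. sorted_wrt (<) R) \<and> map length M = [1..<Suc n] \<and>
        distinct (concat M) \<and> set (concat M) = {1..num_entries (replicate n 1)})"
      using rows_iff[of M] by blast
  qed
qed

abbreviation staircases :: "nat \<Rightarrow> nat set list set" where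
  "staircases n \<equiv> disjoint_rows {1..num_entries (replicate n 1)} [1..<Suc n]"

lemma sum_continuous_mlq:
  "(\<Sum>M\<in>continuous_mlq (replicate n 1). g (map set M)) =
    sum g (staircases n)"
  unfolding continuous_mlq_ones
proof (rule sum.reindex_bij_betw[OF disjoint_rows_image])
  show "card {1..num_entries (replicate n 1)} = sum_list [1..<Suc n]"
    by (simp only: card_atLeastAtMost diff_Suc_1 num_entries_ones)
qed simp

lemma cnext_nth:
  assumes "sorted_wrt (<) ys" "a < length ys"
  shows "cnext (set ys) (ys ! a) = ys ! (Suc a mod length ys)"
proof (rule cnext_eqI)
  show "ys ! (Suc a mod length ys) \<in> set ys" using assms by (intro nth_mem mod_less_divisor) auto
  fix z assume "z \<in> set ys"
  then obtain b where b: "b < length ys" "z = ys ! b" by (auto simp: in_set_conv_nth)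
  have mono: "ys ! c < ys ! d \<longleftrightarrow> c < d" "ys ! c \<le> ys ! d \<longleftrightarrow> c \<le> d" if "c < length ys" "d < length ys" for c d
    using that sorted_wrt_nth_less[OF assms(1)] by (metis linorder_neqE_nat order_less_asym order_less_irrefl not_le order_refl less_imp_le)+
  show "\<not> btw (ys ! a) z (ys ! (Suc a mod length ys))"
  proof (cases "Suc a = length ys")
    case True
    then have "\<not> ys ! a < ys ! b" "\<not> ys ! b < ys ! 0"
      using mono(1)[OF assms(2) b(1)] mono(1)[OF b(1), of 0] True b assms(2) by (auto simp del: length_greater_0_conv)
    then show ?thesis using True b by (auto simp: btw_def)
  next
    case False
    then have a: "Suc a mod length ys = Suc a" "Suc a < length ys" using assms by auto
    then have "ys ! a < ys ! Suc a" "\<not> (ys ! a < ys ! b \<and> ys ! b < ys ! Suc a)"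
      using mono(1)[of a "Suc a"] mono(1)[of a b] mono(1)[of b "Suc a"] b assms by auto
    then show ?thesis using a b by (auto simp: btw_def)
  qed
qed simp

lemma inj_on_cnext:
  assumes "finite C"
  shows "inj_on (cnext C) C"
proof (rule inj_onI)
  fix c c' assume *: "c \<in> C" "c' \<in> C" "cnext C c = cnext C c'"
  have nb: "\<not> btw c c' (cnext C c)" "\<not> btw c' c (cnext C c)"
    using not_btw_cnext[OF assms *(2), of c] not_btw_cnext[OF assms *(1), of c'] *(3) by auto
  show "c = c'"
  proof (rule ccontr)
    assume "c \<noteq> c'"
    then show False using nb btw_total[of c c' "cnext C c"] by (metis btw_irrefl(3))
  qed
qed

lemma follow_count_eq:
  assumes "finite C" "B \<subseteq> C"
  shows "follow_count B D C = real (card {c \<in> B. cnext C c \<in> C - D})"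
proof -
  have "{u. u \<in> C - D \<and> (\<exists>c\<in>B. cnext C c = u)} = cnext C ` {c \<in> B. cnext C c \<in> C - D}" by auto
  moreover have "inj_on (cnext C) {c \<in> B. cnext C c \<in> C - D}"
    using inj_on_cnext[OF assms(1)] by (rule inj_on_subset) (use assms in auto)
  ultimately show ?thesis by (simp add: follow_count_def card_image)
qed

text \<open>\<open>labelled R r p\<close> is the set of the entries of row \<open>p + 1\<close> visited by the bully paths that start in
  the first \<open>r\<close> rows.\<close>

primrec labelled :: "(nat \<Rightarrow> nat set) \<Rightarrow> nat \<Rightarrow> nat \<Rightarrow> nat set" where
  "labelled R r 0 = (if 0 < r then R 0 else {})"
| "labelled R r (Suc p) = (if Suc p < r then R (Suc p) else served (labelled R r p) (R (Suc p)))"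

lemma labelled_full: "p < r \<Longrightarrow> labelled R r p = R p"
  by (cases p) auto

lemma labelled_subset: "labelled R r p \<subseteq> R p"
  by (cases p) (auto dest: subsetD[OF served_subset])

section \<open>The bully path procedure as iterated service\<close>

locale staircase =
  fixes n :: nat and R :: "nat \<Rightarrow> nat set"
  assumes fin: "\<And>p. p < n \<Longrightarrow> finite (R p)" and card_R: "\<And>p. p < n \<Longrightarrow> card (R p) = Suc p"
    and disj: "\<And>p q. p < n \<Longrightarrow> q < n \<Longrightarrow> p \<noteq> q \<Longrightarrow> R p \<inter> R q = {}"
begin

lemma finite_labelled: "p < n \<Longrightarrow> finite (labelled R r p)"
  using labelled_subset fin finite_subset by metis

lemma card_labelled: "p < n \<Longrightarrow> card (labelled R r p) = min r (Suc p)"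
proof (induction p)
  case 0
  then show ?case using card_R[of 0] by auto
next
  case (Suc p)
  show ?case
  proof (cases "Suc p < r")
    case True
    then show ?thesis using Suc card_R by simp
  next
    case False
    have "card (served (labelled R r p) (R (Suc p))) = card (labelled R r p)"
      using Suc fin card_R finite_labelled by (intro card_served) auto
    then show ?thesis using False Suc by auto
  qed
qed

lemma labelled_mono: "p < n \<Longrightarrow> r \<le> r' \<Longrightarrow> labelled R r p \<subseteq> labelled R r' p"
proof (induction p)
  case (Suc p)
  show ?case
  proof (cases "Suc p < r'")
    case True
    then show ?thesis using labelled_subset[of R r "Suc p"] by simp
  next
    case False
    then have "labelled R r (Suc p) = served (labelled R r p) (R (Suc p))"
      "labelled R r' (Suc p) = served (labelled R r' p) (R (Suc p))" using Suc by auto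
    moreover have "served (labelled R r p) (R (Suc p)) \<subseteq> served (labelled R r' p) (R (Suc p))"
      using Suc fin card_R card_labelled[of p r'] finite_labelled by (intro served_mono) auto
    ultimately show ?thesis by simp
  qed
qed auto

end

locale staircase_mlq =
  fixes n :: nat and M :: "nat list list" and R :: "nat \<Rightarrow> nat set"
  assumes len: "length M = n" and R_def: "\<And>p. R p = set (M ! p)"
    and lens: "\<And>p. p < n \<Longrightarrow> length (M ! p) = Suc p"
    and sorted: "\<And>p. p < n \<Longrightarrow> sorted_wrt (<) (M ! p)"
    and dist: "distinct (concat M)" and n_pos: "n > 0"
begin

lemma distinct_row: "p < n \<Longrightarrow> distinct (M ! p)"
  using sorted[of p] by (simp add: strict_sorted_iff)

sublocale staircase n R
proof
  show "finite (R p)" if "p < n" for p by (simp add: R_def)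
  show "card (R p) = Suc p" if "p < n" for p
    using that distinct_card[OF distinct_row[OF that]] lens by (simp add: R_def)
  show "R p \<inter> R q = {}" if "p < n" "q < n" "p \<noteq> q" for p q
  proof -
    have "M ! p \<noteq> M ! q"
    proof
      assume "M ! p = M ! q"
      then have "Suc p = Suc q" using lens that by metis
      then show False using that by simp
    qed
    then show ?thesis using dist that len unfolding distinct_concat_iff R_def by (meson nth_mem)
  qed
qed

abbreviation path_result :: "nat \<Rightarrow> nat \<Rightarrow> nat set \<Rightarrow> nat \<Rightarrow> nat set \<Rightarrow> bool" where
  "path_result r p A y A' \<equiv> y \<notin> labelled R r (n - 1) \<and>
     insert y (labelled R r (n - 1)) = labelled R (Suc r) (n - 1) \<and> A' \<subseteq> A \<and>
     (\<forall>q. p < q \<longrightarrow> q < n \<longrightarrow> A' \<inter> R q = R q - labelled R (Suc r) q) \<and>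
     (\<forall>q\<le>p. A' \<inter> R q = A \<inter> R q)"

text \<open>While the free entries of a lower row are those left over by
  \<open>labelled R r\<close>, the path enters that row as one more arrival, served last. By
  \<open>served_insert\<close> it takes exactly the entry that \<open>labelled R (Suc r)\<close> has
  in addition.\<close>

lemma bully_path_labelled:
  assumes "r \<le> p" "p < n" "\<And>q. p < q \<Longrightarrow> q < n \<Longrightarrow> A \<inter> R q = R q - labelled R r q"
    and "x \<notin> labelled R r p" "insert x (labelled R r p) = labelled R (Suc r) p"
  shows "\<exists>y A'. bully_path A x (drop (Suc p) M) = (y, A') \<and> path_result r p A y A'"
  using assms
proof (induction "n - p" arbitrary: p A x)
  case 0
  then show ?case by simp
next
  case (Suc d)
  show ?case
  proof (cases "Suc p = n")
    case True
    then have "drop (Suc p) M = []" using len by simp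
    moreover have "p = n - 1" using True by simp
    ultimately show ?thesis using Suc.prems by auto
  next
    case False
    then have p: "Suc p < n" using Suc.prems by simp
    let ?X = "labelled R r p" and ?R = "R (Suc p)"
    define y where "y = bullied A (M ! Suc p) x"
    have X: "labelled R r (Suc p) = served ?X ?R" using Suc.prems(1) by simp
    have AR: "A \<inter> set (M ! Suc p) = ?R - served ?X ?R"
      using Suc.prems(3)[of "Suc p"] p X by (simp add: R_def)
    have y: "y = cnext (?R - served ?X ?R) x"
      unfolding y_def bullied_def cnext_def AR ..
    have c: "card ?X < card ?R" using card_labelled[of p r] card_R[OF p] Suc.prems by simp
    note si = served_insert[OF finite_labelled[OF Suc.prems(2)] fin[OF p] Suc.prems(4) c]
    have yR: "y \<in> ?R" "y \<notin> labelled R r (Suc p)" using si(2) y X by auto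
    have ins: "insert y (labelled R r (Suc p)) = labelled R (Suc r) (Suc p)"
      using si(1) y X Suc.prems(1,5) by simp
    have "drop (Suc p) M = M ! Suc p # drop (Suc (Suc p)) M" using p len by (simp add: Cons_nth_drop_Suc)
    then have bp: "bully_path A x (drop (Suc p) M) = bully_path (A - {y}) y (drop (Suc (Suc p)) M)"
      by (simp add: y_def Let_def)
    have other: "(A - {y}) \<inter> R q = A \<inter> R q" if "q \<noteq> Suc p" "q < n" for q
      using disj[OF that(2) p that(1)] yR by blast
    have "\<exists>z A'. bully_path (A - {y}) y (drop (Suc (Suc p)) M) = (z, A') \<and> path_result r (Suc p) (A - {y}) z A'"
    proof (rule Suc.hyps(1))
      show "d = n - Suc p" using Suc.hyps(2) by simp
      show "r \<le> Suc p" "Suc p < n" using Suc.prems(1) p by simp_all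
      show "(A - {y}) \<inter> R q = R q - labelled R r q" if "Suc p < q" "q < n" for q
        using other[of q] Suc.prems(3)[of q] that by simp
    qed (fact yR(2), fact ins)
    then obtain z A' where Z: "bully_path (A - {y}) y (drop (Suc (Suc p)) M) = (z, A') \<and> path_result r (Suc p) (A - {y}) z A'"
      by (elim exE)
    have zq: "A' \<inter> R q = R q - labelled R (Suc r) q" if "Suc p < q" "q < n" for q using Z that by simp
    have zl: "A' \<inter> R q = (A - {y}) \<inter> R q" if "q \<le> Suc p" for q using Z that by simp
    have "A' \<subseteq> A" using Z by blast
    have Aq: "A' \<inter> R q = R q - labelled R (Suc r) q" if "p < q" "q < n" for q
    proof (cases "q = Suc p")
      case True
      have "A' \<inter> ?R = (A \<inter> ?R) - {y}" using zl[of "Suc p"] by blast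
      also have "\<dots> = ?R - insert y (labelled R r (Suc p))" using Suc.prems(3)[of "Suc p"] p by auto
      finally show ?thesis using ins True by simp
    next
      case False
      then show ?thesis using zq that by simp
    qed
    have "A' \<inter> R q = A \<inter> R q" if "q \<le> p" for q
      using zl[of q] other[of q] that Suc.prems(2) by simp
    then show ?thesis
      using bp Z Aq \<open>A' \<subseteq> A\<close> by (intro exI[of _ z] exI[of _ A']) simp
  qed
qed

lemma fold_start_path_skip:
  "(\<And>x. x \<in> set xs \<Longrightarrow> x \<notin> A) \<Longrightarrow> fold (start_path M r) xs (A, L) = (A, L)"
  by (induction xs) (auto simp: start_path_def)

text \<open>The sets \<open>labelled R r (n - 1)\<close> increase with r, so the second part says
  that the label of y is the least index of a set containing y.\<close>

definition labels_ok :: "nat \<Rightarrow> nat set \<times> (nat \<Rightarrow> nat) \<Rightarrow> bool" where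
  "labels_ok r s \<longleftrightarrow> (\<forall>p<n. fst s \<inter> R p = R p - labelled R r p) \<and>
     (\<forall>y\<in>labelled R r (n - 1). 1 \<le> snd s y \<and> snd s y \<le> r \<and>
        y \<in> labelled R (snd s y) (n - 1) \<and> y \<notin> labelled R (snd s y - 1) (n - 1))"

text \<open>Row r + 1 has r + 1 entries, and the paths from above occupy r of them. So exactly one
  path starts there, at x, and the other entries are skipped.\<close>

lemma process_row_labelled:
  assumes "labels_ok r s" "r < n"
  shows "labels_ok (Suc r) (process_row M (Suc r) s)"
proof -
  obtain A L where s: "s = (A, L)" by (cases s)
  have AR: "A \<inter> R p = R p - labelled R r p" if "p < n" for p
    using assms(1) that by (simp add: labels_ok_def s)
  have "card (R r - labelled R r r) = 1"
    using card_Diff_subset[OF finite_labelled labelled_subset, of r r] card_labelled[of r r] card_R[of r] assms(2) by simp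
  then obtain x where x: "R r - labelled R r r = {x}" by (auto simp: card_1_singleton_iff)
  then have xR: "x \<in> R r" "x \<in> A" "x \<notin> labelled R r r" using AR[OF assms(2)] by blast+
  then obtain ys zs where yz: "M ! r = ys @ x # zs" unfolding R_def by (meson split_list)
  have skip: "v \<notin> A" if "v \<in> set ys \<union> set zs" for v
  proof
    assume "v \<in> A"
    moreover have "v \<in> R r" using that yz by (auto simp: R_def)
    ultimately have "v = x" using AR[OF assms(2)] x by blast
    then show False using that yz distinct_row[OF assms(2)] by auto
  qed
  have insx: "insert x (labelled R r r) = labelled R (Suc r) r"
    using x labelled_full[of r "Suc r" R] labelled_subset[of R r r] by blast
  have rest: "(A - {x}) \<inter> R q = A \<inter> R q" if "q \<noteq> r" "q < n" for q
    using disj[OF that(2) assms(2) that(1)] xR by blast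
  have "\<exists>y A'. bully_path (A - {x}) x (drop (Suc r) M) = (y, A') \<and> path_result r r (A - {x}) y A'"
  proof (rule bully_path_labelled[OF order_refl assms(2) _ xR(3) insx])
    show "(A - {x}) \<inter> R q = R q - labelled R r q" if "r < q" "q < n" for q
      using rest[of q] AR[of q] that by simp
  qed
  then obtain y A' where Y: "bully_path (A - {x}) x (drop (Suc r) M) = (y, A') \<and> path_result r r (A - {x}) y A'"
    by (elim exE)
  then have y: "bully_path (A - {x}) x (drop (Suc r) M) = (y, A')" "y \<notin> labelled R r (n - 1)"
    "insert y (labelled R r (n - 1)) = labelled R (Suc r) (n - 1)" "A' \<subseteq> A - {x}" by simp_all
  have yq: "A' \<inter> R q = R q - labelled R (Suc r) q" if "r < q" "q < n" for q using Y that by simp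
  have yl: "A' \<inter> R q = (A - {x}) \<inter> R q" if "q \<le> r" for q using Y that by simp
  have "process_row M (Suc r) s = fold (start_path M (Suc r)) (x # zs) (A, L)"
    using fold_start_path_skip[of ys A "Suc r" L] skip by (simp add: process_row_def yz s)
  also have "\<dots> = fold (start_path M (Suc r)) zs (A', L(y := Suc r))"
    using xR y by (simp add: start_path_def)
  also have "\<dots> = (A', L(y := Suc r))"
    using skip y(4) by (intro fold_start_path_skip) blast
  finally have res: "process_row M (Suc r) s = (A', L(y := Suc r))" .
  have "A' \<inter> R p = R p - labelled R (Suc r) p" if "p < n" for p
  proof (cases "r < p")
    case True
    then show ?thesis using yq that by simp
  next
    case False
    then have "labelled R (Suc r) p = R p" by (intro labelled_full) simp
    moreover have "A' \<inter> R p = {}"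
    proof (cases "p = r")
      case True
      then show ?thesis using yl[of r] AR[OF assms(2)] x by blast
    next
      case pr: False
      then have "labelled R r p = R p" using False by (intro labelled_full) simp
      then show ?thesis using yl[of p] rest[OF pr that] AR[OF that] False by auto
    qed
    ultimately show ?thesis by simp
  qed
  moreover have "1 \<le> (L(y := Suc r)) z \<and> (L(y := Suc r)) z \<le> Suc r \<and>
      z \<in> labelled R ((L(y := Suc r)) z) (n - 1) \<and> z \<notin> labelled R ((L(y := Suc r)) z - 1) (n - 1)"
    if "z \<in> labelled R (Suc r) (n - 1)" for z
  proof (cases "z = y")
    case True
    then show ?thesis using that y(2) by simp
  next
    case False
    then have "z \<in> labelled R r (n - 1)" using that y(3) by blast
    then show ?thesis using assms(1) False by (auto simp: labels_ok_def s)
  qed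
  ultimately show ?thesis unfolding res labels_ok_def by simp
qed

lemma labels_ok_fold:
  "r < n \<Longrightarrow> labels_ok r (fold (process_row M) [1..<Suc r] (set (concat M), \<lambda>_. 0))"
proof (induction r)
  case 0
  have "labelled R 0 p = {}" for p by (induction p) auto
  moreover have "set (concat M) \<inter> R p = R p" if "p < n" for p
  proof -
    have "M ! p \<in> set M" using that len by simp
    then show ?thesis unfolding R_def set_concat by blast
  qed
  ultimately show ?case by (simp add: labels_ok_def)
next
  case (Suc r)
  then show ?case using process_row_labelled[of r] by simp
qed

lemma bully_label_le_iff:
  assumes "y \<in> R (n - 1)"
  shows "1 \<le> bully_label M y" "bully_label M y \<le> n" "r \<le> n \<Longrightarrow> bully_label M y \<le> r \<longleftrightarrow> y \<in> labelled R r (n - 1)"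
proof -
  obtain A L where s: "fold (process_row M) [1..<n] (set (concat M), \<lambda>_. 0) = (A, L)"
    by (cases "fold (process_row M) [1..<n] (set (concat M), \<lambda>_. 0)")
  have ok: "labels_ok (n - 1) (A, L)" using labels_ok_fold[of "n - 1"] n_pos s by simp
  have A: "A \<inter> R (n - 1) = R (n - 1) - labelled R (n - 1) (n - 1)"
    using ok n_pos by (simp add: labels_ok_def)
  have lab: "bully_label M y = (if y \<in> A then n else L y)"
    unfolding bully_label_def len s by simp
  have full: "labelled R n (n - 1) = R (n - 1)" using n_pos by (intro labelled_full) simp
  have "1 \<le> bully_label M y \<and> bully_label M y \<le> n \<and>
      y \<in> labelled R (bully_label M y) (n - 1) \<and> y \<notin> labelled R (bully_label M y - 1) (n - 1)"
  proof (cases "y \<in> A")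
    case True
    then have "y \<notin> labelled R (n - 1) (n - 1)" using A assms by blast
    then show ?thesis using True lab full assms n_pos by simp
  next
    case False
    then have "y \<in> labelled R (n - 1) (n - 1)" using A assms by blast
    then show ?thesis using False lab ok by (auto simp: labels_ok_def)
  qed
  note l = this
  then show "1 \<le> bully_label M y" "bully_label M y \<le> n" by auto
  show "bully_label M y \<le> r \<longleftrightarrow> y \<in> labelled R r (n - 1)" if "r \<le> n"
  proof
    assume "bully_label M y \<le> r"
    then show "y \<in> labelled R r (n - 1)" using l labelled_mono[of "n - 1" "bully_label M y" r] n_pos by auto
  next
    assume y: "y \<in> labelled R r (n - 1)"
    show "bully_label M y \<le> r"
    proof (rule ccontr)
      assume "\<not> ?thesis"
      then have "r \<le> bully_label M y - 1" by simp
      then show False using l y labelled_mono[of "n - 1" r "bully_label M y - 1"] n_pos by auto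
    qed
  qed
qed

lemma labelled_descend:
  assumes "1 \<le> r" "r \<le> n"
  shows "labelled R r (n - 1) = descend (r - 1) (map set M)"
proof -
  have "labelled R r (r - 1 + d) = foldl served (R (r - 1)) (take d (drop r (map set M)))" if "r + d \<le> n" for d
    using that
  proof (induction d)
    case 0
    then show ?case using assms labelled_full[of "r - 1" r R] by simp
  next
    case (Suc d)
    have "take (Suc d) (drop r (map set M)) = take d (drop r (map set M)) @ [R (r + d)]"
      using Suc.prems len by (simp add: take_Suc_conv_app_nth R_def)
    moreover have "labelled R r (r - 1 + Suc d) = served (labelled R r (r - 1 + d)) (R (r + d))"
      using assms by (cases r) simp_all
    ultimately show ?case using Suc by simp
  qed
  from this[of "n - r"] show ?thesis using assms len by (simp add: descend_def R_def)
qed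

text \<open>Label i occurs only once, so the indicator of the event is a sum of indicators over C.
  Being equal to i or to j is then a difference of conditions of the form at most a and larger than
  b, which gives four terms.\<close>

lemma followed_eq_follow_count:
  assumes "1 \<le> i" "i < j" "j \<le> n"
  defines "X \<equiv> \<lambda>r. labelled R r (n - 1)" and "C \<equiv> R (n - 1)"
  shows "of_bool (cyclically_followed (projected_word M) i j) =
    follow_count (X i) (X (j - 1)) C - follow_count (X (i - 1)) (X (j - 1)) C
    - follow_count (X i) (X j) C + follow_count (X (i - 1)) (X j) C"
proof -
  let ?l = "bully_label M"
  let ?ys = "M ! (n - 1)"
  have C: "finite C" "C = set ?ys" "length ?ys = n" "sorted_wrt (<) ?ys"
    using fin[of "n - 1"] n_pos lens[of "n - 1"] sorted[of "n - 1"] by (auto simp: C_def R_def)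
  have nx: "cnext C c \<in> C" if "c \<in> C" for c using cnext_in[OF C(1)] that by blast
  have "cyclically_followed (projected_word M) i j \<longleftrightarrow>
      (\<exists>a<n. ?l (?ys ! a) = i \<and> ?l (?ys ! (Suc a mod n)) = j)"
    unfolding cyclically_followed_def projected_word_def using C(3) n_pos len by auto
  also have "\<dots> \<longleftrightarrow> (\<exists>a<n. ?l (?ys ! a) = i \<and> ?l (cnext C (?ys ! a)) = j)"
    using cnext_nth[OF C(4)] C(2,3) by auto
  also have "\<dots> \<longleftrightarrow> (\<exists>c\<in>C. ?l c = i \<and> ?l (cnext C c) = j)"
    unfolding C(2) using C(3) by (metis in_set_conv_nth)
  finally have fol: "cyclically_followed (projected_word M) i j \<longleftrightarrow> (\<exists>c\<in>C. ?l c = i \<and> ?l (cnext C c) = j)" .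
  have le: "?l c \<le> r \<longleftrightarrow> c \<in> X r" if "c \<in> C" "r \<le> n" for c r
    using bully_label_le_iff(3)[of c r] that by (simp add: C_def X_def)
  have XC: "X r \<subseteq> C" for r using labelled_subset by (simp add: X_def C_def)
  have fc: "follow_count (X a) (X b) C = (\<Sum>c\<in>C. of_bool (?l c \<le> a \<and> b < ?l (cnext C c)))"
    if "a \<le> n" "b \<le> n" for a b
  proof -
    have "{c \<in> X a. cnext C c \<in> C - X b} = {c \<in> C. ?l c \<le> a \<and> b < ?l (cnext C c)}"
      using XC[of a] le[OF _ that(1)] le[OF nx that(2)] nx by (auto simp: not_le[symmetric])
    then show ?thesis
      using follow_count_eq[OF C(1) XC] C(1) by (simp add: of_bool_def sum.If_cases Int_def)
  qed
  have one: "c = c'" if "c \<in> C" "c' \<in> C" "?l c = i" "?l c' = i" for c c'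
  proof -
    have "X (i - 1) \<subseteq> X i" using labelled_mono[of "n - 1" "i - 1" i] n_pos by (simp add: X_def)
    then have "card (X i - X (i - 1)) = 1"
      using card_Diff_subset[of "X (i - 1)" "X i"] finite_labelled[of "n - 1"] card_labelled[of "n - 1"] n_pos assms
      by (simp add: X_def)
    then obtain z where z: "X i - X (i - 1) = {z}" by (auto simp: card_1_singleton_iff)
    have i: "i \<le> n" "i - 1 \<le> n" "\<not> i \<le> i - 1" using assms(1-3) by simp_all
    have "c \<in> X i - X (i - 1)" "c' \<in> X i - X (i - 1)"
      using that le[OF that(1) i(1)] le[OF that(1) i(2)] le[OF that(2) i(1)] le[OF that(2) i(2)] i(3) by simp_all
    then show ?thesis unfolding z by simp
  qed
  have "of_bool (\<exists>c\<in>C. ?l c = i \<and> ?l (cnext C c) = j) = (\<Sum>c\<in>C. of_bool (?l c = i \<and> ?l (cnext C c) = j) :: real)"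
  proof (cases "\<exists>c\<in>C. ?l c = i \<and> ?l (cnext C c) = j")
    case True
    then obtain c where c: "c \<in> C" "?l c = i" "?l (cnext C c) = j" by blast
    have "(\<Sum>c\<in>C. of_bool (?l c = i \<and> ?l (cnext C c) = j) :: real) = (\<Sum>c'\<in>C. of_bool (c' = c))"
      by (rule sum.cong[OF refl]) (use c one in auto)
    then show ?thesis using True c C(1) by (simp add: of_bool_def)
  next
    case False
    then have "(\<Sum>c\<in>C. of_bool (?l c = i \<and> ?l (cnext C c) = j) :: real) = 0"
      by (intro sum.neutral) auto
    then show ?thesis using False by (simp only: of_bool_eq)
  qed
  also have "\<dots> = (\<Sum>c\<in>C. of_bool (?l c \<le> i \<and> j - 1 < ?l (cnext C c)) - of_bool (?l c \<le> i - 1 \<and> j - 1 < ?l (cnext C c))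
      - of_bool (?l c \<le> i \<and> j < ?l (cnext C c)) + of_bool (?l c \<le> i - 1 \<and> j < ?l (cnext C c)))"
  proof (rule sum.cong[OF refl])
    fix c
    have "?l c \<le> i \<longleftrightarrow> ?l c \<le> i - 1 \<or> ?l c = i" "j - 1 < ?l (cnext C c) \<longleftrightarrow> j < ?l (cnext C c) \<or> ?l (cnext C c) = j"
      using assms by auto
    moreover have "\<not> (?l c \<le> i - 1 \<and> ?l c = i)" "\<not> (j < ?l (cnext C c) \<and> ?l (cnext C c) = j)" using assms by auto
    ultimately show "of_bool (?l c = i \<and> ?l (cnext C c) = j) =
      of_bool (?l c \<le> i \<and> j - 1 < ?l (cnext C c)) - of_bool (?l c \<le> i - 1 \<and> j - 1 < ?l (cnext C c))
      - of_bool (?l c \<le> i \<and> j < ?l (cnext C c)) + (of_bool (?l c \<le> i - 1 \<and> j < ?l (cnext C c)) :: real)"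
      by (cases "?l c \<le> i - 1"; cases "?l c = i"; cases "j < ?l (cnext C c)"; cases "?l (cnext C c) = j") auto
  qed
  also have "\<dots> = follow_count (X i) (X (j - 1)) C - follow_count (X (i - 1)) (X (j - 1)) C
    - follow_count (X i) (X j) C + follow_count (X (i - 1)) (X j) C"
  proof -
    have b: "i \<le> n" "i - 1 \<le> n" "j - 1 \<le> n" using assms(1-3) by simp_all
    show ?thesis
      unfolding fc[OF b(1,3)] fc[OF b(2,3)] fc[OF b(1) assms(3)] fc[OF b(2) assms(3)]
      by (simp only: sum.distrib sum_subtractf)
  qed
  finally show ?thesis unfolding fol .
qed

end

section \<open>Assembling the correlation\<close>

text \<open>The empty set is the only row of size 0. This brings the case i = k into the form of
  \<open>sum_rows_lump\<close>, with an artificial first row of size 0.\<close>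

lemma sum_rows_insert_empty:
  assumes "finite W"
  shows "sum g (disjoint_rows W (pre @ 0 # ss)) =
    (\<Sum>Rs\<in>disjoint_rows W (pre @ ss). g (take (length pre) Rs @ {} # drop (length pre) Rs))"
  using assms
proof (induction pre arbitrary: W g)
  case Nil
  have "{R. R \<subseteq> W \<and> card R = 0} = {{}}" using finite_subset[OF _ Nil] by auto
  then show ?case using sum_rows_Cons[OF Nil, of g 0 ss] by simp
next
  case (Cons p pre)
  show ?case using Cons by (simp add: sum_rows_Cons)
qed

text \<open>Because i - 1 is truncated, the value at i = 0 is that at i = 1 and not 0; hence the
  distinctions on i = 1 further on.\<close>

definition total_follow :: "nat \<Rightarrow> nat \<Rightarrow> nat \<Rightarrow> real" where
  "total_follow n i k =
    (\<Sum>Rs\<in>staircases n.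
      follow_count (descend (i - 1) Rs) (descend (k - 1) Rs) (last Rs))"

lemma card_entries: "card {1..num_entries (replicate n 1)} = sum_list [1..<Suc n]"
  by (simp only: card_atLeastAtMost diff_Suc_1 num_entries_ones)

lemma upt_split: "1 \<le> k \<Longrightarrow> k < n \<Longrightarrow> [1..<Suc n] = [1..<k] @ k # [Suc k..<n] @ [n]"
  using upt_add_eq_append[of 1 k "n - k"] upt_conv_Cons[of k n] by simp

lemma total_follow_less:
  assumes "1 \<le> i" "i < k" "k < n"
  shows "total_follow n i k = real i * real (n - k) / real (n + k) *
    real (card (staircases n))"
proof -
  let ?W = "{1..num_entries (replicate n 1)}"
  have "[1..<k] = [1..<i] @ i # [Suc i..<k]"
    using assms upt_add_eq_append[of 1 i "k - i"] upt_conv_Cons[of i k] by simp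
  then have ss: "[1..<Suc n] = [1..<i] @ i # [Suc i..<k] @ k # [Suc k..<n] @ [n]"
    using upt_split[of k n] assms by simp
  obtain K where K: "K > 0" "\<And>h. cyc_inv3 h \<Longrightarrow>
      (\<Sum>Rs\<in>disjoint_rows ?W ([1..<i] @ i # [Suc i..<k] @ k # [Suc k..<n] @ [n]).
        h (descend (length [1..<i]) Rs) (descend (length [1..<i] + Suc (length [Suc i..<k])) Rs) (last Rs)) =
      K * (\<Sum>Rs\<in>disjoint_rows {..<i + k + n} [i, k, n].
        three_rows h Rs)"
    by (rule sum_rows_lump[of i k "[Suc i..<k]" "[Suc k..<n]" ?W "[1..<i]" n])
      (use assms card_entries[of n] in \<open>auto simp only: ss[symmetric] set_upt finite_atLeastAtMost atLeastLessThan_iff\<close>)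
  have l: "length [1..<i] = i - 1" "i - 1 + Suc (length [Suc i..<k]) = k - 1" using assms by simp_all
  have one: "real (card (disjoint_rows ?W [1..<Suc n])) = K * real (card (disjoint_rows {..<i + k + n} [i, k, n]))"
    using K(2)[of "\<lambda>_ _ _. 1"] unfolding ss[symmetric] by (simp add: cyc_inv3_def del: upt_Suc)
  have "total_follow n i k = K * (real i * real (n - k) / real (n + k) * real (card (disjoint_rows {..<i + k + n} [i, k, n])))"
    using K(2)[OF cyc_inv3_follow_count] follow_count_average[OF assms(2,3)]
    unfolding total_follow_def l ss[symmetric] by simp
  then show ?thesis unfolding one by simp
qed

lemma total_follow_eq:
  assumes "1 \<le> k" "k < n"
  shows "total_follow n k k = real k * real (n - k + 1) / real (n + k - 1) *
    real (card (staircases n))"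
proof -
  let ?W = "{1..num_entries (replicate n 1)}"
  have ss: "[1..<Suc n] = [1..<k] @ k # [Suc k..<n] @ [n]" using upt_split assms by simp
  have len: "length [1..<k] = k - 1" by simp
  obtain K where K: "K > 0" "\<And>h. cyc_inv3 h \<Longrightarrow>
      (\<Sum>Rs\<in>disjoint_rows ?W ([1..<k] @ 0 # [] @ k # [Suc k..<n] @ [n]).
        h (descend (length [1..<k]) Rs) (descend (length [1..<k] + Suc (length ([] :: nat list))) Rs) (last Rs)) =
      K * (\<Sum>Rs\<in>disjoint_rows {..<0 + k + n} [0, k, n].
        three_rows h Rs)"
  proof (rule sum_rows_lump[of 0 k "[]" "[Suc k..<n]" ?W "[1..<k]" n])
    have "sum_list [1..<Suc n] = sum_list ([1..<k] @ 0 # [] @ k # [Suc k..<n] @ [n])"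
      unfolding ss by simp
    then show "card ?W = sum_list ([1..<k] @ 0 # [] @ k # [Suc k..<n] @ [n])"
      using card_entries[of n] by metis
  qed auto
  \<comment> \<open>The inserted empty row has index k - 1 and pushes row k from index k - 1 to
    index k.\<close>
  have red: "(\<Sum>Rs\<in>disjoint_rows ?W ([1..<k] @ 0 # [] @ k # [Suc k..<n] @ [n]). h (descend k Rs) (last Rs)) =
      (\<Sum>Rs\<in>disjoint_rows ?W [1..<Suc n]. h (descend (k - 1) Rs) (last Rs))"
    for h :: "nat set \<Rightarrow> nat set \<Rightarrow> real"
  proof -
    have "(\<Sum>Rs\<in>disjoint_rows ?W ([1..<k] @ 0 # k # [Suc k..<n] @ [n]). h (descend k Rs) (last Rs)) =
      (\<Sum>Rs\<in>disjoint_rows ?W [1..<Suc n]. h (descend k (take (k - 1) Rs @ {} # drop (k - 1) Rs))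
        (last (take (k - 1) Rs @ {} # drop (k - 1) Rs)))"
      unfolding ss by (subst sum_rows_insert_empty) (simp_all only: finite_atLeastAtMost len)
    also have "\<dots> = (\<Sum>Rs\<in>disjoint_rows ?W [1..<Suc n]. h (descend (k - 1) Rs) (last Rs))"
    proof (rule sum.cong[OF refl])
      fix Rs assume "Rs \<in> disjoint_rows ?W [1..<Suc n]"
      then have lR: "length Rs = n" using disjoint_rowsD[of Rs ?W "[1..<Suc n]"] by (simp del: upt_Suc)
      let ?Q = "take (k - 1) Rs @ {} # drop (k - 1) Rs"
      have lt: "length (take (k - 1) Rs) = k - 1" using lR assms by simp
      have "?Q ! k = Rs ! (k - 1)"
        using lt assms lR by (cases k) (simp_all add: nth_append)
      moreover have "drop (Suc k) ?Q = drop k Rs"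
      proof -
        have "drop (Suc k) ?Q = drop (Suc k - (k - 1)) ({} # drop (k - 1) Rs)" using lt by simp
        also have "Suc k - (k - 1) = Suc (Suc 0)" using assms by simp
        finally show ?thesis using assms by simp
      qed
      ultimately have "descend k ?Q = descend (k - 1) Rs" using assms by (simp add: descend_def)
      moreover have "k - 1 < length Rs" using lR assms by simp
      then have "last ?Q = last Rs" by simp
      ultimately show "h (descend k ?Q) (last ?Q) = h (descend (k - 1) Rs) (last Rs)" by simp
    qed
    finally show ?thesis by simp
  qed
  have l: "length [1..<k] + Suc (length ([] :: nat list)) = k" using assms by simp
  have one: "real (card (disjoint_rows ?W [1..<Suc n])) = K * real (card (disjoint_rows {..<0 + k + n} [0, k, n]))"
    using K(2)[of "\<lambda>_ _ _. 1"] red[of "\<lambda>_ _. 1"] by (simp add: cyc_inv3_def del: upt_Suc)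
  have "cyc_inv3 (\<lambda>B D C. follow_count D D C)"
    using cyc_inv3_follow_count unfolding cyc_inv3_def by blast
  from K(2)[OF this] have "total_follow n k k = K * (real k * real (n - k + 1) / real (n + k - 1) * real (card (disjoint_rows {..<0 + k + n} [0, k, n])))"
    using follow_count_average_two_rows[of k n] red[of "\<lambda>D C. follow_count D D C"] assms
    unfolding total_follow_def l by simp
  then show ?thesis unfolding one by simp
qed

text \<open>No label exceeds n. This agrees with the zero of (n - k) / (n + k) at k = n, a case
  outside the three-row computation.\<close>

lemma total_follow_last: "n > 0 \<Longrightarrow> total_follow n i n = 0"
  unfolding total_follow_def
proof (rule sum.neutral, rule ballI)
  fix Rs assume n: "n > 0" and "Rs \<in> staircases n"
  then have "length Rs = n" using disjoint_rowsD[of Rs _ "[1..<Suc n]"] by (simp del: upt_Suc)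
  then have "descend (n - 1) Rs = last Rs" using n by (cases "Rs = []") (auto simp: descend_def last_conv_nth)
  then show "follow_count (descend (i - 1) Rs) (descend (n - 1) Rs) (last Rs) = 0"
    by (simp add: follow_count_def)
qed

lemma correlation_eq_total:
  assumes "1 \<le> i" "i < j" "j \<le> n"
  shows "correlation i j n * real (card (staircases n)) =
    (total_follow n i (j - 1) - (if i = 1 then 0 else total_follow n (i - 1) (j - 1)))
    - (total_follow n i j - (if i = 1 then 0 else total_follow n (i - 1) j))"
proof -
  let ?\<Omega> = "continuous_mlq (replicate n 1)"
  let ?D = "staircases n"
  let ?F = "\<lambda>a b Rs. follow_count (descend (a - 1) Rs) (descend (b - 1) Rs) (last Rs)"
  let ?G = "\<lambda>Rs. (?F i (j - 1) Rs - (if i = 1 then 0 else ?F (i - 1) (j - 1) Rs))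
    - (?F i j Rs - (if i = 1 then 0 else ?F (i - 1) j Rs))"
  have card: "real (card ?D) = real (card ?\<Omega>)"
    using sum_continuous_mlq[of "\<lambda>_. 1 :: real" n] by (simp del: upt_Suc)
  have "correlation i j n = real (card (?\<Omega> \<inter> {M. cyclically_followed (projected_word M) i j})) / real (card ?\<Omega>)"
    unfolding correlation_def
    by (rule measure_pmf_of_set[OF continuous_mlq_nonempty finite_continuous_mlq])
  moreover have "card ?\<Omega> \<noteq> 0" using continuous_mlq_nonempty finite_continuous_mlq by simp
  ultimately have "correlation i j n * real (card ?D) = real (card (?\<Omega> \<inter> {M. cyclically_followed (projected_word M) i j}))"
    unfolding card by simp
  also have "\<dots> = (\<Sum>M\<in>?\<Omega>. of_bool (cyclically_followed (projected_word M) i j))"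
    using finite_continuous_mlq[of "replicate n 1"] by (simp add: of_bool_def sum.If_cases)
  also have "\<dots> = (\<Sum>M\<in>?\<Omega>. ?G (map set M))"
  proof (rule sum.cong[OF refl])
    fix M assume "M \<in> ?\<Omega>"
    then have M: "\<forall>R\<in>set M. sorted_wrt (<) R" "map length M = [1..<Suc n]" "distinct (concat M)"
      unfolding continuous_mlq_ones by blast+
    have "length (map length M) = length [1..<Suc n]" using M(2) by simp
    then have len: "length M = n" by (simp del: upt_Suc)
    interpret staircase_mlq n M "\<lambda>p. set (M ! p)"
    proof
      fix p assume p: "p < n"
      have "map length M ! p = [1..<Suc n] ! p" using M(2) by simp
      then show "length (M ! p) = Suc p" using p len by (simp del: upt_Suc)
      show "sorted_wrt (<) (M ! p)" using M(1) p len by simp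
    qed (use len M(3) assms in simp_all)
    let ?X = "\<lambda>r. labelled (\<lambda>p. set (M ! p)) r (n - 1)"
    have X: "?X r = descend (r - 1) (map set M)" if "1 \<le> r" "r \<le> n" for r
      using labelled_descend[OF that] .
    have "M \<noteq> []" using len n_pos by auto
    then have last: "set (M ! (n - 1)) = last (map set M)"
      using last_map[of M set] last_conv_nth[of M] len by simp
    have "labelled Q 0 p = {}" for Q p by (induction p) auto
    then have "?X 0 = {}" .
    then have zero: "follow_count (?X 0) D C = 0" for D C by (simp add: follow_count_def)
    have "of_bool (cyclically_followed (projected_word M) i j) =
      follow_count (?X i) (?X (j - 1)) (set (M ! (n - 1))) - follow_count (?X (i - 1)) (?X (j - 1)) (set (M ! (n - 1)))
      - follow_count (?X i) (?X j) (set (M ! (n - 1))) + follow_count (?X (i - 1)) (?X j) (set (M ! (n - 1)))"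
      using followed_eq_follow_count[OF assms] .
    moreover have "follow_count (?X (i - 1)) (?X b) (set (M ! (n - 1))) =
        (if i = 1 then 0 else ?F (i - 1) b (map set M))" if "1 \<le> b" "b \<le> n" for b
    proof (cases "i = 1")
      case True
      then show ?thesis using zero by simp
    next
      case False
      then show ?thesis using X[of "i - 1"] X[OF that] assms last by simp
    qed
    moreover have "follow_count (?X i) (?X b) (set (M ! (n - 1))) = ?F i b (map set M)" if "1 \<le> b" "b \<le> n" for b
      using X[of i] X[OF that] assms last by simp
    moreover have "1 \<le> j - 1" "j - 1 \<le> n" "1 \<le> j" using assms by simp_all
    ultimately show "of_bool (cyclically_followed (projected_word M) i j) = ?G (map set M)"
      using assms(3) by (simp only:)
  qed
  also have "\<dots> = sum ?G ?D" by (rule sum_continuous_mlq)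
  also have "\<dots> = (total_follow n i (j - 1) - (if i = 1 then 0 else total_follow n (i - 1) (j - 1)))
    - (total_follow n i j - (if i = 1 then 0 else total_follow n (i - 1) j))"
    unfolding total_follow_def by (cases "i = 1") (simp_all add: sum_subtractf del: upt_Suc)
  finally show ?thesis .
qed

lemma ratio_difference:
  fixes n j :: real
  assumes "n + j - 1 > 0"
  shows "(n - j + 1) / (n + j - 1) - (n - j) / (n + j) = 2 * n / ((n + j) * (n + j - 1))"
proof -
  have "n + j > 0" using assms by simp
  then have "(n - j + 1) / (n + j - 1) - (n - j) / (n + j) =
      ((n - j + 1) * (n + j) - (n - j) * (n + j - 1)) / ((n + j - 1) * (n + j))"
    using assms by (intro diff_frac_eq) simp_all
  also have "(n - j + 1) * (n + j) - (n - j) * (n + j - 1) = 2 * n" by (simp add: algebra_simps)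
  finally show ?thesis by (simp add: mult.commute)
qed

lemma choose_two_ratio:
  assumes "a > 0"
  shows "x / real ((n + a) choose 2) = 2 * x / ((real n + real a) * (real n + real a - 1))"
proof -
  have "even ((n + a) * (n + a - 1))" by (cases "even (n + a)") auto
  then have "(n + a choose 2) * 2 = (n + a) * (n + a - 1)"
    unfolding choose_two by (rule dvd_div_mult_self)
  then have "real (n + a choose 2) * 2 = real (n + a) * real (n + a - 1)"
    by (metis of_nat_mult of_nat_numeral)
  then have "real (n + a choose 2) = (real n + real a) * (real n + real a - 1) / 2"
    using assms by (simp add: of_nat_diff)
  then show ?thesis by (simp only: divide_divide_eq_right mult.commute[of x 2])
qed

theorem theorem1p2:
  fixes n i j :: nat
  assumes "n \<ge> 2" and "1 \<le> i" and "i < j" and "j \<le> n"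
  shows "(i + 1 < j \<longrightarrow> correlation i j n = real n / real ((n + j) choose 2)) \<and>
         (i + 1 = j \<longrightarrow> correlation i j n =
            real n / real ((n + j) choose 2) + real (n * i) / real ((n + i) choose 2))"
proof -
  let ?D = "staircases n"
  have "real (card ?D) = real (card (continuous_mlq (replicate n 1)))"
    using sum_continuous_mlq[of "\<lambda>_. 1 :: real" n] by (simp del: upt_Suc)
  then have D: "real (card ?D) > 0"
    using continuous_mlq_nonempty finite_continuous_mlq by (simp add: card_gt_0_iff)
  define d where "d = real (card ?D)"
  have d: "d \<noteq> 0" using D unfolding d_def by linarith
  define r where "r a = (real n - a) / (real n + a)" for a :: real
  \<comment> \<open>Linearity in a makes the differences in the first argument equal to
    \<open>r b\<close> times d, independently of a.\<close>
  have lower: "total_follow n a b = real a * r (real b) * d" if "1 \<le> a" "a < b" "b \<le> n" for a b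
  proof (cases "b = n")
    case True
    then show ?thesis using total_follow_last[of n a] assms(1) by (simp add: r_def)
  next
    case False
    then show ?thesis using total_follow_less[of a b n] that by (simp add: d_def r_def of_nat_diff del: upt_Suc)
  qed
  have prev: "(if i = 1 then 0 else total_follow n (i - 1) b) = (real i - 1) * r (real b) * d"
    if "i \<le> b" "b \<le> n" for b
    using lower[of "i - 1" b] that assms(2) by (simp add: of_nat_diff)
  have j1: "real (j - 1) = real j - 1" using assms by (simp add: of_nat_diff)
  have step: "r (real j - 1) - r (real j) = real n / real ((n + j) choose 2)"
  proof -
    have "r (real j - 1) = (real n - real j + 1) / (real n + real j - 1)"
      unfolding r_def by (rule arg_cong2[of _ _ _ _ "(/)"]) simp_all
    then show ?thesis
      using ratio_difference[of "real n" "real j"] choose_two_ratio[of j "real n" n] assms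
      by (simp add: r_def)
  qed
  have corr: "correlation i j n * d = (total_follow n i (j - 1) - (real i - 1) * r (real j - 1) * d)
      - (real i * r (real j) * d - (real i - 1) * r (real j) * d)"
    using correlation_eq_total[OF assms(2-4)] prev[of "j - 1"] prev[of j] lower[of i j] assms j1
    unfolding d_def[symmetric] by simp
  show ?thesis
  proof (intro conjI impI)
    assume "i + 1 < j"
    then have "total_follow n i (j - 1) = real i * r (real j - 1) * d"
      using lower[of i "j - 1"] assms j1 by simp
    then have "correlation i j n * d = (r (real j - 1) - r (real j)) * d"
      unfolding corr by (simp add: algebra_simps)
    then have "correlation i j n = r (real j - 1) - r (real j)" using d by simp
    then show "correlation i j n = real n / real ((n + j) choose 2)" using step by simp
  next
    assume ij: "i + 1 = j"
    let ?s = "2 * real n / ((real n + real i) * (real n + real i - 1))"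
    have "i < n" using assms by simp
    then have "total_follow n i (j - 1) = real i * ((real n - real i + 1) / (real n + real i - 1)) * d"
      using total_follow_eq[of i n] assms ij by (auto simp: d_def of_nat_diff simp del: upt_Suc)
    \<comment> \<open>The diagonal value exceeds the linear formula by i times \<open>?s\<close>,
      which becomes the additional summand.\<close>
    moreover have "(real n - real i + 1) / (real n + real i - 1) = r (real i) + ?s"
      using ratio_difference[of "real n" "real i"] assms by (simp add: r_def)
    moreover have "real j - 1 = real i" using ij by simp
    ultimately have "correlation i j n * d = (r (real j - 1) - r (real j) + real i * ?s) * d"
      unfolding corr by (simp only:) (simp only: algebra_simps)
    then have "correlation i j n = r (real j - 1) - r (real j) + real i * ?s"
      using d by (simp only: mult_cancel_right simp_thms)
    then have "correlation i j n = real n / real ((n + j) choose 2) + real i * ?s"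
      unfolding step .
    also have "real i * ?s = real (n * i) / real ((n + i) choose 2)"
      using choose_two_ratio[of i "real (n * i)" n] assms by simp
    finally show "correlation i j n =
        real n / real ((n + j) choose 2) + real (n * i) / real ((n + i) choose 2)" .
  qed
qed

end
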